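(* Let $a\in\mathbb{R}$, $I\in\mathbb{I}_{a+}$, $m\in\mathbb{N}^*$, $q_a\in\mathbb{R}^m$, $\alpha=(\alpha_i)\in(0,1]^m$, $A=(A_{ij})\in\mathrm{L}^\infty_{\mathrm{loc}}(I,\mathbb{R}^{m\times m})$ and $B=(B_i)\in\mathrm{L}^\infty_{\mathrm{loc}}(I,\mathbb{R}^m)$. Let $Z(\cdot,\cdot)$ (resp. ${}_{\mathrm c}Z(\cdot,\cdot)$) be the left Riemann-Liouville (resp. left Caputo) state-transition matrix associated to $A$ and $\overline{\alpha}\in(0,1]^{m\times m}$. Then the non-homogeneous linear vector Cauchy problem $${}_{\mathrm c}\mathrm{D}^\alpha_{a+}[q](t)=A(t)\times q(t)+B(t),\qquad q(a)=q_a$$ admits a unique maximal solution, that is moreover global, denoted by $q$, and it is given by $$q(t)={}_{\mathrm c}Z(t,a)\times q_a+\int_a^t Z(t,s)\times B(s)\,ds$$ for every $t\in I$.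
   Context: $\mathbb{N}^*$ is the set of positive integers; $\times$ denotes the usual matrix-matrix or matrix-vector product and $\mathrm{Id}_m$ the identity matrix. For $a\in\mathbb{R}$, $\mathbb{I}_{a+}$ denotes the set of intervals $I\subset\mathbb{R}$ with $\{a\}\subsetneq I\subset[a,+\infty)$ (not necessarily compact). $\mathrm{L}^1_{\mathrm{loc}}(I)$, $\mathrm{L}^\infty_{\mathrm{loc}}(I)$, $\mathrm{AC}_{\mathrm{loc}}(I)$ are the sets of functions on $I$ that are respectively integrable, essentially bounded, absolutely continuous on every compact subinterval of $I$; $\mathrm{C}(I)$ is the set of continuous functions. Left fractional operators. Let $I\in\mathbb{I}_{a+}$ and $q\in \mathrm{L}^1_{\mathrm{loc}}(I,\mathbb{R})$. For a real $\alpha>0$, $\mathrm{I}^\alpha_{a+}[q](t):=\int_a^t\frac{1}{\Gamma(\alpha)}(t-\tau)^{\alpha-1}q(\tau)\,d\tau$ (defined for a.e. $t\in I$), and $\mathrm{I}^0_{a+}[q]:=q$; if $\mathrm{I}^\alpha_{a+}[q]$ is a.e. equal to a continuous function, it is identified with it. For $0\le\alpha\le1$, $\mathrm{AC}^\alpha_{a+}(I,\mathbb{R})$ is the set of $q\in \mathrm{L}^1_{\mathrm{loc}}(I,\mathbb{R})$ with $\mathrm{I}^{1-\alpha}_{a+}[q]\in\mathrm{AC}_{\mathrm{loc}}(I,\mathbb{R})$, and then $\mathrm{D}^\alpha_{a+}[q]:=\frac{d}{dt}\mathrm{I}^{1-\alpha}_{a+}[q]$ a.e. on $I$. ${}_{\mathrm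 c}\mathrm{AC}^\alpha_{a+}(I,\mathbb{R})$ is the set of $q\in\mathrm{C}(I,\mathbb{R})$ with $q-q(a)\in\mathrm{AC}^\alpha_{a+}(I,\mathbb{R})$, and then ${}_{\mathrm c}\mathrm{D}^\alpha_{a+}[q]:=\mathrm{D}^\alpha_{a+}[q-q(a)]$. For vector or matrix functions and a vector or matrix multi-order $\alpha$ of the same size, everything is taken entrywise, each entry with the corresponding order. The same operators with base point $s$ instead of $a$ are denoted with the subscript $s+$. Solutions. A local solution of the Cauchy problem in the claim is a couple $(q,J)$ with $J\in\mathbb{I}_{a+}$, $J\subset I$, $q\in{}_{\mathrm c}\mathrm{AC}^\alpha_{a+}(J,\mathbb{R}^m)$, $q(a)=q_a$ and satisfying the differential equation for a.e. $t\in J$. A local solution $(q',J')$ is an extension of $(q,J)$ if $J\subset J'$ and $q'=q$ on $J$; $(q,J)$ is maximal if $J'=J$ for every extension $(q',J')$, and global if $J=I$. The analogous terminology is used for matrix Cauchy problems with base point $s$. For $\alpha=(\alpha_i)\in(0,1]^m$, $\overline{\alpha}\in(0,1]^{m\times m}$ is the row constant matrix with entries $\overline{\alpha}_{ij}=\alpha_i$. State-transition matrices. Let $\beta=(\beta_{ij})\in(0,1]^{m\times m}$. For $s\in I$, $s<\sup I$, put $I^s:=I\cap[s,+\infty)$. The matrix Cauchy problem $\mathrm{D}^\beta_{s+}[Z](t)=A(t)\times Z(t)$ for a.e. $t\in I^s$, $\mathrm{I}^{1-\beta}_{s+}[Z](s)=\mathrm{Id}_m$, admits a unique (global) solution in $\mathrm{AC}^\beta_{s+}(I^s,\mathbb{R}^{m\times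 m})$, denoted by $Z(\cdot,s)$; $Z(\cdot,\cdot)$ is the left Riemann-Liouville state-transition matrix associated to $A$ and $\beta$, and it satisfies $$Z(t,s)=\Big[\tfrac{1}{\Gamma(\beta)}(t-s)^{\beta-1}\Big]\otimes\mathrm{Id}_m+\int_s^t\Big[\tfrac{1}{\Gamma(\beta)}(t-\tau)^{\beta-1}\Big]\otimes\big[A(\tau)\times Z(\tau,s)\big]\,d\tau$$ for almost every $t,s\in I$ with $t>s$. The matrix Cauchy problem ${}_{\mathrm c}\mathrm{D}^\beta_{s+}[Z](t)=A(t)\times Z(t)$, $Z(s)=\mathrm{Id}_m$, admits a unique maximal solution, which is global, i.e. in ${}_{\mathrm c}\mathrm{AC}^\beta_{s+}(I^s,\mathbb{R}^{m\times m})$, denoted by ${}_{\mathrm c}Z(\cdot,s)$; ${}_{\mathrm c}Z(\cdot,\cdot)$ is the left Caputo state-transition matrix associated to $A$ and $\beta$, and it satisfies $${}_{\mathrm c}Z(t,s)=\mathrm{Id}_m+\int_s^t\Big[\tfrac{1}{\Gamma(\beta)}(t-\tau)^{\beta-1}\Big]\otimes\big[A(\tau)\times {}_{\mathrm c}Z(\tau,s)\big]\,d\tau$$ for every $t,s\in I$ with $t\ge s$. Here $\otimes$ is the Hadamard (entrywise) product and $\big[\frac{1}{\Gamma(\beta)}(t-\tau)^{\beta-1}\big]$ is the matrix with entries $\frac{1}{\Gamma(\beta_{ij})}(t-\tau)^{\beta_{ij}-1}$. *)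

theory Defs
  imports "HOL-Analysis.Analysis"
begin

text \<open>
  A function on an interval \<open>I\<close> is represented by a total function on \<open>real\<close>, of which only the
  values on \<open>I\<close> matter; \<open>R\<^sup>m\<close> is \<open>real^'m\<close>, with \<open>m = CARD('m)\<close> arbitrary and positive.
  Measurability, integrals and ``almost everywhere'' refer to Lebesgue measure.
\<close>

definition base_intervals :: "real \<Rightarrow> real set set" where
  "base_intervals a = {I. is_interval I \<and> {a} \<subset> I \<and> I \<subseteq> {a..}}"

subsection \<open>Local function spaces\<close>

definition L1_loc :: "real set \<Rightarrow> (real \<Rightarrow> real) set" where
  "L1_loc I = {q. \<forall>c d. {c..d} \<subseteq> I \<longrightarrow> q absolutely_integrable_on {c..d}}"

text \<open>On matrices and vectors this is equivalent to the entrywise condition.\<close>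

definition Linf_loc :: "real set \<Rightarrow> (real \<Rightarrow> 'b::euclidean_space) set" where
  "Linf_loc I = {f. \<forall>c d. {c..d} \<subseteq> I \<longrightarrow>
     f \<in> borel_measurable (lebesgue_on {c..d}) \<and>
     (\<exists>K. AE t in lebesgue. t \<in> {c..d} \<longrightarrow> norm (f t) \<le> K)}"

text \<open>
  Absolute continuity of a function of a real variable. A finite family of nonoverlapping
  subintervals \<open>[u,v]\<close> of \<open>[c,d]\<close> is given as a finite set of pairs \<open>(u,v)\<close> with \<open>u < v\<close>.
\<close>

definition AC_on :: "real \<Rightarrow> real \<Rightarrow> (real \<Rightarrow> real) \<Rightarrow> bool" where
  "AC_on c d f \<longleftrightarrow> (\<forall>\<epsilon>>0. \<exists>\<delta>>0. \<forall>P.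
     finite P \<and> (\<forall>(u,v)\<in>P. c \<le> u \<and> u < v \<and> v \<le> d) \<and>
     pairwise (\<lambda>p r. {fst p<..<snd p} \<inter> {fst r<..<snd r} = {}) P \<and>
     (\<Sum>(u,v)\<in>P. v - u) < \<delta>
     \<longrightarrow> (\<Sum>(u,v)\<in>P. \<bar>f v - f u\<bar>) < \<epsilon>)"

definition AC_loc :: "real set \<Rightarrow> (real \<Rightarrow> real) set" where
  "AC_loc I = {f. \<forall>c d. {c..d} \<subseteq> I \<longrightarrow> AC_on c d f}"

subsection \<open>Left fractional operators\<close>

definition frac_int_raw :: "real \<Rightarrow> real \<Rightarrow> (real \<Rightarrow> real) \<Rightarrow> real \<Rightarrow> real" where
  "frac_int_raw a \<alpha> q t =
     (if \<alpha> = 0 then q t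
      else LINT \<tau>:{a..t}|lebesgue. 1 / Gamma \<alpha> * (t - \<tau>) powr (\<alpha> - 1) * q \<tau>)"

definition cont_rep :: "real set \<Rightarrow> (real \<Rightarrow> real) \<Rightarrow> (real \<Rightarrow> real) \<Rightarrow> bool" where
  "cont_rep I f g \<longleftrightarrow> continuous_on I g \<and> (AE t in lebesgue. t \<in> I \<longrightarrow> f t = g t)"

text \<open>
  The fractional integral on \<open>I\<close>, identified with its continuous representative if it has one.
  On a nondegenerate interval \<open>I\<close> this representative is unique on \<open>I\<close>.
\<close>

definition frac_int :: "real \<Rightarrow> real set \<Rightarrow> real \<Rightarrow> (real \<Rightarrow> real) \<Rightarrow> real \<Rightarrow> real" where
  "frac_int a I \<alpha> q =
     (if \<exists>g. cont_rep I (frac_int_raw a \<alpha> q) g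
      then SOME g. cont_rep I (frac_int_raw a \<alpha> q) g
      else frac_int_raw a \<alpha> q)"

definition RL_AC :: "real \<Rightarrow> real set \<Rightarrow> real \<Rightarrow> (real \<Rightarrow> real) set" where
  "RL_AC a I \<alpha> = {q \<in> L1_loc I. frac_int a I (1 - \<alpha>) q \<in> AC_loc I}"

definition Caputo_AC :: "real \<Rightarrow> real set \<Rightarrow> real \<Rightarrow> (real \<Rightarrow> real) set" where
  "Caputo_AC a I \<alpha> = {q. continuous_on I q \<and> (\<lambda>t. q t - q a) \<in> RL_AC a I \<alpha>}"

text \<open>
  The fractional derivatives are only defined almost everywhere, hence are rendered as relations:
  \<open>has_RL_deriv a I \<alpha> q g\<close> says that the Riemann-Liouville derivative of \<open>q\<close>, which is the ordinary
  derivative of the fractional integral of order \<open>1 - \<alpha>\<close>, exists and equals \<open>g\<close> almost everywhere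
  on \<open>I\<close>. Since the endpoints of \<open>I\<close> form a null set, only the values of \<open>q\<close> on \<open>I\<close> matter.
\<close>

definition has_RL_deriv ::
    "real \<Rightarrow> real set \<Rightarrow> real \<Rightarrow> (real \<Rightarrow> real) \<Rightarrow> (real \<Rightarrow> real) \<Rightarrow> bool" where
  "has_RL_deriv a I \<alpha> q g \<longleftrightarrow>
     (AE t in lebesgue. t \<in> I \<longrightarrow> (frac_int a I (1 - \<alpha>) q has_real_derivative g t) (at t))"

definition has_Caputo_deriv ::
    "real \<Rightarrow> real set \<Rightarrow> real \<Rightarrow> (real \<Rightarrow> real) \<Rightarrow> (real \<Rightarrow> real) \<Rightarrow> bool" where
  "has_Caputo_deriv a I \<alpha> q g \<longleftrightarrow> has_RL_deriv a I \<alpha> (\<lambda>t. q t - q a) g"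

subsection \<open>State-transition matrices\<close>

text \<open>
  \<open>Z t s\<close> stands for \<open>Z(t,s)\<close>; only its values for \<open>t > s\<close> matter. For each \<open>s\<close>, the Cauchy problem
  determines \<open>Z(\<cdot>,s)\<close> almost everywhere. That class has exactly one representative that is
  continuous on \<open>I \<inter> (s, \<infinity>)\<close> (the one that satisfies the equivalent integral equation for every
  \<open>t > s\<close>), and \<open>Z(\<cdot>,s)\<close> is identified with it, so that \<open>Z(t,s)\<close> makes sense for every \<open>t > s\<close>.
\<close>

definition RL_state_transition ::
    "real set \<Rightarrow> (real \<Rightarrow> real^'m^'m) \<Rightarrow> real^'m^'m \<Rightarrow> (real \<Rightarrow> real \<Rightarrow> real^'m^'m) \<Rightarrow> bool" where
  "RL_state_transition I A \<beta> Z \<longleftrightarrow>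
     (\<forall>s\<in>I. (\<exists>u\<in>I. s < u) \<longrightarrow>
        (\<forall>i j. (\<lambda>t. Z t s $ i $ j) \<in> RL_AC s (I \<inter> {s..}) (\<beta> $ i $ j) \<and>
           has_RL_deriv s (I \<inter> {s..}) (\<beta> $ i $ j)
             (\<lambda>t. Z t s $ i $ j) (\<lambda>t. (A t ** Z t s) $ i $ j) \<and>
           frac_int s (I \<inter> {s..}) (1 - \<beta> $ i $ j) (\<lambda>t. Z t s $ i $ j) s = mat 1 $ i $ j) \<and>
        continuous_on (I \<inter> {s<..}) (\<lambda>t. Z t s))"

definition Caputo_state_transition ::
    "real set \<Rightarrow> (real \<Rightarrow> real^'m^'m) \<Rightarrow> real^'m^'m \<Rightarrow> (real \<Rightarrow> real \<Rightarrow> real^'m^'m) \<Rightarrow> bool" where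
  "Caputo_state_transition I A \<beta> Z \<longleftrightarrow>
     (\<forall>s\<in>I. (\<exists>u\<in>I. s < u) \<longrightarrow>
        (\<forall>i j. (\<lambda>t. Z t s $ i $ j) \<in> Caputo_AC s (I \<inter> {s..}) (\<beta> $ i $ j) \<and>
           has_Caputo_deriv s (I \<inter> {s..}) (\<beta> $ i $ j)
             (\<lambda>t. Z t s $ i $ j) (\<lambda>t. (A t ** Z t s) $ i $ j)) \<and>
        Z s s = mat 1)"

definition row_constant :: "real^'m \<Rightarrow> real^'m^'m" where
  "row_constant \<alpha> = (\<chi> i j. \<alpha> $ i)"

subsection \<open>Linear Caputo Cauchy problems\<close>

definition local_solution ::
    "real \<Rightarrow> real set \<Rightarrow> real^'m \<Rightarrow> (real \<Rightarrow> real^'m^'m) \<Rightarrow> (real \<Rightarrow> real^'m) \<Rightarrow> real^'m \<Rightarrow>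
     (real \<Rightarrow> real^'m) \<Rightarrow> real set \<Rightarrow> bool" where
  "local_solution a I \<alpha> A B q\<^sub>a q J \<longleftrightarrow>
     J \<in> base_intervals a \<and> J \<subseteq> I \<and>
     (\<forall>i. (\<lambda>t. q t $ i) \<in> Caputo_AC a J (\<alpha> $ i)) \<and>
     q a = q\<^sub>a \<and>
     (\<forall>i. has_Caputo_deriv a J (\<alpha> $ i) (\<lambda>t. q t $ i) (\<lambda>t. (A t *v q t + B t) $ i))"

definition maximal_solution ::
    "real \<Rightarrow> real set \<Rightarrow> real^'m \<Rightarrow> (real \<Rightarrow> real^'m^'m) \<Rightarrow> (real \<Rightarrow> real^'m) \<Rightarrow> real^'m \<Rightarrow>
     (real \<Rightarrow> real^'m) \<Rightarrow> real set \<Rightarrow> bool" where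
  "maximal_solution a I \<alpha> A B q\<^sub>a q J \<longleftrightarrow>
     local_solution a I \<alpha> A B q\<^sub>a q J \<and>
     (\<forall>q' J'. local_solution a I \<alpha> A B q\<^sub>a q' J' \<and> J \<subseteq> J' \<and> (\<forall>t\<in>J. q' t = q t) \<longrightarrow> J' = J)"

end

theory Submission
  imports Defs
begin

text \<open>
  All Cauchy problems are turned into Volterra equations with the kernel
  \<open>u powr (\<alpha> - 1) / Gamma \<alpha>\<close>; the passage uses the fundamental theorem of calculus for absolutely
  continuous functions, Lebesgue differentiation, and the semigroup law of the kernels (Beta
  integral). For the weight \<open>exp (- l * t)\<close> with \<open>l\<close> large, convolution with the kernel is a
  contraction in \<open>L\<^sup>1\<close>, which gives uniqueness. The same contraction makes the Picard iterates of the
  Riemann-Liouville problem, which are jointly measurable in \<open>(t,s)\<close>, converge to \<open>Z(t,s)\<close> for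
  almost every \<open>t\<close>; hence \<open>Z\<close> is jointly measurable and \<open>\<integral> |Z(t,s)| ds\<close> is locally bounded in
  \<open>t\<close>. Integrating the equation of \<open>Z(\<cdot>,s)\<close> against \<open>B(s)\<close> and applying Fubini then shows that
  \<open>\<integral> Z(t,s) B(s) ds\<close> solves the inhomogeneous equation with zero initial value.
\<close>

section \<open>Absolutely continuous functions and Lebesgue differentiation\<close>

text \<open>The hypotheses say nothing about how \<open>Z t s\<close> depends on \<open>s\<close>:
  for each \<open>s\<close> it solves a problem of its own. Joint measurability, without which
  Fubini is out of reach, must come from a construction, and explicit iterates supply it. They
  cannot be controlled in a supremum norm, because for orders below 1 the solution blows up like (t
  - s) powr (\<alpha> - 1) at the diagonal. Hence the integral norms, and with them statements valid
  only for almost every t. The exceptional sets are removed in two ways: convolution ignores null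
  sets, so one more use of the integral equation is valid at every t; and continuous functions that
  agree almost everywhere on an interval agree. The contraction fixes \<open>s\<close> and
  integrates over t, whereas the formula fixes t and integrates over \<open>s\<close>. The second
  bound rests on another property of the same kernel: exp (l * t) is an eigenfunction of the
  convolution. All work is done on one compact interval {a..T} at a time, with data replaced by
  Borel functions that vanish outside it, so that every integral runs over the whole line.\<close>

lemma AC_fundamental_theorem:
  fixes F g :: "real \<Rightarrow> real"
  assumes "c \<le> d" and AC: "AC_on c d F"
    and der: "AE t in lebesgue. t \<in> {c..d} \<longrightarrow> (F has_real_derivative g t) (at t)"
  shows "(g has_integral (F d - F c)) {c..d}"
proof (cases "c = d")
  case True
  then show ?thesis using has_integral_refl(2)[of g c] by simp
next
  case False
  with \<open>c \<le> d\<close> have cd: "c < d" by simp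
  obtain N where N: "N \<in> null_sets lebesgue"
    and Nder: "\<And>t. t \<notin> N \<Longrightarrow> t \<in> {c..d} \<Longrightarrow> (F has_real_derivative g t) (at t)"
    using AE_E3[OF der] by auto
  have negN: "negligible N" using N by (simp add: negligible_iff_null_sets)
  \<comment> \<open>With the value 0 on \<open>N\<close>, a tag in \<open>N\<close> contributes
    nothing but the increment of \<open>F\<close>.\<close>
  define g0 where "g0 = (\<lambda>t. if t \<in> N then 0 else g t)"
  have "(g0 has_integral (F d - F c)) {c..d}"
    unfolding has_integral_real
  proof (intro allI impI)
    fix e :: real assume e: "e > 0"
    obtain \<delta> where \<delta>: "\<delta> > 0" and ACd: "\<And>P. finite P \<Longrightarrow> (\<forall>(u,v)\<in>P. c \<le> u \<and> u < v \<and> v \<le> d) \<Longrightarrow>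
         pairwise (\<lambda>p r. {fst p<..<snd p} \<inter> {fst r<..<snd r} = {}) P \<Longrightarrow>
         (\<Sum>(u,v)\<in>P. v - u) < \<delta> \<Longrightarrow> (\<Sum>(u,v)\<in>P. \<bar>F v - F u\<bar>) < e/2"
      using AC[unfolded AC_on_def, rule_format, of "e/2"] e by auto
    obtain U where U: "open U" "N \<subseteq> U" "U \<in> lmeasurable" "measure lebesgue U < \<delta>"
    proof -
      have "N \<in> sets lebesgue" using N by auto
      then obtain U where U: "open U" "N \<subseteq> U" "U - N \<in> lmeasurable" "emeasure lebesgue (U - N) < ennreal \<delta>"
        using sets_lebesgue_outer_open \<delta> by blast
      have em: "emeasure lebesgue U = emeasure lebesgue (U - N)"
        using N U(1) by (simp add: emeasure_Diff_null_set lborelD)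
      have 1: "U \<in> lmeasurable"
        using em U(1) order.strict_trans[OF U(4), of top]
        by (intro fmeasurableI) (auto simp: lborelD)
      have "measure lebesgue U < \<delta>"
        using U(4) unfolding em[symmetric] emeasure_eq_measure2[OF 1] by (simp add: ennreal_less_iff)
      with 1 U show ?thesis by (intro that) auto
    qed
    \<comment> \<open>Spreads the error e/2 over the total length d - c; the other e/2 is reserved
      for tags in \<open>N\<close>.\<close>
    define e' where "e' = e / (2 * (d - c))"
    have e': "e' > 0" using e cd by (simp add: e'_def)
    have "\<forall>x. \<exists>r>0. x \<in> {c..d} - N \<longrightarrow>
         (\<forall>y. norm (y-x) < r \<longrightarrow> norm (F y - F x - (y-x) *\<^sub>R g x) \<le> e' * norm (y-x))"
    proof
      fix x
      show "\<exists>r>0. x \<in> {c..d} - N \<longrightarrow>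
         (\<forall>y. norm (y-x) < r \<longrightarrow> norm (F y - F x - (y-x) *\<^sub>R g x) \<le> e' * norm (y-x))"
      proof (cases "x \<in> {c..d} - N")
        case True
        then have "(F has_vector_derivative g x) (at x)"
          using Nder by (auto simp: has_real_derivative_iff_has_vector_derivative)
        then show ?thesis
          using e' unfolding has_vector_derivative_def has_derivative_at_alt by blast
      qed (auto intro: exI[of _ 1])
    qed
    then obtain r where r: "\<And>x. 0 < r x"
      and rder: "\<And>x y. \<lbrakk>x \<in> {c..d} - N; norm (y-x) < r x\<rbrakk> \<Longrightarrow> norm (F y - F x - (y-x) *\<^sub>R g x) \<le> e' * norm (y-x)"
      by metis
    \<comment> \<open>A tag off \<open>N\<close> gets its radius of differentiability. A tag in
      \<open>N\<close> is confined to the small open set \<open>U\<close>, so that all such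
      intervals together have length below \<delta> and absolute continuity bounds their
      increments.\<close>
    define \<gamma> where "\<gamma> = (\<lambda>x. if x \<in> N then U else ball x (r x))"
    have gauge: "gauge \<gamma>" using U r by (auto simp: gauge_def \<gamma>_def)
    have main: "norm ((\<Sum>(x, k)\<in>p. measure lborel k *\<^sub>R g0 x) - (F d - F c)) < e"
      if ptag: "p tagged_division_of {c..d}" and fine: "\<gamma> fine p" for p
    proof -
      have finp: "finite p" using ptag by auto
      note ptagb = ptag[unfolded box_real[symmetric]]
      have ba: "d - c = (\<Sum>(x,K)\<in>p. Sup K - Inf K)" "F d - F c = (\<Sum>(x,K)\<in>p. F(Sup K) - F(Inf K))"
        using additive_tagged_division_1[where f= "\<lambda>x. x"] additive_tagged_division_1[where f= F]
              \<open>c \<le> d\<close> ptag by auto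
      define h where "h = (\<lambda>(x,K). measure lborel K *\<^sub>R g0 x - (F (Sup K) - F (Inf K)))"
      have Kform: "\<exists>u v. K = {u..v} \<and> u \<le> v \<and> c \<le> u \<and> v \<le> d \<and> x \<in> {u..v}" if xK: "(x,K) \<in> p" for x K
      proof -
        obtain u v where "K = cbox u v" "x \<in> K" "K \<subseteq> {c..d}" using ptag xK by blast
        then show ?thesis by (auto intro!: exI[of _ u] exI[of _ v])
      qed
      have eq: "(\<Sum>(x, k)\<in>p. measure lborel k *\<^sub>R g0 x) - (F d - F c) = (\<Sum>z\<in>p. h z)"
        unfolding ba h_def by (simp add: sum_subtractf split_def)
      define p1 where "p1 = {z\<in>p. fst z \<notin> N}"
      define p2 where "p2 = {z\<in>p. fst z \<in> N}"
      \<comment> \<open>\<open>AC_on\<close> speaks of pairs u < v only; degenerate intervals have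
        no increment and are dropped.\<close>
      define p3 where "p3 = {z\<in>p2. Inf (snd z) < Sup (snd z)}"
      have split: "(\<Sum>z\<in>p. h z) = (\<Sum>z\<in>p1. h z) + (\<Sum>z\<in>p2. h z)"
        unfolding p1_def p2_def using finp
        by (subst sum.union_disjoint[symmetric]) (auto intro: sum.cong)
      have "norm (\<Sum>z\<in>p1. h z) \<le> (\<Sum>(x,K)\<in>p1. e' * (Sup K - Inf K))"
      proof (rule sum_norm_le, safe)
        fix x K assume "(x,K) \<in> p1"
        then have xK: "(x,K) \<in> p" "x \<notin> N" by (auto simp: p1_def)
        obtain u v where K: "K = {u..v}" "u \<le> v" "c \<le> u" "v \<le> d" "x \<in> {u..v}" using Kform[OF xK(1)] by blast
        have Kb: "K \<subseteq> ball x (r x)" using fineD[OF fine xK(1)] xK(2) by (simp add: \<gamma>_def)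
        then have uv: "norm (u - x) < r x" "norm (v - x) < r x"
          using K subsetD[OF Kb, of u] subsetD[OF Kb, of v] by (auto simp: dist_real_def)
        have x: "x \<in> {c..d} - N" using K xK by auto
        \<comment> \<open>The tag lies between u and v, so the distances |u - x| and |v - x| add up
          to the length of K.\<close>
        have "norm (h (x,K)) = norm (F u - F x - (u - x) *\<^sub>R g x - (F v - F x - (v - x) *\<^sub>R g x))"
          using K xK by (simp add: h_def g0_def algebra_simps)
        also have "\<dots> \<le> norm (F u - F x - (u - x) *\<^sub>R g x) + norm (F v - F x - (v - x) *\<^sub>R g x)"
          by (rule norm_triangle_ineq4)
        also have "\<dots> \<le> e' * norm (u - x) + e' * norm (v - x)"
          using rder[OF x uv(1)] rder[OF x uv(2)] by simp
        also have "\<dots> = e' * (Sup K - Inf K)"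
          using K by (simp add: abs_if algebra_simps)
        finally show "norm (h (x,K)) \<le> e' * (Sup K - Inf K)" .
      qed
      also have "\<dots> \<le> (\<Sum>(x,K)\<in>p. e' * (Sup K - Inf K))"
      proof (rule sum_mono2[OF finp])
        show "p1 \<subseteq> p" by (auto simp: p1_def)
        fix b assume "b \<in> p - p1"
        then obtain x K where b: "b = (x,K)" "(x,K) \<in> p" by (cases b) auto
        then show "0 \<le> (case b of (x,K) \<Rightarrow> e' * (Sup K - Inf K))"
          using Kform[OF b(2)] e' by auto
      qed
      also have "\<dots> = e' * (d - c)" unfolding ba by (simp add: sum_distrib_left split_def)
      also have "\<dots> = e/2" using cd by (simp add: e'_def divide_simps)
      finally have 1: "norm (\<Sum>z\<in>p1. h z) \<le> e/2" .
      have "norm (\<Sum>z\<in>p2. h z) \<le> (\<Sum>(x,K)\<in>p2. \<bar>F (Sup K) - F (Inf K)\<bar>)"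
        by (rule sum_norm_le) (auto simp: h_def g0_def p2_def)
      also have "\<dots> = (\<Sum>(x,K)\<in>p3. \<bar>F (Sup K) - F (Inf K)\<bar>)"
      proof (rule sum.mono_neutral_right)
        show "finite p2" using finp by (simp add: p2_def)
        show "p3 \<subseteq> p2" by (auto simp: p3_def)
        show "\<forall>i\<in>p2 - p3. (case i of (x, K) \<Rightarrow> \<bar>F (Sup K) - F (Inf K)\<bar>) = 0"
        proof
          fix i assume i: "i \<in> p2 - p3"
          obtain x K where xK: "i = (x,K)" by (cases i)
          then have "(x,K) \<in> p" using i by (auto simp: p2_def)
          from Kform[OF this] obtain u v where "K = {u..v}" "u \<le> v" by blast
          then show "(case i of (x, K) \<Rightarrow> \<bar>F (Sup K) - F (Inf K)\<bar>) = 0"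
            using i xK by (auto simp: p3_def)
        qed
      qed
      finally have 2: "norm (\<Sum>z\<in>p2. h z) \<le> (\<Sum>(x,K)\<in>p3. \<bar>F (Sup K) - F (Inf K)\<bar>)" .
      define \<phi> where "\<phi> = (\<lambda>z::real\<times>real set. (Inf (snd z), Sup (snd z)))"
      have disj: "{Inf K<..<Sup K} \<inter> {Inf L<..<Sup L} = {}" if "(x,K) \<in> p3" "(y,L) \<in> p3" "(x,K) \<noteq> (y,L)" for x y K L
      proof -
        have in_p: "(x,K) \<in> p" "(y,L) \<in> p" using that by (auto simp: p3_def p2_def)
        have "interior K \<inter> interior L = {}" using tagged_division_ofD(5)[OF ptag in_p that(3)] .
        then show ?thesis using Kform[OF in_p(1)] Kform[OF in_p(2)] by (auto simp: interior_atLeastAtMost_real)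
      qed
      \<comment> \<open>\<open>AC_on\<close> takes a set of end point pairs, so different tagged
        intervals must not collapse to one pair: with equal end points, two nondegenerate intervals
        would have overlapping interiors.\<close>
      have inj: "inj_on \<phi> p3"
      proof (rule inj_onI, rule ccontr)
        fix z w assume zw: "z \<in> p3" "w \<in> p3" "\<phi> z = \<phi> w" "z \<noteq> w"
        obtain x K y L where xy: "z = (x,K)" "w = (y,L)" by (cases z, cases w)
        have "{Inf K<..<Sup K} \<inter> {Inf L<..<Sup L} = {}" using disj zw xy by blast
        moreover have "Inf K = Inf L" "Sup K = Sup L" "Inf K < Sup K" using zw xy by (auto simp: \<phi>_def p3_def)
        ultimately show False using dense[of "Inf K" "Sup K"] by auto
      qed
      have fin3: "finite p3" using finp by (simp add: p3_def p2_def)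
      have sumeq: "(\<Sum>(x,K)\<in>p3. f (Inf K) (Sup K)) = (\<Sum>(u,v)\<in>\<phi> ` p3. f u v)" for f :: "real \<Rightarrow> real \<Rightarrow> real"
        by (subst sum.reindex[OF inj]) (simp add: \<phi>_def split_def)
      have "(\<Sum>(x,K)\<in>p3. \<bar>F (Sup K) - F (Inf K)\<bar>) < e/2"
        unfolding sumeq[of "\<lambda>u v. \<bar>F v - F u\<bar>"]
      proof (rule ACd)
        show "finite (\<phi> ` p3)" using fin3 by simp
        show "\<forall>(u, v)\<in>\<phi> ` p3. c \<le> u \<and> u < v \<and> v \<le> d"
        proof safe
          fix u v x K assume "(u,v) = \<phi> (x,K)" "(x,K) \<in> p3"
          moreover from this have "(x,K) \<in> p" by (auto simp: p3_def p2_def)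
          from Kform[OF this] obtain u' v' where "K = {u'..v'}" "u' \<le> v'" "c \<le> u'" "v' \<le> d" by blast
          ultimately show "c \<le> u" "u < v" "v \<le> d" by (auto simp: \<phi>_def p3_def)
        qed
        show "pairwise (\<lambda>p r. {fst p<..<snd p} \<inter> {fst r<..<snd r} = {}) (\<phi> ` p3)"
        proof (rule pairwiseI)
          fix z w assume zw: "z \<in> \<phi> ` p3" "w \<in> \<phi> ` p3" "z \<noteq> w"
          then obtain x K y L where *: "z = \<phi> (x,K)" "(x,K) \<in> p3" "w = \<phi> (y,L)" "(y,L) \<in> p3" by auto
          then have "(x,K) \<noteq> (y,L)" using zw by auto
          from disj[OF *(2,4) this] show "{fst z<..<snd z} \<inter> {fst w<..<snd w} = {}"
            by (simp add: * \<phi>_def)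
        qed
        have p3t: "p3 tagged_partial_division_of cbox c d"
        proof (rule tagged_partial_division_subset)
          show "p tagged_partial_division_of cbox c d"
            using ptagb by (simp add: tagged_division_of_def)
        qed (auto simp: p3_def p2_def)
        have inj': "inj_on snd p3" using inj_onD[OF inj] by (intro inj_onI) (simp add: \<phi>_def)
        have "(\<Sum>(u,v)\<in>\<phi> ` p3. v - u) = (\<Sum>(x,K)\<in>p3. Sup K - Inf K)"
          by (rule sumeq[of "\<lambda>u v. v - u", symmetric])
        also have "\<dots> = (\<Sum>z\<in>p3. measure lebesgue (snd z))"
        proof (rule sum.cong[OF refl], safe)
          fix x K assume "(x,K) \<in> p3"
          then have "(x,K) \<in> p" by (auto simp: p3_def p2_def)
          from Kform[OF this] show "Sup K - Inf K = measure lebesgue (snd (x,K))" by auto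
        qed
        also have "\<dots> = (\<Sum>K\<in>snd ` p3. measure lebesgue K)"
          by (subst sum.reindex[OF inj']) simp
        also have "\<dots> = measure lebesgue (\<Union>(snd ` p3))"
          by (rule content_division[OF partial_division_of_tagged_division[OF p3t]])
        also have "\<dots> \<le> measure lebesgue U"
        proof (rule measure_mono_fmeasurable)
          show "\<Union> (snd ` p3) \<subseteq> U"
          proof (rule Union_least)
            fix K assume "K \<in> snd ` p3"
            then obtain x where "(x,K) \<in> p" "x \<in> N" by (auto simp: p3_def p2_def)
            with fineD[OF fine this(1)] show "K \<subseteq> U" by (simp add: \<gamma>_def)
          qed
          show "\<Union> (snd ` p3) \<in> sets lebesgue"
            using partial_division_of_tagged_division[OF p3t] by (blast intro: lmeasurable_division fmeasurableD)
        qed (use U in auto)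
        also have "\<dots> < \<delta>" using U by simp
        finally show "(\<Sum>(u,v)\<in>\<phi> ` p3. v - u) < \<delta>" .
      qed
      with 2 have "norm (\<Sum>z\<in>p2. h z) < e/2" by simp
      with 1 show ?thesis unfolding eq split
        using norm_triangle_ineq[of "\<Sum>z\<in>p1. h z" "\<Sum>z\<in>p2. h z"] by linarith
    qed
    show "\<exists>\<gamma>. gauge \<gamma> \<and> (\<forall>\<D>. \<D> tagged_division_of {c..d} \<and> \<gamma> fine \<D> \<longrightarrow>
        norm ((\<Sum>(x, k)\<in>\<D>. measure lborel k *\<^sub>R g0 x) - (F d - F c)) < e)"
    proof (intro exI conjI allI impI)
      show "gauge \<gamma>" by (rule gauge)
    qed (elim conjE, rule main)
  qed
  moreover have "g x = g0 x" if "x \<in> {c..d} - N" for x using that by (simp add: g0_def)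
  ultimately show ?thesis
    using has_integral_spike[OF negN, of "{c..d}" g g0] by blast
qed

section \<open>Lebesgue differentiation of primitives\<close>

lemma lebesgue_differentiation_right:
  fixes f :: "real \<Rightarrow> real"
  assumes "\<And>a b. f integrable_on {a..b}"
  obtains N where "negligible N"
    "\<And>x e. \<lbrakk>x \<notin> N; 0 < e\<rbrakk> \<Longrightarrow> \<exists>d>0. \<forall>h. 0 < h \<and> h < d \<longrightarrow> \<bar>integral {x..x+h} f / h - f x\<bar> < e"
proof -
  have "\<And>a b. f integrable_on cbox a b" using assms by simp
  from integrable_ccontinuous_explicit[OF this] obtain N where N: "negligible N"
    "\<And>x e. \<lbrakk>x \<notin> N; 0 < e\<rbrakk> \<Longrightarrow> \<exists>d>0. \<forall>h. 0 < h \<and> h < d \<longrightarrow>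
         norm(integral (cbox x (x + h *\<^sub>R One)) f /\<^sub>R h ^ DIM(real) - f x) < e" by metis
  show ?thesis
    by (rule that[OF N(1)]) (use N(2) in \<open>simp add: divide_inverse mult.commute\<close>)
qed

text \<open>The left difference quotient of f at t is the right one of the reflected function at -t,
  so the one-sided theorem is used twice and the second null set is reflected back.\<close>

lemma lebesgue_differentiation:
  fixes f :: "real \<Rightarrow> real"
  assumes int: "\<And>a b. f integrable_on {a..b}"
  shows "AE t in lebesgue. c < t \<longrightarrow> ((\<lambda>u. integral {c..u} f) has_real_derivative f t) (at t)"
proof -
  obtain N1 where N1: "negligible N1"
    "\<And>x e. \<lbrakk>x \<notin> N1; 0 < e\<rbrakk> \<Longrightarrow> \<exists>d>0. \<forall>h. 0 < h \<and> h < d \<longrightarrow> \<bar>integral {x..x+h} f / h - f x\<bar> < e"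
    using lebesgue_differentiation_right[OF int] by metis
  have int2: "(\<lambda>x. f (- x)) integrable_on {a..b}" for a b
    using Henstock_Kurzweil_Integration.integrable_reflect_real[where f = f and a = "-b" and b = "-a"] int[of "-b" "-a"] by simp
  obtain N2 where N2: "negligible N2"
    "\<And>x e. \<lbrakk>x \<notin> N2; 0 < e\<rbrakk> \<Longrightarrow> \<exists>d>0. \<forall>h. 0 < h \<and> h < d \<longrightarrow> \<bar>integral {x..x+h} (\<lambda>x. f (-x)) / h - f (-x)\<bar> < e"
    using lebesgue_differentiation_right[OF int2] by metis
  have aux: "\<bar>X - v * h\<bar> \<le> e * h" if "\<bar>X / h - v\<bar> < e" "h > 0" for X v h e :: real
  proof -
    have "X / h - v = (X - v * h) / h" using that by (simp add: diff_divide_distrib)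
    then show ?thesis using that by (simp add: abs_divide pos_divide_less_eq)
  qed
  define N where "N = N1 \<union> uminus ` N2"
  have "negligible N" unfolding N_def
    using N1(1) N2(1) negligible_differentiable_image_negligible[of N2 uminus] by (auto simp: differentiable_on_def)
  moreover have "((\<lambda>u. integral {c..u} f) has_real_derivative f t) (at t)" if t: "t \<notin> N" "c < t" for t
  proof -
    have t1: "t \<notin> N1" and t2: "-t \<notin> N2" using t by (auto simp: N_def image_iff)
    show ?thesis unfolding has_field_derivative_def has_derivative_at_alt
    proof (intro conjI allI impI)
      show "bounded_linear ((*) (f t))" by (rule bounded_linear_mult_right)
      fix e :: real assume e: "0 < e"
      obtain d1 where d1: "d1 > 0" "\<And>h. 0 < h \<Longrightarrow> h < d1 \<Longrightarrow> \<bar>integral {t..t+h} f / h - f t\<bar> < e"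
        using N1(2)[OF t1 e] by auto
      obtain d2 where d2: "d2 > 0" "\<And>h. 0 < h \<Longrightarrow> h < d2 \<Longrightarrow> \<bar>integral {-t..-t+h} (\<lambda>x. f (-x)) / h - f t\<bar> < e"
        using N2(2)[OF t2 e] by auto
      \<comment> \<open>The bound t - c keeps y to the right of c, so that the integrals from c can
        be split at y.\<close>
      define r where "r = min (min d1 d2) (t - c)"
      have "norm (integral {c..y} f - integral {c..t} f - f t * (y - t)) \<le> e * norm (y - t)"
        if y: "norm (y - t) < r" for y
      proof (cases "y = t")
        case True then show ?thesis by simp
      next
        case False
        then consider "y > t" | "y < t" by linarith
        then show ?thesis
        proof cases
          case 1
          have "integral {c..t} f + integral {t..y} f = integral {c..y} f"
            using t(2) 1 int by (intro Henstock_Kurzweil_Integration.integral_combine) auto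
          moreover have "\<bar>integral {t..y} f / (y - t) - f t\<bar> < e"
            using d1(2)[of "y - t"] 1 y by (simp add: r_def)
          then have "\<bar>integral {t..y} f - f t * (y - t)\<bar> \<le> e * (y - t)"
            using 1 by (intro aux) auto
          ultimately show ?thesis using 1 by (simp add: algebra_simps)
        next
          case 2
          have yc: "c < y" using y 2 by (simp add: r_def)
          have "integral {c..y} f + integral {y..t} f = integral {c..t} f"
            using yc 2 int by (intro Henstock_Kurzweil_Integration.integral_combine) auto
          moreover have "\<bar>integral {-t..-y} (\<lambda>x. f (-x)) / (t - y) - f t\<bar> < e"
            using d2(2)[of "t - y"] 2 y by (simp add: r_def)
          then have "\<bar>integral {y..t} f / (t - y) - f t\<bar> < e" 
            by (simp add: Henstock_Kurzweil_Integration.integral_reflect_real)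
          then have "\<bar>integral {y..t} f - f t * (t - y)\<bar> \<le> e * (t - y)"
            using 2 by (intro aux) auto
          ultimately have "\<bar>- (integral {c..y} f - integral {c..t} f - f t * (y - t))\<bar> \<le> e * (t - y)"
            by (simp add: algebra_simps)
          then show ?thesis using 2 by (simp only: abs_minus_cancel) (simp add: algebra_simps)
        qed
      qed
      moreover have "r > 0" using d1 d2 t by (simp add: r_def)
      ultimately show "\<exists>d>0. \<forall>y. norm (y - t) < d \<longrightarrow> norm (integral {c..y} f - integral {c..t} f - f t * (y - t)) \<le> e * norm (y - t)"
        by blast
    qed
  qed
  ultimately show ?thesis
    by (intro AE_I'[of N]) (auto simp: negligible_iff_null_sets)
qed

section \<open>The Riemann-Liouville kernel\<close>

text \<open>Vanishing on the left half line restricts a convolution over the whole line to the past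
  r < t. The base point is encoded in the other factor, which vanishes to the left of it.\<close>

definition rl_kernel :: "real \<Rightarrow> real \<Rightarrow> real" where
  "rl_kernel b u = (if u > 0 then u powr (b - 1) / Gamma b else 0)"

definition kconv :: "real \<Rightarrow> (real \<Rightarrow> real) \<Rightarrow> real \<Rightarrow> real" where
  "kconv b f t = (\<integral>r. rl_kernel b (t - r) * f r \<partial>lborel)"

text \<open>The Bochner integral in \<open>kconv\<close> is 0 by default when the integrand is not
  integrable; finiteness of this integral rules that case out.\<close>

abbreviation abs_kconv :: "real \<Rightarrow> (real \<Rightarrow> real) \<Rightarrow> real \<Rightarrow> ennreal" where
  "abs_kconv b f t \<equiv> (\<integral>\<^sup>+r. ennreal (rl_kernel b (t - r)) * ennreal \<bar>f r\<bar> \<partial>lborel)"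

lemma rl_kernel_nonneg [simp]: "0 < b \<Longrightarrow> 0 \<le> rl_kernel b u"
  by (simp add: rl_kernel_def Gamma_real_pos less_imp_le)

lemma rl_kernel_pos: "0 < b \<Longrightarrow> 0 < u \<Longrightarrow> 0 < rl_kernel b u"
  by (simp add: rl_kernel_def Gamma_real_pos)

lemma rl_kernel_eq_0 [simp]: "u \<le> 0 \<Longrightarrow> rl_kernel b u = 0"
  by (simp add: rl_kernel_def)

lemma rl_kernel_measurable [measurable]: "rl_kernel b \<in> borel_measurable borel"
  unfolding rl_kernel_def[abs_def] by measurable

text \<open>Order one is the Heaviside function: \<open>kconv 1\<close> is plain integration, and
  shifted copies serve as indicators to which the semigroup law applies.\<close>

lemma rl_kernel_1: "rl_kernel 1 u = (if u > 0 then 1 else 0)"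
  by (simp add: rl_kernel_def)

lemma rl_kernel_mono: "1 \<le> b \<Longrightarrow> u \<le> v \<Longrightarrow> rl_kernel b u \<le> rl_kernel b v"
  by (auto simp: rl_kernel_def Gamma_real_pos[THEN less_imp_le] intro!: divide_right_mono powr_mono2)

lemma rl_kernel_antimono: "0 < b \<Longrightarrow> b \<le> 1 \<Longrightarrow> 0 < u \<Longrightarrow> u \<le> v \<Longrightarrow> rl_kernel b v \<le> rl_kernel b u"
  by (auto simp: rl_kernel_def Gamma_real_pos[THEN less_imp_le] intro!: divide_right_mono powr_mono2')

section \<open>Laplace transform and semigroup law of the kernels\<close>

lemma nn_integral_translate:
  fixes h :: "real \<Rightarrow> ennreal"
  assumes [measurable]: "h \<in> borel_measurable borel"
  shows "(\<integral>\<^sup>+x. h (x - c) \<partial>lborel) = (\<integral>\<^sup>+x. h x \<partial>lborel)"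
  using nn_integral_real_affine[of h 1 "-c"] by (simp add: algebra_simps)

lemma nn_integral_reflect:
  fixes h :: "real \<Rightarrow> ennreal"
  assumes [measurable]: "h \<in> borel_measurable borel"
  shows "(\<integral>\<^sup>+x. h (c - x) \<partial>lborel) = (\<integral>\<^sup>+x. h x \<partial>lborel)"
  using nn_integral_real_affine[of h "-1" "c"] by (simp add: algebra_simps)

text \<open>Substitute x = l * u in Euler's integral for \<open>Gamma b\<close>. That the value
  tends to 0 as l grows is the source of the contraction.\<close>

lemma rl_kernel_laplace:
  assumes b: "0 < b" and l: "0 < l"
  shows "(\<integral>\<^sup>+u. ennreal (exp (- l * u)) * ennreal (rl_kernel b u) \<partial>lborel) = ennreal (l powr - b)"
proof -
  have "ennreal (Gamma b) = (\<integral>\<^sup>+x. ennreal (indicator {0..} x * x powr (b - 1) / exp x) \<partial>lborel)"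
    by (rule Gamma_conv_nn_integral_real[OF b])
  also have "\<dots> = \<bar>l\<bar> * (\<integral>\<^sup>+u. ennreal (indicator {0..} (0 + l * u) * (0 + l * u) powr (b - 1) / exp (0 + l * u)) \<partial>lborel)"
    by (rule nn_integral_real_affine) (use l in auto)
  also have "\<dots> = l * (\<integral>\<^sup>+u. ennreal (l powr (b - 1) * Gamma b) * (ennreal (exp (- l * u)) * ennreal (rl_kernel b u)) \<partial>lborel)"
  proof -
    have "(\<integral>\<^sup>+u. ennreal (indicator {0..} (0 + l * u) * (0 + l * u) powr (b - 1) / exp (0 + l * u)) \<partial>lborel)
        = (\<integral>\<^sup>+u. ennreal (l powr (b - 1) * Gamma b) * (ennreal (exp (- l * u)) * ennreal (rl_kernel b u)) \<partial>lborel)"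
    proof (rule nn_integral_cong)
      fix u :: real
      have G: "Gamma b > 0" using b by (rule Gamma_real_pos)
      have "indicator {0..} (l * u) * (l * u) powr (b - 1) / exp (l * u)
          = (l powr (b - 1) * Gamma b) * (exp (- l * u) * rl_kernel b u)"
      proof (cases "u > 0")
        case True
        then show ?thesis using l G
          by (simp add: rl_kernel_def powr_mult exp_minus field_simps)
      next
        case False
        then show ?thesis using l by (cases "u = 0") (auto simp: indicator_def zero_le_mult_iff)
      qed
      then show "ennreal (indicator {0..} (0 + l * u) * (0 + l * u) powr (b - 1) / exp (0 + l * u))
        = ennreal (l powr (b - 1) * Gamma b) * (ennreal (exp (- l * u)) * ennreal (rl_kernel b u))"
        using l G b by (simp add: ennreal_mult[symmetric])
    qed
    then show ?thesis using l by simp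
  qed
  also have "\<dots> = ennreal (l powr b * Gamma b) * (\<integral>\<^sup>+u. ennreal (exp (- l * u)) * ennreal (rl_kernel b u) \<partial>lborel)"
  proof -
    have e: "l * (l powr (b - 1) * Gamma b) = l powr b * Gamma b"
      using l by (simp add: powr_diff)
    have G: "Gamma b > 0" using b by (rule Gamma_real_pos)
    have e': "ennreal l * ennreal (l powr (b - 1) * Gamma b) = ennreal (l powr b * Gamma b)"
      using G l by (subst ennreal_mult[symmetric]) (simp_all only: e, simp_all)
    show ?thesis
      by (subst nn_integral_cmult) (simp_all only: mult.assoc[symmetric] e', simp_all)
  qed
  finally have *: "ennreal (Gamma b) = ennreal (l powr b * Gamma b) * (\<integral>\<^sup>+u. ennreal (exp (- l * u)) * ennreal (rl_kernel b u) \<partial>lborel)" .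
  have G: "Gamma b > 0" using b by (rule Gamma_real_pos)
  have "ennreal (l powr - b) = ennreal (1 / (l powr b * Gamma b)) * ennreal (Gamma b)"
    using G l by (subst ennreal_mult[symmetric]) (auto simp: powr_minus_divide)
  also have "\<dots> = (\<integral>\<^sup>+u. ennreal (exp (- l * u)) * ennreal (rl_kernel b u) \<partial>lborel)"
    using G l by (subst *, subst mult.assoc[symmetric], subst ennreal_mult[symmetric]) auto
  finally show ?thesis by simp
qed

text \<open>Scaling v = u * x maps the support to the unit interval and leaves Euler's Beta integral
  times a power of u.\<close>

lemma rl_kernel_semigroup:
  assumes a: "0 < a" and b: "0 < b"
  shows "(\<integral>\<^sup>+v. ennreal (rl_kernel a (u - v)) * ennreal (rl_kernel b v) \<partial>lborel) = ennreal (rl_kernel (a + b) u)"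
proof (cases "u > 0")
  case False
  then have "ennreal (rl_kernel a (u - v)) * ennreal (rl_kernel b v) = 0" for v
    by (cases "v > 0") auto
  then show ?thesis using False by (simp del: mult_eq_0_iff)
next
  case True
  have Ga: "Gamma a > 0" and Gb: "Gamma b > 0" and Gab: "Gamma (a + b) > 0"
    using a b by (auto intro: Gamma_real_pos)
  define C where "C = u powr (a - 1) * u powr (b - 1) / (Gamma a * Gamma b)"
  have C: "C \<ge> 0" using Ga Gb by (simp add: C_def)
  have "(\<integral>\<^sup>+v. ennreal (rl_kernel a (u - v)) * ennreal (rl_kernel b v) \<partial>lborel)
      = \<bar>u\<bar> * (\<integral>\<^sup>+x. ennreal (rl_kernel a (u - (0 + u * x))) * ennreal (rl_kernel b (0 + u * x)) \<partial>lborel)"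
    by (rule nn_integral_real_affine) (use True in auto)
  also have "(\<integral>\<^sup>+x. ennreal (rl_kernel a (u - (0 + u * x))) * ennreal (rl_kernel b (0 + u * x)) \<partial>lborel)
      = (\<integral>\<^sup>+x. ennreal C * ennreal (indicator {0<..<1} x * (x powr (b - 1) * (1 - x) powr (a - 1))) \<partial>lborel)"
  proof (rule nn_integral_cong)
    fix x :: real
    have "rl_kernel a (u - u * x) * rl_kernel b (u * x) = C * (indicator {0<..<1} x * (x powr (b - 1) * (1 - x) powr (a - 1)))"
    proof (cases "0 < x \<and> x < 1")
      case T: True
      have e: "u - u * x = u * (1 - x)" by (simp add: algebra_simps)
      have "u * (1 - x) > 0" "u * x > 0" using T True by auto
      then show ?thesis using T True unfolding e
        by (simp add: rl_kernel_def powr_mult C_def)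
    next
      case False
      then have "u * x \<le> 0 \<or> u - u * x \<le> 0" using True
        by (auto simp: not_less mult_nonneg_nonpos)
      then show ?thesis using False by auto
    qed
    then show "ennreal (rl_kernel a (u - (0 + u * x))) * ennreal (rl_kernel b (0 + u * x)) =
      ennreal C * ennreal (indicator {0<..<1} x * (x powr (b - 1) * (1 - x) powr (a - 1)))"
      using a b C by (simp add: ennreal_mult[symmetric])
  qed
  also have "\<dots> = ennreal C * (\<integral>\<^sup>+x. ennreal (indicator {0<..<1} x * (x powr (b - 1) * (1 - x) powr (a - 1))) \<partial>lborel)"
    by (rule nn_integral_cmult) measurable
  also have "(\<integral>\<^sup>+x. ennreal (indicator {0<..<1} x * (x powr (b - 1) * (1 - x) powr (a - 1))) \<partial>lborel) = ennreal (Beta b a)"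
  proof -
    have "((\<lambda>x. x powr (b - 1) * (1 - x) powr (a - 1)) has_integral Beta b a) {0<..<1}"
      using has_integral_Beta_real[OF b a] by (simp add: has_integral_Icc_iff_Ioo)
    from nn_integral_has_integral_lebesgue[OF _ this] show ?thesis by simp
  qed
  also have "ennreal \<bar>u\<bar> * (ennreal C * ennreal (Beta b a)) = ennreal (rl_kernel (a + b) u)"
  proof -
    have B: "Beta b a = Gamma a * Gamma b / Gamma (a + b)"
      by (simp add: Beta_def add.commute mult.commute)
    have e: "u powr (a + b - 1) = u * (u powr (a - 1) * u powr (b - 1))"
      using True by (simp add: powr_diff powr_add field_simps)
    have "\<bar>u\<bar> * (C * Beta b a) = rl_kernel (a + b) u"
      using True Ga Gb unfolding rl_kernel_def B e C_def by simp
    then show ?thesis using C True Ga Gb Gab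
      by (simp add: ennreal_mult[symmetric] B)
  qed
  finally show ?thesis .
qed

lemma rl_kernel_semigroup_shift:
  assumes a: "0 < a" and b: "0 < b"
  shows "(\<integral>\<^sup>+r. ennreal (rl_kernel a (t - r)) * ennreal (rl_kernel b (r - s)) \<partial>lborel) = ennreal (rl_kernel (a + b) (t - s))"
proof -
  have "(\<integral>\<^sup>+r. ennreal (rl_kernel a (t - r)) * ennreal (rl_kernel b (r - s)) \<partial>lborel)
    = (\<integral>\<^sup>+r. (\<lambda>v. ennreal (rl_kernel a ((t - s) - v)) * ennreal (rl_kernel b v)) (r - s) \<partial>lborel)"
    by simp
  also have "\<dots> = (\<integral>\<^sup>+v. ennreal (rl_kernel a ((t - s) - v)) * ennreal (rl_kernel b v) \<partial>lborel)"
    by (rule nn_integral_translate) measurable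
  finally show ?thesis by (simp add: rl_kernel_semigroup[OF a b])
qed

section \<open>Integrability and composition of convolutions\<close>

lemma kconv_measurable [measurable]:
  assumes [measurable]: "f \<in> borel_measurable borel"
  shows "kconv b f \<in> borel_measurable borel"
  unfolding kconv_def[abs_def] by measurable

lemma kconv_integrableI:
  assumes [measurable]: "f \<in> borel_measurable borel" and b: "0 < b"
    and fin: "abs_kconv b f t < \<infinity>"
  shows "integrable lborel (\<lambda>r. rl_kernel b (t - r) * f r)"
  using fin b by (intro integrableI_bounded) (auto simp: abs_mult ennreal_mult)

lemma norm_kconv_le:
  assumes b: "0 < b"
  shows "ennreal \<bar>kconv b f t\<bar> \<le> abs_kconv b f t"
proof (cases "integrable lborel (\<lambda>r. rl_kernel b (t - r) * f r)")
  case True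
  from integral_norm_bound_ennreal[OF this] show ?thesis
    using b by (simp add: kconv_def abs_mult ennreal_mult)
qed (simp add: kconv_def not_integrable_integral_eq)

text \<open>Fubini. By the semigroup law the double integrand is integrable as soon as the absolute
  convolution of order a + b is finite at the single point t; no pointwise convergence of the inner
  convolution is required.\<close>

lemma kconv_kconv:
  assumes [measurable]: "f \<in> borel_measurable borel" and a: "0 < a" and b: "0 < b"
    and fin: "abs_kconv (a + b) f t < \<infinity>"
  shows "integrable lborel (\<lambda>r. rl_kernel a (t - r) * kconv b f r)"
    and "kconv a (kconv b f) t = kconv (a + b) f t"
proof -
  define H where "H = (\<lambda>(r,\<sigma>). rl_kernel a (t - r) * (rl_kernel b (r - \<sigma>) * f \<sigma>))"
  have [measurable]: "H \<in> borel_measurable (lborel \<Otimes>\<^sub>M lborel)"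
    unfolding H_def by measurable
  have "(\<integral>\<^sup>+z. ennreal (norm (H z)) \<partial>(lborel \<Otimes>\<^sub>M lborel)) = (\<integral>\<^sup>+\<sigma>. \<integral>\<^sup>+r. ennreal (norm (H (r,\<sigma>))) \<partial>lborel \<partial>lborel)"
    by (rule lborel_pair.nn_integral_snd[symmetric]) measurable
  also have "\<dots> = (\<integral>\<^sup>+\<sigma>. ennreal (rl_kernel (a + b) (t - \<sigma>)) * ennreal \<bar>f \<sigma>\<bar> \<partial>lborel)"
  proof (rule nn_integral_cong)
    fix \<sigma> :: real
    have "(\<integral>\<^sup>+r. ennreal (norm (H (r,\<sigma>))) \<partial>lborel) =
      (\<integral>\<^sup>+r. (ennreal (rl_kernel a (t - r)) * ennreal (rl_kernel b (r - \<sigma>))) * ennreal \<bar>f \<sigma>\<bar> \<partial>lborel)"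
      using a b by (intro nn_integral_cong) (simp add: H_def abs_mult ennreal_mult mult.assoc)
    also have "\<dots> = (\<integral>\<^sup>+r. ennreal (rl_kernel a (t - r)) * ennreal (rl_kernel b (r - \<sigma>)) \<partial>lborel) * ennreal \<bar>f \<sigma>\<bar>"
      by (rule nn_integral_multc) measurable
    finally show "(\<integral>\<^sup>+r. ennreal (norm (H (r,\<sigma>))) \<partial>lborel) = ennreal (rl_kernel (a + b) (t - \<sigma>)) * ennreal \<bar>f \<sigma>\<bar>"
      by (simp add: rl_kernel_semigroup_shift[OF a b])
  qed
  finally have H: "integrable (lborel \<Otimes>\<^sub>M lborel) H"
    using fin by (intro integrableI_bounded) auto
  have 1: "(\<integral>\<sigma>. H (r,\<sigma>) \<partial>lborel) = rl_kernel a (t - r) * kconv b f r" for r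
    by (simp add: H_def kconv_def)
  show "integrable lborel (\<lambda>r. rl_kernel a (t - r) * kconv b f r)"
    using lborel_pair.integrable_fst'[OF H] unfolding 1 .
  have 2: "(\<integral>r. H (r,\<sigma>) \<partial>lborel) = rl_kernel (a + b) (t - \<sigma>) * f \<sigma>" for \<sigma>
  proof -
    have "(\<integral>r. H (r,\<sigma>) \<partial>lborel) = (\<integral>r. rl_kernel a (t - r) * rl_kernel b (r - \<sigma>) \<partial>lborel) * f \<sigma>"
      by (simp add: H_def mult.assoc[symmetric])
    also have "(\<integral>r. rl_kernel a (t - r) * rl_kernel b (r - \<sigma>) \<partial>lborel) =
        enn2real (\<integral>\<^sup>+r. ennreal (rl_kernel a (t - r) * rl_kernel b (r - \<sigma>)) \<partial>lborel)"
      using a b by (intro integral_eq_nn_integral) (auto intro!: AE_I2)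
    also have "(\<integral>\<^sup>+r. ennreal (rl_kernel a (t - r) * rl_kernel b (r - \<sigma>)) \<partial>lborel) = ennreal (rl_kernel (a + b) (t - \<sigma>))"
      using a b by (simp add: ennreal_mult rl_kernel_semigroup_shift)
    finally show ?thesis using a b by simp
  qed
  have "(\<integral>r. (\<integral>\<sigma>. H (r,\<sigma>) \<partial>lborel) \<partial>lborel) = (\<integral>\<sigma>. (\<integral>r. H (r,\<sigma>) \<partial>lborel) \<partial>lborel)"
    using lborel_pair.Fubini_integral[of "\<lambda>r \<sigma>. H (r,\<sigma>)"] H by simp
  then show "kconv a (kconv b f) t = kconv (a + b) f t"
    unfolding 1 2 by (simp add: kconv_def)
qed

text \<open>The weight factors along t = r + (t - r). After Tonelli the inner integral is the
  Laplace transform of the kernel, so convolution multiplies weighted norms by l powr - b.\<close>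

lemma laplace_rl_convolution:
  assumes [measurable]: "h \<in> borel_measurable borel" and b: "0 < b" and l: "0 < l"
  shows "(\<integral>\<^sup>+t. ennreal (exp (- l * t)) * (\<integral>\<^sup>+r. ennreal (rl_kernel b (t - r)) * h r \<partial>lborel) \<partial>lborel)
    = ennreal (l powr - b) * (\<integral>\<^sup>+r. ennreal (exp (- l * r)) * h r \<partial>lborel)"
proof -
  have "(\<integral>\<^sup>+t. ennreal (exp (- l * t)) * (\<integral>\<^sup>+r. ennreal (rl_kernel b (t - r)) * h r \<partial>lborel) \<partial>lborel)
    = (\<integral>\<^sup>+t. \<integral>\<^sup>+r. (ennreal (exp (- l * t)) * ennreal (rl_kernel b (t - r))) * h r \<partial>lborel \<partial>lborel)"
    by (subst nn_integral_cmult[symmetric]) (auto simp: mult.assoc)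
  also have "\<dots> = (\<integral>\<^sup>+r. \<integral>\<^sup>+t. (ennreal (exp (- l * t)) * ennreal (rl_kernel b (t - r))) * h r \<partial>lborel \<partial>lborel)"
    by (rule lborel_pair.Fubini'[symmetric]) measurable
  also have "\<dots> = (\<integral>\<^sup>+r. ennreal (l powr - b) * (ennreal (exp (- l * r)) * h r) \<partial>lborel)"
  proof (rule nn_integral_cong)
    fix r :: real
    have "(\<integral>\<^sup>+t. ennreal (exp (- l * t)) * ennreal (rl_kernel b (t - r)) \<partial>lborel)
      = (\<integral>\<^sup>+t. (\<lambda>u. ennreal (exp (- l * r)) * (ennreal (exp (- l * u)) * ennreal (rl_kernel b u))) (t - r) \<partial>lborel)"
    proof (rule nn_integral_cong)
      fix t
      have "exp (- l * t) = exp (- l * r) * exp (- l * (t - r))" by (simp add: exp_add[symmetric] algebra_simps)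
      then have "ennreal (exp (- l * t)) = ennreal (exp (- l * r)) * ennreal (exp (- l * (t - r)))"
        by (simp only: ennreal_mult[symmetric] exp_ge_zero)
      then show "ennreal (exp (- l * t)) * ennreal (rl_kernel b (t - r)) =
          ennreal (exp (- l * r)) * (ennreal (exp (- l * (t - r))) * ennreal (rl_kernel b (t - r)))"
        by (simp only: mult.assoc)
    qed
    also have "\<dots> = (\<integral>\<^sup>+u. ennreal (exp (- l * r)) * (ennreal (exp (- l * u)) * ennreal (rl_kernel b u)) \<partial>lborel)"
      by (rule nn_integral_translate) measurable
    also have "\<dots> = ennreal (exp (- l * r)) * (\<integral>\<^sup>+u. ennreal (exp (- l * u)) * ennreal (rl_kernel b u) \<partial>lborel)"
      by (rule nn_integral_cmult) measurable
    also have "\<dots> = ennreal (exp (- l * r)) * ennreal (l powr - b)"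
      by (simp only: rl_kernel_laplace[OF b l])
    finally have "(\<integral>\<^sup>+t. ennreal (exp (- l * t)) * ennreal (rl_kernel b (t - r)) \<partial>lborel) = ennreal (exp (- l * r)) * ennreal (l powr - b)" .
    then show "(\<integral>\<^sup>+t. (ennreal (exp (- l * t)) * ennreal (rl_kernel b (t - r))) * h r \<partial>lborel)
      = ennreal (l powr - b) * (ennreal (exp (- l * r)) * h r)"
      by (subst nn_integral_multc) (auto simp: ac_simps)
  qed
  also have "\<dots> = ennreal (l powr - b) * (\<integral>\<^sup>+r. ennreal (exp (- l * r)) * h r \<partial>lborel)"
    by (rule nn_integral_cmult) measurable
  finally show ?thesis .
qed

text \<open>The function is dominated by M times the Heaviside function at s; the semigroup law
  evaluates the convolution of that bound exactly.\<close>

lemma nn_kconv_bounded: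
  assumes b: "0 < b" and s: "\<And>r. r \<le> s \<Longrightarrow> f r = 0" and M: "\<And>r. \<bar>f r\<bar> \<le> M"
  shows "abs_kconv b f t \<le> ennreal (M * rl_kernel (b + 1) (t - s))"
proof -
  have M0: "0 \<le> M" using M[of 0] by simp
  have "abs_kconv b f t
      \<le> (\<integral>\<^sup>+r. ennreal M * (ennreal (rl_kernel b (t - r)) * ennreal (rl_kernel 1 (r - s))) \<partial>lborel)"
  proof (rule nn_integral_mono)
    fix r
    have "ennreal \<bar>f r\<bar> \<le> ennreal M * ennreal (rl_kernel 1 (r - s))"
      using s[of r] M[of r] M0 by (cases "r \<le> s") (auto simp: rl_kernel_1 ennreal_leI)
    then have "ennreal (rl_kernel b (t - r)) * ennreal \<bar>f r\<bar> \<le> ennreal (rl_kernel b (t - r)) * (ennreal M * ennreal (rl_kernel 1 (r - s)))"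
      by (rule mult_left_mono) simp
    then show "ennreal (rl_kernel b (t - r)) * ennreal \<bar>f r\<bar> \<le> ennreal M * (ennreal (rl_kernel b (t - r)) * ennreal (rl_kernel 1 (r - s)))"
      by (simp add: ac_simps)
  qed
  also have "\<dots> = ennreal M * ennreal (rl_kernel (b + 1) (t - s))"
    using b by (subst nn_integral_cmult) (auto simp: rl_kernel_semigroup_shift)
  finally show ?thesis using M0 b by (simp add: ennreal_mult)
qed

text \<open>From order one on the kernel is nondecreasing, hence bounded by its value at t - s, and
  finiteness holds at every t. Below order one the singularity allows it only almost
  everywhere.\<close>

lemma nn_kconv_integrable:
  assumes f: "integrable lborel f" and s: "\<And>r. r \<le> s \<Longrightarrow> f r = 0" and b: "1 \<le> b"
  shows "abs_kconv b f t < \<infinity>"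
proof -
  have "abs_kconv b f t
      \<le> (\<integral>\<^sup>+r. ennreal (rl_kernel b (t - s)) * ennreal \<bar>f r\<bar> \<partial>lborel)"
  proof (rule nn_integral_mono)
    fix r
    show "ennreal (rl_kernel b (t - r)) * ennreal \<bar>f r\<bar> \<le> ennreal (rl_kernel b (t - s)) * ennreal \<bar>f r\<bar>"
      using s[of r] rl_kernel_mono[OF b, of "t - r" "t - s"]
      by (cases "r \<le> s") (auto intro!: mult_right_mono ennreal_leI)
  qed
  also have "\<dots> = ennreal (rl_kernel b (t - s)) * (\<integral>\<^sup>+r. ennreal \<bar>f r\<bar> \<partial>lborel)"
    using f by (intro nn_integral_cmult) auto
  also have "\<dots> < \<infinity>"
    using f by (auto simp: ennreal_mult_less_top integrable_iff_bounded)
  finally show ?thesis .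
qed

text \<open>The weight with l = 1 suffices: on the support of f it is at most exp (- s).\<close>

lemma AE_nn_kconv_finite:
  assumes f: "integrable lborel f" and s: "\<And>r. r \<le> s \<Longrightarrow> f r = 0" and b: "0 < b"
  shows "(\<integral>\<^sup>+t. ennreal (exp (- t)) * abs_kconv b f t \<partial>lborel) < \<infinity>"
    "AE t in lborel. abs_kconv b f t < \<infinity>"
proof -
  have [measurable]: "f \<in> borel_measurable borel" using f by auto
  have "(\<integral>\<^sup>+t. ennreal (exp (- 1 * t)) * abs_kconv b f t \<partial>lborel)
      = ennreal (1 powr - b) * (\<integral>\<^sup>+r. ennreal (exp (- 1 * r)) * ennreal \<bar>f r\<bar> \<partial>lborel)"
    using b by (intro laplace_rl_convolution) auto
  also have "\<dots> \<le> ennreal (1 powr - b) * (\<integral>\<^sup>+r. ennreal (exp (- s)) * ennreal \<bar>f r\<bar> \<partial>lborel)"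
  proof (intro mult_left_mono nn_integral_mono)
    fix r
    show "ennreal (exp (- 1 * r)) * ennreal \<bar>f r\<bar> \<le> ennreal (exp (- s)) * ennreal \<bar>f r\<bar>"
      using s[of r] by (cases "r \<le> s") (auto intro!: mult_right_mono ennreal_leI)
  qed simp
  also have "\<dots> = ennreal (exp (- s)) * (\<integral>\<^sup>+r. ennreal \<bar>f r\<bar> \<partial>lborel)"
    by (subst nn_integral_cmult) auto
  also have "\<dots> < \<infinity>"
    using f by (auto simp: ennreal_mult_less_top integrable_iff_bounded)
  finally show 1: "(\<integral>\<^sup>+t. ennreal (exp (- t)) * abs_kconv b f t \<partial>lborel) < \<infinity>"
    by simp
  have "AE t in lborel. ennreal (exp (- t)) * abs_kconv b f t \<noteq> \<infinity>"
    using 1 by (intro nn_integral_noteq_infinite) auto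
  then show "AE t in lborel. abs_kconv b f t < \<infinity>"
    by eventually_elim (auto simp: ennreal_mult_eq_top_iff less_top)
qed

lemma has_bochner_integral_rl_kernel:
  assumes a: "0 < a" and b: "0 < b"
  shows "has_bochner_integral lborel (\<lambda>r. rl_kernel a (t - r) * rl_kernel b (r - s)) (rl_kernel (a + b) (t - s))"
  using a b by (intro has_bochner_integral_nn_integral) (auto simp: ennreal_mult rl_kernel_semigroup_shift)

lemma kconv_add:
  assumes "integrable lborel (\<lambda>r. rl_kernel b (t - r) * f r)" "integrable lborel (\<lambda>r. rl_kernel b (t - r) * g r)"
  shows "kconv b (\<lambda>r. f r + g r) t = kconv b f t + kconv b g t"
  unfolding kconv_def using assms by (simp add: distrib_left)

lemma kconv_cmult: "kconv b (\<lambda>r. c * f r) t = c * kconv b f t"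
  unfolding kconv_def by (simp add: mult.left_commute)

lemma kconv_eq_0: "(\<And>r. r \<le> s \<Longrightarrow> f r = 0) \<Longrightarrow> t \<le> s \<Longrightarrow> kconv b f t = 0"
proof -
  assume *: "\<And>r. r \<le> s \<Longrightarrow> f r = 0" "t \<le> s"
  have "rl_kernel b (t - r) * f r = 0" for r using * by (cases "r \<le> s") auto
  then show ?thesis unfolding kconv_def by (simp only: Bochner_Integration.integral_zero)
qed

lemma kconv_cong_AE:
  assumes [measurable]: "f \<in> borel_measurable borel" "g \<in> borel_measurable borel"
    and "AE r in lborel. r < t \<longrightarrow> f r = g r"
  shows "kconv b f t = kconv b g t"
  unfolding kconv_def
proof (rule integral_cong_AE)
  show "AE r in lborel. rl_kernel b (t - r) * f r = rl_kernel b (t - r) * g r"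
    using assms(3)
  proof eventually_elim
    case (elim r)
    then show ?case by (cases "r < t") auto
  qed
qed measurable

section \<open>Continuity of convolutions\<close>

lemma kconv_Hoelder:
  assumes [measurable]: "f \<in> borel_measurable borel" and b: "0 < b" "b \<le> 1"
    and s: "\<And>r. r \<le> s \<Longrightarrow> f r = 0" and M: "\<And>r. \<bar>f r\<bar> \<le> M" and t: "t \<le> t'"
  shows "\<bar>kconv b f t' - kconv b f t\<bar> \<le> 2 * M * rl_kernel (b + 1) (t' - t)"
proof -
  have M0: "0 \<le> M" using M[of 0] by simp
  have int: "integrable lborel (\<lambda>r. rl_kernel b (u - r) * f r)" for u
    using b by (intro kconv_integrableI le_less_trans[OF nn_kconv_bounded[OF b(1) s M]]) auto
  define p where "p = (\<lambda>u c r. rl_kernel b (u - r) * rl_kernel 1 (r - c))"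
  have p: "has_bochner_integral lborel (p u c) (rl_kernel (b + 1) (u - c))" for u c
    unfolding p_def using b by (intro has_bochner_integral_rl_kernel) auto
  \<comment> \<open>\<open>P\<close> dominates the difference off r = t. For r < t the kernel is
    decreasing, so the first two terms already bound it; for r > t the first term vanishes and the
    second cancels half of the third. Each term has an exact integral by the semigroup law.\<close>
  define P where "P = (\<lambda>r. M * (p t s r - p t' s r + 2 * p t' t r))"
  have P: "has_bochner_integral lborel P (M * (rl_kernel (b + 1) (t - s) - rl_kernel (b + 1) (t' - s) + 2 * rl_kernel (b + 1) (t' - t)))"
    unfolding P_def by (intro has_bochner_integral_mult_right has_bochner_integral_add has_bochner_integral_diff p)
  have "kconv b f t' - kconv b f t = (\<integral>r. rl_kernel b (t' - r) * f r - rl_kernel b (t - r) * f r \<partial>lborel)"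
    unfolding kconv_def using int by (subst Bochner_Integration.integral_diff) auto
  also have "\<bar>\<dots>\<bar> \<le> (\<integral>r. \<bar>rl_kernel b (t' - r) * f r - rl_kernel b (t - r) * f r\<bar> \<partial>lborel)"
    by (rule integral_abs_bound)
  also have "\<dots> \<le> (\<integral>r. P r \<partial>lborel)"
  proof (rule integral_mono_AE)
    show "integrable lborel (\<lambda>r. \<bar>rl_kernel b (t' - r) * f r - rl_kernel b (t - r) * f r\<bar>)"
      using int by (intro integrable_abs Bochner_Integration.integrable_diff) auto
    show "integrable lborel P" using P by (auto simp: has_bochner_integral_iff)
    have "AE r in lborel. r \<noteq> t" by (rule AE_lborel_singleton)
    then show "AE r in lborel. \<bar>rl_kernel b (t' - r) * f r - rl_kernel b (t - r) * f r\<bar> \<le> P r"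
    proof eventually_elim
      case (elim r)
      have eq: "\<bar>rl_kernel b (t' - r) * f r - rl_kernel b (t - r) * f r\<bar> = \<bar>rl_kernel b (t' - r) - rl_kernel b (t - r)\<bar> * \<bar>f r\<bar>"
        by (simp add: abs_mult[symmetric] left_diff_distrib)
      consider "r \<le> s" | "r > s" "r < t" | "r > s" "r > t" using elim by linarith
      then show ?case
      proof cases
        case 1
        then show ?thesis using s[OF 1] M0 b by (simp add: P_def p_def)
      next
        case 2
        have "rl_kernel b (t' - r) \<le> rl_kernel b (t - r)" using 2 t b by (intro rl_kernel_antimono) auto
        then have "\<bar>rl_kernel b (t' - r) - rl_kernel b (t - r)\<bar> * \<bar>f r\<bar> \<le> (rl_kernel b (t - r) - rl_kernel b (t' - r)) * M"
          using M[of r] by (intro mult_mono) auto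
        then show ?thesis unfolding eq using 2 by (simp add: P_def p_def rl_kernel_1 mult.commute)
      next
        case 3
        have "\<bar>rl_kernel b (t' - r) - rl_kernel b (t - r)\<bar> * \<bar>f r\<bar> \<le> rl_kernel b (t' - r) * M"
          using M[of r] 3 b by (intro mult_mono) auto
        then show ?thesis unfolding eq using 3 by (simp add: P_def p_def rl_kernel_1 mult.commute)
      qed
    qed
  qed
  also have "\<dots> = M * (rl_kernel (b + 1) (t - s) - rl_kernel (b + 1) (t' - s) + 2 * rl_kernel (b + 1) (t' - t))"
    using P by (auto simp: has_bochner_integral_iff)
  also have "\<dots> \<le> M * (2 * rl_kernel (b + 1) (t' - t))"
    using M0 rl_kernel_mono[of "b + 1" "t - s" "t' - s"] b t by (intro mult_left_mono) auto
  finally show ?thesis by simp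
qed

lemma kconv_continuous_bounded:
  assumes [measurable]: "f \<in> borel_measurable borel" and b: "0 < b" "b \<le> 1"
    and s: "\<And>r. r \<le> s \<Longrightarrow> f r = 0" and M: "\<And>r. \<bar>f r\<bar> \<le> M"
  shows "continuous_on A (kconv b f)"
proof -
  have "isCont (kconv b f) t0" for t0
    unfolding isCont_def
  proof (rule Lim_null[THEN iffD2], rule Lim_null_comparison)
    show "\<forall>\<^sub>F t in at t0. norm (kconv b f t - kconv b f t0) \<le> 2 * M * (\<bar>t - t0\<bar> powr b / Gamma (b + 1))"
    proof (rule always_eventually, rule allI)
      fix t
      have e: "rl_kernel (b + 1) \<bar>u\<bar> = \<bar>u\<bar> powr b / Gamma (b + 1)" for u by (simp add: rl_kernel_def)
      show "norm (kconv b f t - kconv b f t0) \<le> 2 * M * (\<bar>t - t0\<bar> powr b / Gamma (b + 1))"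
        using kconv_Hoelder[OF assms(1) b s M, where t = t and t' = t0]
          kconv_Hoelder[OF assms(1) b s M, where t = t0 and t' = t]
        unfolding e[symmetric] by (cases "t \<le> t0") (auto simp: abs_minus_commute)
    qed
    have "((\<lambda>t. 2 * M * (\<bar>t - t0\<bar> powr b / Gamma (b + 1))) \<longlongrightarrow> 2 * M * (0 / Gamma (b + 1))) (at t0)"
      using b by (intro tendsto_intros tendsto_zero_powrI[where b = b] tendsto_rabs_zero)
        (auto simp: LIM_zero_iff Gamma_eq_zero_iff intro: always_eventually dest: nonpos_Ints_nonpos)
    then show "((\<lambda>t. 2 * M * (\<bar>t - t0\<bar> powr b / Gamma (b + 1))) \<longlongrightarrow> 0) (at t0)" by simp
  qed
  then show ?thesis by (simp add: continuous_at_imp_continuous_on)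
qed

text \<open>The mass of f stays at distance at least d from the evaluation point, hence away from
  the singularity of the kernel, and dominated convergence applies.\<close>

lemma kconv_continuous_left_supported:
  assumes f: "integrable lborel f" and b: "0 < b" "b \<le> 1" and c: "\<And>r. c < r \<Longrightarrow> f r = 0" and d: "0 < d"
  shows "continuous_on {c + d..} (kconv b f)"
  unfolding continuous_on_sequentially
proof (intro allI ballI impI, elim conjE)
  have [measurable]: "f \<in> borel_measurable borel" using f by auto
  fix x t assume t: "t \<in> {c + d..}" and x: "\<forall>n. x n \<in> {c + d..}" "x \<longlonglongrightarrow> t"
  show "(kconv b f \<circ> x) \<longlonglongrightarrow> kconv b f t"
    unfolding kconv_def o_def
  proof (rule integral_dominated_convergence)
    show "integrable lborel (\<lambda>r. rl_kernel b d * \<bar>f r\<bar>)" using f by simp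
    show "AE r in lborel. (\<lambda>n. rl_kernel b (x n - r) * f r) \<longlonglongrightarrow> rl_kernel b (t - r) * f r"
    proof (rule AE_I2)
      fix r :: real
      show "(\<lambda>n. rl_kernel b (x n - r) * f r) \<longlonglongrightarrow> rl_kernel b (t - r) * f r"
      proof (cases "r \<le> c")
        case True
        have pos: "x n - r > 0" "t - r > 0" for n using x t d True by (auto simp: less_diff_eq intro: less_le_trans[of _ "c + d"])
        have "(\<lambda>n. (x n - r) powr (b - 1) / Gamma b * f r) \<longlonglongrightarrow> (t - r) powr (b - 1) / Gamma b * f r"
          using pos b x(2) by (intro tendsto_intros) (auto simp: Gamma_eq_zero_iff dest: nonpos_Ints_nonpos)
        then show ?thesis using pos by (simp add: rl_kernel_def)
      qed (use c in simp)
    qed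
    show "AE r in lborel. norm (rl_kernel b (x n - r) * f r) \<le> rl_kernel b d * \<bar>f r\<bar>" for n
    proof (rule AE_I2)
      fix r :: real
      have "c + d \<le> x n" using x(1) by auto
      then show "norm (rl_kernel b (x n - r) * f r) \<le> rl_kernel b d * \<bar>f r\<bar>"
        using b d c[of r] rl_kernel_antimono[OF b d, of "x n - r"]
        by (cases "r \<le> c") (auto simp: abs_mult intro!: mult_right_mono)
    qed
  qed measurable
qed

text \<open>Made for functions such as Z(.,s), integrable but possibly unbounded near s. Cut at a
  point between s and t: the left piece is integrable and seen from a distance, the right piece is
  bounded.\<close>

lemma kconv_locally_bounded:
  assumes f: "integrable lborel f" and b: "0 < b" "b \<le> 1" and s: "\<And>r. r \<le> s \<Longrightarrow> f r = 0"
    and M: "\<And>c. s < c \<Longrightarrow> \<exists>M. \<forall>r>c. \<bar>f r\<bar> \<le> M"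
  shows "s < t \<Longrightarrow> integrable lborel (\<lambda>r. rl_kernel b (t - r) * f r)"
    and "continuous_on {s<..} (kconv b f)"
proof -
  have [measurable]: "f \<in> borel_measurable borel" using f by auto
  \<comment> \<open>Continuity is obtained to the right of t only; every u > s is reached by taking
    t midway between s and u.\<close>
  have split: "integrable lborel (\<lambda>r. rl_kernel b (t - r) * f r) \<and> continuous_on {t<..} (kconv b f)"
    if t: "s < t" for t
  proof -
    define c where "c = (s + t) / 2"
    have c: "s < c" "c < t" using t by (auto simp: c_def field_simps)
    define f1 where "f1 = (\<lambda>r. indicator {..c} r * f r)"
    define f2 where "f2 = (\<lambda>r. indicator {c<..} r * f r)"
    have [measurable]: "f1 \<in> borel_measurable borel" "f2 \<in> borel_measurable borel" unfolding f1_def f2_def by measurable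
    have f12: "f = (\<lambda>r. f1 r + f2 r)" by (auto simp: f1_def f2_def fun_eq_iff indicator_def)
    obtain K where "\<forall>r>c. \<bar>f r\<bar> \<le> K" using M[OF c(1)] by auto
    then have K: "\<bar>f2 r\<bar> \<le> max K 0" for r by (auto simp: f2_def indicator_def le_max_iff_disj)
    have z2: "r \<le> c \<Longrightarrow> f2 r = 0" for r by (simp add: f2_def)
    have z1: "c < r \<Longrightarrow> f1 r = 0" for r by (simp add: f1_def)
    have i1: "integrable lborel f1" unfolding f1_def
      using integrable_mult_indicator[OF _ f, of "{..c}"] by simp
    have int2: "integrable lborel (\<lambda>r. rl_kernel b (u - r) * f2 r)" for u
      using b by (intro kconv_integrableI le_less_trans[OF nn_kconv_bounded[OF b(1) z2 K]]) auto
    have int1: "integrable lborel (\<lambda>r. rl_kernel b (u - r) * f1 r)" if u: "c < u" for u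
    proof (rule Bochner_Integration.integrable_bound)
      show "integrable lborel (\<lambda>r. rl_kernel b (u - c) * \<bar>f1 r\<bar>)" using i1 by simp
      show "AE r in lborel. norm (rl_kernel b (u - r) * f1 r) \<le> norm (rl_kernel b (u - c) * \<bar>f1 r\<bar>)"
      proof (rule AE_I2)
        fix r :: real
        show "norm (rl_kernel b (u - r) * f1 r) \<le> norm (rl_kernel b (u - c) * \<bar>f1 r\<bar>)"
          using b u z1[of r] rl_kernel_antimono[OF b, of "u - c" "u - r"]
          by (cases "r \<le> c") (auto simp: abs_mult intro!: mult_right_mono)
      qed
    qed measurable
    have eq: "kconv b f u = kconv b f1 u + kconv b f2 u" if "c < u" for u
      using kconv_add[OF int1[OF that] int2[of u]] f12 by simp
    have "continuous_on {t<..} (\<lambda>u. kconv b f1 u + kconv b f2 u)"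
    proof (rule continuous_on_add)
      show "continuous_on {t<..} (kconv b f1)"
        using kconv_continuous_left_supported[OF i1 b z1, where c = c and d = "t - c"] c by (auto intro: continuous_on_subset)
      show "continuous_on {t<..} (kconv b f2)"
        by (rule kconv_continuous_bounded[OF _ b z2 K]) measurable
    qed
    then have "continuous_on {t<..} (kconv b f)"
      using eq c by (subst continuous_on_cong[OF refl, of _ _ "\<lambda>u. kconv b f1 u + kconv b f2 u"]) auto
    moreover have "integrable lborel (\<lambda>r. rl_kernel b (t - r) * f r)"
      using Bochner_Integration.integrable_add[OF int1[OF c(2)] int2[of t]] unfolding f12 by (simp add: distrib_left)
    ultimately show ?thesis by simp
  qed
  show "s < t \<Longrightarrow> integrable lborel (\<lambda>r. rl_kernel b (t - r) * f r)" using split by simp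
  have "isCont (kconv b f) u" if "s < u" for u
  proof -
    have "continuous_on {(s + u) / 2<..} (kconv b f)" using split[of "(s + u)/2"] that by (simp add: field_simps)
    then show ?thesis using that by (simp add: continuous_on_eq_continuous_at field_simps)
  qed
  then show "continuous_on {s<..} (kconv b f)"
    by (intro continuous_at_imp_continuous_on) auto
qed

section \<open>Borel representatives of Lebesgue measurable functions\<close>

lemma lebesgue_integral_borel_version:
  fixes f g :: "real \<Rightarrow> 'b::euclidean_space"
  assumes f: "f \<in> borel_measurable borel" and ae: "AE x in lborel. f x = g x"
  shows "integral\<^sup>L lebesgue g = integral\<^sup>L lborel f" "integrable lebesgue g \<longleftrightarrow> integrable lborel f"
proof -
  have ae': "AE x in lebesgue. f x = g x" using ae by (rule AE_completion)
  have f': "f \<in> borel_measurable lebesgue" using f by (intro measurable_completion) simp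
  have g': "g \<in> borel_measurable lebesgue" by (rule borel_measurable_AE[OF f' ae'])
  have f'': "f \<in> borel_measurable lborel" using f by simp
  have "integral\<^sup>L lebesgue g = integral\<^sup>L lebesgue f"
    using ae' by (intro integral_cong_AE[OF g' f']) (auto elim: eventually_mono)
  then show "integral\<^sup>L lebesgue g = integral\<^sup>L lborel f" by (simp add: integral_completion[OF f''])
  have "integrable lebesgue g \<longleftrightarrow> integrable lebesgue f"
    using ae' by (intro integrable_cong_AE[OF g' f']) (auto elim: eventually_mono)
  then show "integrable lebesgue g \<longleftrightarrow> integrable lborel f" by (simp add: integrable_completion[OF f''])
qed

text \<open>The data are Lebesgue measurable, whereas Tonelli on products of \<open>lborel\<close>
  asks for Borel functions. Zeros outside the interval turn integrals from s into convolutions over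
  the line; the left end is open so that f vanishes at every r <= s.\<close>

definition borel_version :: "real \<Rightarrow> real \<Rightarrow> (real \<Rightarrow> 'b::euclidean_space) \<Rightarrow> (real \<Rightarrow> 'b) \<Rightarrow> bool" where
  "borel_version s T q f \<longleftrightarrow> f \<in> borel_measurable borel \<and> (\<forall>r. r \<notin> {s<..T} \<longrightarrow> f r = 0) \<and>
     (AE r in lborel. r \<in> {s..T} \<longrightarrow> q r = f r)"

lemma borel_versionD:
  assumes "borel_version s T q f"
  shows "f \<in> borel_measurable borel" "r \<le> s \<Longrightarrow> f r = 0" "T < r \<Longrightarrow> f r = 0"
    "AE r in lborel. r \<in> {s..T} \<longrightarrow> q r = f r"
  using assms by (auto simp: borel_version_def)

lemma absolutely_integrable_borel_version:
  fixes q :: "real \<Rightarrow> real"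
  assumes "q absolutely_integrable_on {s..T}"
  obtains f where "borel_version s T q f" "integrable lborel f"
proof -
  have int: "integrable lebesgue (\<lambda>x. indicator {s..T} x *\<^sub>R q x)"
    using assms by (simp add: set_integrable_def)
  then have "(\<lambda>x. indicator {s..T} x *\<^sub>R q x) \<in> borel_measurable lebesgue" by (rule borel_measurable_integrable)
  from completion_ex_borel_measurable_real[OF this] obtain g where [measurable]: "g \<in> borel_measurable borel"
    and g: "AE x in lborel. indicator {s..T} x *\<^sub>R q x = g x" by auto
  define f where "f = (\<lambda>x. indicator {s<..T} x * g x)"
  have [measurable]: "f \<in> borel_measurable borel" unfolding f_def by measurable
  have 1: "AE x in lborel. f x = indicator {s..T} x *\<^sub>R q x"
    using g AE_lborel_singleton[of s]
  proof eventually_elim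
    case (elim x)
    then show ?case by (cases "x \<in> {s<..T}") (auto simp: f_def indicator_def of_bool_def split: if_splits)
  qed
  have "AE x in lborel. x \<in> {s..T} \<longrightarrow> q x = f x"
    using 1 by eventually_elim (auto simp: indicator_def)
  then have "borel_version s T q f" by (auto simp: borel_version_def f_def)
  moreover have "integrable lborel f"
    using lebesgue_integral_borel_version(2)[OF _ 1] int by simp
  ultimately show ?thesis by (rule that)
qed

lemma borel_version_absolutely_integrable:
  fixes q :: "real \<Rightarrow> real"
  assumes v: "borel_version s T q f" and f: "integrable lborel f" and t: "t \<le> T"
  shows "q absolutely_integrable_on {s..t}" and "integral {s..t} q = kconv 1 f t"
    and "(LINT r:{s..t}|lebesgue. q r) = kconv 1 f t"
proof -
  note [measurable] = borel_versionD(1)[OF v]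
  have ae: "AE x in lborel. rl_kernel 1 (t - x) * f x = indicator {s..t} x *\<^sub>R q x"
    using borel_versionD(4)[OF v] AE_lborel_singleton[of s] AE_lborel_singleton[of t]
  proof eventually_elim
    case (elim x)
    then show ?case using t borel_versionD(2)[OF v, of x] by (cases "x \<le> s") (auto simp: rl_kernel_1 indicator_def)
  qed
  have i: "integrable lborel (\<lambda>x. rl_kernel 1 (t - x) * f x)"
    by (rule kconv_integrableI[OF _ _ nn_kconv_integrable[OF f borel_versionD(2)[OF v]]]) auto
  have 1: "integrable lebesgue (\<lambda>x. indicator {s..t} x *\<^sub>R q x)"
    by (subst lebesgue_integral_borel_version(2)[OF _ ae]) (auto intro: i)
  then show 2: "q absolutely_integrable_on {s..t}" by (simp add: set_integrable_def)
  show 3: "(LINT r:{s..t}|lebesgue. q r) = kconv 1 f t"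
    unfolding kconv_def set_lebesgue_integral_def
    by (rule lebesgue_integral_borel_version(1)[OF _ ae]) simp
  show "integral {s..t} q = kconv 1 f t"
    using set_lebesgue_integral_eq_integral(2)[OF 2] 3 by simp
qed

lemma frac_int_raw_eq_kconv:
  assumes \<alpha>: "0 < \<alpha>" and v: "borel_version s T q f" and t: "t \<le> T"
  shows "frac_int_raw s \<alpha> q t = kconv \<alpha> f t"
proof -
  note [measurable] = borel_versionD(1)[OF v]
  have ae: "AE x in lborel. rl_kernel \<alpha> (t - x) * f x = indicator {s..t} x *\<^sub>R (1 / Gamma \<alpha> * (t - x) powr (\<alpha> - 1) * q x)"
    using borel_versionD(4)[OF v] AE_lborel_singleton[of s] AE_lborel_singleton[of t]
  proof eventually_elim
    case (elim x)
    then show ?case using t borel_versionD(2)[OF v, of x] by (cases "x \<le> s") (auto simp: rl_kernel_def indicator_def)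
  qed
  show ?thesis using \<alpha> unfolding frac_int_raw_def kconv_def set_lebesgue_integral_def
    by (subst lebesgue_integral_borel_version(1)[OF _ ae]) auto
qed

section \<open>Inverting the Riemann-Liouville derivative\<close>

lemma frac_int_AE: "AE t in lborel. t \<in> I \<longrightarrow> frac_int_raw a \<alpha> q t = frac_int a I \<alpha> q t"
proof (cases "\<exists>g. cont_rep I (frac_int_raw a \<alpha> q) g")
  case True
  then have "cont_rep I (frac_int_raw a \<alpha> q) (frac_int a I \<alpha> q)"
    unfolding frac_int_def using someI_ex[OF True] by simp
  then show ?thesis by (simp add: cont_rep_def AE_completion_iff)
qed (simp add: frac_int_def)

text \<open>\<open>kconv 1\<close> is a primitive, so Lebesgue differentiation of the constant 0
  recovers the function up to T.\<close>

lemma kconv_1_eq_0_AE: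
  assumes [measurable]: "\<phi> \<in> borel_measurable borel" and s: "\<And>r. r \<le> s \<Longrightarrow> \<phi> r = 0"
    and int: "integrable lborel (\<lambda>r. rl_kernel 1 (T - r) * \<phi> r)"
    and 0: "\<And>t. t \<le> T \<Longrightarrow> kconv 1 \<phi> t = 0"
  shows "AE t in lborel. t < T \<longrightarrow> \<phi> t = 0"
proof -
  \<comment> \<open>Integrability is known only up to T; the Heaviside factor cuts the function
    there and makes it integrable on every interval.\<close>
  define \<psi> where "\<psi> = (\<lambda>r. rl_kernel 1 (T - r) * \<phi> r)"
  have int': "integrable lborel \<psi>" using int by (simp add: \<psi>_def)
  have hk: "\<psi> integrable_on {x..y}" for x y
    using integrable_on_subinterval[OF integrable_on_lborel[OF int'], of x y] by simp
  \<comment> \<open>The primitive starts at s - 1, strictly left of the support, so that s itself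
    falls in the range of the differentiation theorem.\<close>
  have I0: "integral {s - 1..u} \<psi> = 0" if u: "u \<le> T" for u
  proof -
    have "set_integrable lborel {s - 1..u} \<psi>"
      using int' integrable_mult_indicator[of "{s - 1..u}" lborel \<psi>] by (simp add: set_integrable_def)
    from set_borel_integral_eq_integral(2)[OF this]
    have "integral {s - 1..u} \<psi> = (\<integral>x. indicator {s - 1..u} x *\<^sub>R \<psi> x \<partial>lborel)"
      by (simp add: set_lebesgue_integral_def)
    also have "\<dots> = kconv 1 \<phi> u" unfolding kconv_def
    proof (rule integral_cong_AE)
      have "AE x in lborel. x \<noteq> u" by (rule AE_lborel_singleton)
      then show "AE x in lborel. indicator {s - 1..u} x *\<^sub>R \<psi> x = rl_kernel 1 (u - x) * \<phi> x"
      proof eventually_elim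
        case (elim x)
        then show ?case using u s[of x] by (cases "x < s - 1") (auto simp: \<psi>_def rl_kernel_1 indicator_def)
      qed
    qed (simp_all add: \<psi>_def)
    finally show ?thesis using 0 u by simp
  qed
  have "AE t in lborel. s - 1 < t \<longrightarrow> ((\<lambda>u. integral {s - 1..u} \<psi>) has_real_derivative \<psi> t) (at t)"
    using lebesgue_differentiation[OF hk, of "s - 1"] by (simp add: AE_completion_iff)
  then show ?thesis
  proof eventually_elim
    case (elim t)
    show ?case
    proof
      assume t: "t < T"
      show "\<phi> t = 0"
      proof (cases "s - 1 < t")
        case True
        then have d: "((\<lambda>u. integral {s - 1..u} \<psi>) has_real_derivative \<psi> t) (at t)" using elim by simp
        have "((\<lambda>u. 0) has_real_derivative \<psi> t) (at t)"
          by (rule has_field_derivative_transform_within[OF d, of "T - t"]) (use t I0 in \<open>auto simp: dist_real_def\<close>)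
        then have "\<psi> t = 0" using DERIV_unique[OF _ DERIV_const] by blast
        then show ?thesis using t by (simp add: \<psi>_def rl_kernel_1)
      qed (use s in auto)
    qed
  qed
qed

text \<open>Integrating the derivative gives I^(1-\<beta>) z = c + I^1 g. Applying I^\<beta> turns
  this into an identity between the primitives of z and of c * k + I^\<beta> g, with k the kernel of
  order \<beta> at s. Differentiating both primitives gives the claim almost everywhere.\<close>

lemma RL_solution_AE:
  assumes \<beta>: "0 < \<beta>" "\<beta> \<le> 1"
    and z: "z \<in> RL_AC s J \<beta>" and dz: "has_RL_deriv s J \<beta> z g" and T: "{s..T} \<subseteq> J" "s < T"
    and zf: "borel_version s T z zf" "integrable lborel zf"
    and gf: "borel_version s T g gf" "integrable lborel gf"
  shows "AE t in lborel. t \<in> {s..T} \<longrightarrow>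
    z t = frac_int s J (1 - \<beta>) z s * rl_kernel \<beta> (t - s) + kconv \<beta> gf t"
proof -
  define F where "F = frac_int s J (1 - \<beta>) z"
  have AC: "AC_on s t F" if "t \<le> T" for t
  proof -
    have "{s..t} \<subseteq> J" using T(1) that by auto
    then show ?thesis using z unfolding RL_AC_def AC_loc_def F_def by auto
  qed
  have Ft: "F t = F s + kconv 1 gf t" if t: "t \<in> {s..T}" for t
  proof -
    have sub: "{s..t} \<subseteq> J" using T(1) t by auto
    have "(g has_integral (F t - F s)) {s..t}"
    proof (rule AC_fundamental_theorem)
      show "AE x in lebesgue. x \<in> {s..t} \<longrightarrow> (F has_real_derivative g x) (at x)"
        using dz unfolding has_RL_deriv_def F_def
        by eventually_elim (use sub in auto)
    qed (use t AC in auto)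
    then have "integral {s..t} g = F t - F s" by (rule integral_unique)
    then show ?thesis using borel_version_absolutely_integrable(2)[OF gf, of t] t by simp
  qed
  note zm[measurable] = borel_versionD(1)[OF zf(1)] and gm[measurable] = borel_versionD(1)[OF gf(1)]
  note z0 = borel_versionD(2)[OF zf(1)] and g0 = borel_versionD(2)[OF gf(1)]
  have raw: "AE t in lborel. t \<in> J \<longrightarrow> frac_int_raw s (1 - \<beta>) z t = F t"
    unfolding F_def by (rule frac_int_AE)
  show ?thesis
  proof (cases "\<beta> = 1")
    \<comment> \<open>Order 1 - \<beta> = 0 means the identity and not a convolution with
      \<open>rl_kernel\<close>, hence the separate case.\<close>
    case True
    show ?thesis using raw AE_lborel_singleton[of s]
    proof eventually_elim
      case (elim t)
      show ?case
      proof
        assume t: "t \<in> {s..T}"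
        then have "z t = F t" using elim T True by (auto simp: frac_int_raw_def)
        then show "z t = frac_int s J (1 - \<beta>) z s * rl_kernel \<beta> (t - s) + kconv \<beta> gf t"
          using Ft[OF t] True t elim by (simp add: F_def rl_kernel_1)
      qed
    qed
  next
    case False
    with \<beta> have \<beta>1: "0 < 1 - \<beta>" by simp
    define c where "c = F s"
    have ae: "AE t in lborel. t < T \<longrightarrow> kconv (1 - \<beta>) zf t = c * rl_kernel 1 (t - s) + kconv 1 gf t"
      using raw AE_lborel_singleton[of s]
    proof eventually_elim
      case (elim t)
      show ?case
      proof
        assume t: "t < T"
        show "kconv (1 - \<beta>) zf t = c * rl_kernel 1 (t - s) + kconv 1 gf t"
        proof (cases "t \<le> s")
          case True
          then show ?thesis by (simp add: kconv_eq_0[OF z0] kconv_eq_0[OF g0])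
        next
          case False
          then have "t \<in> J" using t by (intro subsetD[OF T(1)]) auto
          then have "F t = kconv (1 - \<beta>) zf t" 
            using frac_int_raw_eq_kconv[OF \<beta>1 zf(1), of t] elim t by auto
          then show ?thesis using Ft[of t] False t by (simp add: c_def rl_kernel_1)
        qed
      qed
    qed
    \<comment> \<open>The claim is that \<phi> vanishes almost everywhere; what the semigroup law
      makes accessible is its primitive.\<close>
    define \<phi> where "\<phi> = (\<lambda>t. zf t + - 1 * (c * rl_kernel \<beta> (t - s) + kconv \<beta> gf t))"
    have [measurable]: "\<phi> \<in> borel_measurable borel" unfolding \<phi>_def by measurable
    have finz: "abs_kconv 1 zf t < \<infinity>" for t
      by (rule nn_kconv_integrable[OF zf(2) z0]) auto
    have fing: "abs_kconv b gf t < \<infinity>" if "1 \<le> b" for t b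
      by (rule nn_kconv_integrable[OF gf(2) g0]) (use that in auto)
    have i1: "integrable lborel (\<lambda>r. rl_kernel 1 (t - r) * zf r)" for t
      by (rule kconv_integrableI[OF _ _ finz]) auto
    have i2: "integrable lborel (\<lambda>r. rl_kernel a (t - r) * (c * rl_kernel b (r - s)))" if "0 < a" "0 < b" for a b t
      using has_bochner_integral_rl_kernel[OF that, of t s]
      by (auto simp: has_bochner_integral_iff mult.left_commute[of _ c])
    have i3: "integrable lborel (\<lambda>r. rl_kernel 1 (t - r) * kconv \<beta> gf r)" for t
      using \<beta> by (intro kconv_kconv(1) fing) auto
    have i4: "integrable lborel (\<lambda>r. rl_kernel \<beta> (t - r) * kconv 1 gf r)" for t
      using \<beta> by (intro kconv_kconv(1) fing) auto
    have i5: "integrable lborel (\<lambda>r. rl_kernel 1 (t - r) * (c * rl_kernel \<beta> (r - s) + kconv \<beta> gf r))" for t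
      using Bochner_Integration.integrable_add[OF i2[of 1 \<beta> t] i3[of t]] \<beta> by (simp add: distrib_left)
    have i6: "integrable lborel (\<lambda>r. rl_kernel 1 (t - r) * (- 1 * (c * rl_kernel \<beta> (r - s) + kconv \<beta> gf r)))" for t
      unfolding mult.left_commute[of _ "- 1"] by (intro integrable_mult_right i5)
    have ck: "kconv a (\<lambda>r. c * rl_kernel b (r - s)) t = c * rl_kernel (a + b) (t - s)" if "0 < a" "0 < b" for a b t
      using has_bochner_integral_rl_kernel[OF that, of t s]
      by (auto simp: has_bochner_integral_iff kconv_def mult.left_commute[of _ c])
    have "AE t in lborel. t < T \<longrightarrow> \<phi> t = 0"
    proof (rule kconv_1_eq_0_AE)
      show "\<phi> r = 0" if "r \<le> s" for r using that by (simp add: \<phi>_def z0 kconv_eq_0[OF g0])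
      show "integrable lborel (\<lambda>r. rl_kernel 1 (T - r) * \<phi> r)"
        using Bochner_Integration.integrable_add[OF i1[of T] i6[of T]] by (simp add: \<phi>_def distrib_left)
      fix t assume t: "t \<le> T"
      have "kconv 1 zf t = kconv \<beta> (kconv (1 - \<beta>) zf) t"
        using \<beta> \<beta>1 finz[of t] kconv_kconv(2)[of zf \<beta> "1 - \<beta>" t] by simp
      also have "\<dots> = kconv \<beta> (\<lambda>r. c * rl_kernel 1 (r - s) + kconv 1 gf r) t"
        using ae by (intro kconv_cong_AE) (auto elim!: eventually_mono simp: t intro: less_le_trans[OF _ t])
      also have "\<dots> = c * rl_kernel (\<beta> + 1) (t - s) + kconv (\<beta> + 1) gf t"
        using \<beta> fing[of "\<beta> + 1" t] by (subst kconv_add[OF i2 i4]) (auto simp: ck kconv_kconv(2))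
      also have "\<dots> = kconv 1 (\<lambda>r. c * rl_kernel \<beta> (r - s) + kconv \<beta> gf r) t"
        using \<beta> fing[of "1 + \<beta>" t] by (subst kconv_add[OF i2 i3]) (auto simp: ck kconv_kconv(2) add.commute)
      finally show "kconv 1 \<phi> t = 0"
        unfolding \<phi>_def by (subst kconv_add[OF i1 i6], subst kconv_cmult) simp
    qed measurable
    then show ?thesis using borel_versionD(4)[OF zf(1)] AE_lborel_singleton[of T]
      by eventually_elim (auto simp: \<phi>_def c_def F_def)
  qed
qed

section \<open>Fractional Cauchy problems as integral equations\<close>

lemma base_intervalsD:
  assumes "J \<in> base_intervals a"
  shows "a \<in> J" "T \<in> J \<Longrightarrow> {a..T} \<subseteq> J" "\<exists>T\<in>J. a < T" "T \<in> J \<Longrightarrow> a \<le> T"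
    "u \<in> J \<Longrightarrow> v \<in> J \<Longrightarrow> {u..v} \<subseteq> J"
proof -
  have J: "is_interval J" "{a} \<subset> J" "J \<subseteq> {a..}" using assms by (auto simp: base_intervals_def)
  show a: "a \<in> J" using J by auto
  show iv: "{u..v} \<subseteq> J" if "u \<in> J" "v \<in> J" for u v
    using J(1) that unfolding is_interval_1 by (meson atLeastAtMost_iff subsetI)
  show "T \<in> J \<Longrightarrow> {a..T} \<subseteq> J" using iv a by blast
  show "T \<in> J \<Longrightarrow> a \<le> T" using J by auto
  obtain T where "T \<in> J" "T \<noteq> a" using J by blast
  then show "\<exists>T\<in>J. a < T" using J(3) by force
qed

lemma base_intervals_Icc: "a < T \<Longrightarrow> {a..T} \<in> base_intervals a"
  by (auto simp: base_intervals_def is_interval_cc)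

text \<open>Countably many rational right ends T keep the union of the null sets null. They miss
  only the left end and a possible maximum, which is then \<open>Sup J\<close>; these two points are
  discarded.\<close>

lemma base_intervals_AE:
  assumes J: "J \<in> base_intervals a"
    and P: "\<And>T. T \<in> J \<Longrightarrow> a < T \<Longrightarrow> AE t in lborel. a < t \<and> t < T \<longrightarrow> P t"
  shows "AE t in lborel. t \<in> J \<longrightarrow> P t"
proof -
  define D where "D = {T \<in> J. a < T} \<inter> \<rat>"
  have "countable D" unfolding D_def by (intro countable_Int2 countable_rat)
  then have "AE t in lborel. \<forall>T\<in>D. a < t \<and> t < T \<longrightarrow> P t"
    using P by (subst AE_ball_countable) (auto simp: D_def)
  then show ?thesis using AE_lborel_singleton[of a] AE_lborel_singleton[of "Sup J"]
  proof eventually_elim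
    case (elim t)
    show ?case
    proof
      assume t: "t \<in> J"
      then have at: "a < t" using base_intervalsD(4)[OF J t] elim by simp
      have "\<exists>u\<in>J. t < u"
      proof (rule ccontr)
        assume "\<not> ?thesis"
        then have "Sup J = t" using t by (intro cSup_eq_maximum) (auto simp: not_less)
        then show False using elim by simp
      qed
      then obtain u where u: "u \<in> J" "t < u" by blast
      obtain r where r: "r \<in> \<rat>" "t < r" "r < u" using Rats_dense_in_real[OF u(2)] by blast
      then have "r \<in> D" using base_intervalsD(5)[OF J t u(1)] at by (auto simp: D_def subset_iff)
      then show "P t" using elim at r by auto
    qed
  qed
qed

text \<open>A negative value would persist on a nondegenerate open interval inside J, which is not
  null. Applied to minus an absolute value, it turns an equality almost everywhere into an equality
  everywhere.\<close>

lemma continuous_AE_nonneg: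
  fixes f :: "real \<Rightarrow> real"
  assumes J: "J \<in> base_intervals a" and f: "continuous_on J f"
    and ae: "AE t in lborel. t \<in> J \<longrightarrow> 0 \<le> f t" and t: "t \<in> J"
  shows "0 \<le> f t"
proof (rule ccontr)
  assume "\<not> 0 \<le> f t"
  then have neg: "0 < - f t" by simp
  then obtain d where d: "0 < d" "\<And>x. x \<in> J \<Longrightarrow> dist x t < d \<Longrightarrow> dist (f x) (f t) < - f t"
    using f t unfolding continuous_on_iff by blast
  have fneg: "f x < 0" if "x \<in> J" "dist x t < d" for x
    using d(2)[OF that] neg by (auto simp: dist_real_def abs_if split: if_splits)
  obtain u where u: "u \<in> J" "u \<noteq> t"
    using base_intervalsD(1,3)[OF J] t by (cases "t = a") auto
  \<comment> \<open>t may be an end point of J, so the interval is taken on the side of t where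
    another point u of J lies.\<close>
  obtain c e where ce: "c < e" "{c<..<e} \<subseteq> J" "\<And>x. x \<in> {c<..<e} \<Longrightarrow> dist x t < d"
  proof (cases "u < t")
    case True
    show ?thesis
    proof (rule that)
      show "max u (t - d) < t" using True d by simp
      show "{max u (t - d)<..<t} \<subseteq> J" using base_intervalsD(5)[OF J u(1) t] by (auto simp: subset_iff)
    qed (auto simp: dist_real_def)
  next
    case False
    show ?thesis
    proof (rule that)
      show "t < min u (t + d)" using False u d by simp
      show "{t<..<min u (t + d)} \<subseteq> J" using base_intervalsD(5)[OF J t u(1)] by (auto simp: subset_iff)
    qed (auto simp: dist_real_def)
  qed
  have "AE x in lborel. x \<notin> {c<..<e}"
    using ae by eventually_elim (use ce fneg in force)
  then have "{c<..<e} \<in> null_sets lborel" by (subst AE_iff_null_sets) auto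
  then show False using ce(1) by (auto simp: null_sets_def)
qed

text \<open>Near a point below some T in J, the sets J and {a..T} coincide; a point that is not
  below any other is the maximum, and then J itself is compact.\<close>

lemma continuous_on_base_interval:
  fixes q :: "real \<Rightarrow> 'b::topological_space"
  assumes J: "J \<in> base_intervals a" and q: "\<And>T. T \<in> J \<Longrightarrow> a < T \<Longrightarrow> continuous_on {a..T} q"
  shows "continuous_on J q"
  unfolding continuous_on_eq_continuous_within
proof
  fix t assume t: "t \<in> J"
  show "continuous (at t within J) q"
  proof (cases "\<exists>T\<in>J. t < T")
    case True
    then obtain T where T: "T \<in> J" "t < T" by blast
    have at: "a \<le> t" using base_intervalsD(4)[OF J t] .
    then have c: "continuous (at t within {a..T}) q"
      using q[OF T(1)] T by (auto simp: continuous_on_eq_continuous_within)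
    have "at t within J = at t within {a..T}"
      by (rule at_within_nhd[of _ "{..<T}"])
        (use T base_intervalsD(2)[OF J T(1)] base_intervalsD(4)[OF J] in auto)
    then show ?thesis using c by simp
  next
    case False
    then have max: "x \<le> t" if "x \<in> J" for x using that by (simp add: not_less)
    have "J = {a..t}"
      using base_intervalsD(2)[OF J t] base_intervalsD(4)[OF J] max by auto
    moreover obtain T where "T \<in> J" "a < T" using base_intervalsD(3)[OF J] by blast
    then have "a < t" using max[of T] by simp
    ultimately show ?thesis using q[OF t] t by (auto simp: continuous_on_eq_continuous_within)
  qed
qed

lemma borel_version_bounded_integrable:
  fixes f :: "real \<Rightarrow> 'b::euclidean_space"
  assumes v: "borel_version s T q f" and M: "\<And>\<tau>. norm (f \<tau>) \<le> M"
  shows "integrable lborel f"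
proof (rule Bochner_Integration.integrable_bound)
  show "integrable lborel (\<lambda>x. M * indicator {s<..T} x :: real)"
    by (cases "s \<le> T") (auto intro!: integrable_mult_right simp: greaterThanAtMost_empty)
  show "f \<in> borel_measurable lborel" using borel_versionD(1)[OF v] by simp
  have "norm (f x) \<le> norm (M * indicator {s<..T} x :: real)" for x
    using M[of x] borel_versionD(2,3)[OF v, of x] by (cases "x \<in> {s<..T}") (auto simp: not_less)
  then show "AE x in lborel. norm (f x) \<le> norm (M * indicator {s<..T} x :: real)" by simp
qed

section \<open>Equivalence of the scalar Caputo equation with a Volterra equation\<close>

text \<open>The Riemann-Liouville formula for q - q a has a term c times the kernel at a. Since q -
  q a is continuous and starts at 0, c must vanish, and continuity then gives the equation at every
  t.\<close>

lemma Caputo_solution_eq: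
  assumes \<beta>: "0 < \<beta>" "\<beta> \<le> 1"
    and q: "q \<in> Caputo_AC a J \<beta>" and dq: "has_Caputo_deriv a J \<beta> q g" and T: "{a..T} \<subseteq> J" "a < T"
    and gf: "borel_version a T g gf" and M: "\<And>\<tau>. \<bar>gf \<tau>\<bar> \<le> M" and t: "t \<in> {a..T}"
  shows "q t = q a + kconv \<beta> gf t"
proof -
  define z where "z = (\<lambda>t. q t - q a)"
  have zRL: "z \<in> RL_AC a J \<beta>" and dz: "has_RL_deriv a J \<beta> z g" and cq: "continuous_on J q"
    using q dq by (auto simp: z_def Caputo_AC_def has_Caputo_deriv_def)
  have cz: "continuous_on {a..T} z"
    unfolding z_def using cq T(1) by (intro continuous_intros) (auto intro: continuous_on_subset)
  obtain zf where zf: "borel_version a T z zf" "integrable lborel zf"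
    using absolutely_integrable_borel_version[OF absolutely_integrable_continuous_real[OF cz]] .
  have gi: "integrable lborel gf" by (rule borel_version_bounded_integrable[OF gf, of M]) (use M in simp)
  note gm[measurable] = borel_versionD(1)[OF gf]
  note g0 = borel_versionD(2)[OF gf]
  define c where "c = frac_int a J (1 - \<beta>) z a"
  have ae: "AE t in lborel. t \<in> {a..T} \<longrightarrow> z t = c * rl_kernel \<beta> (t - a) + kconv \<beta> gf t"
    unfolding c_def by (rule RL_solution_AE[OF \<beta> zRL dz T zf gf gi])
  have ck: "continuous_on {a..T} (kconv \<beta> gf)"
    by (rule kconv_continuous_bounded[where s = a and M = M, OF gm \<beta> g0 M])
  have J: "{a..T} \<in> base_intervals a" by (rule base_intervals_Icc[OF T(2)])
  \<comment> \<open>Almost everywhere the modulus equals |c| times the kernel at t - a, which is at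
    least the kernel at T - a because the kernel decreases. By continuity the bound holds at a,
    where the modulus is 0.\<close>
  have "0 \<le> (\<lambda>t. \<bar>z t - kconv \<beta> gf t\<bar> - \<bar>c\<bar> * rl_kernel \<beta> (T - a)) a"
  proof (rule continuous_AE_nonneg[OF J, where f = "\<lambda>t. \<bar>z t - kconv \<beta> gf t\<bar> - \<bar>c\<bar> * rl_kernel \<beta> (T - a)"])
    show "continuous_on {a..T} (\<lambda>t. \<bar>z t - kconv \<beta> gf t\<bar> - \<bar>c\<bar> * rl_kernel \<beta> (T - a))"
      by (intro continuous_intros cz ck)
    show "AE t in lborel. t \<in> {a..T} \<longrightarrow> 0 \<le> \<bar>z t - kconv \<beta> gf t\<bar> - \<bar>c\<bar> * rl_kernel \<beta> (T - a)"
      using ae AE_lborel_singleton[of a]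
    proof eventually_elim
      case (elim t)
      then show ?case using rl_kernel_antimono[OF \<beta>, of "t - a" "T - a"] \<beta>
        by (auto simp: abs_mult intro!: mult_left_mono)
    qed
  qed (use T in auto)
  moreover have "z a = 0" "kconv \<beta> gf a = 0" by (auto simp: z_def kconv_eq_0[where s = a and t = a and f = gf and b = \<beta>, OF g0])
  ultimately have "\<bar>c\<bar> * rl_kernel \<beta> (T - a) \<le> 0" by simp
  then have c0: "c = 0" using rl_kernel_pos[of \<beta> "T - a"] \<beta> T by (simp add: mult_le_0_iff)
  have "0 \<le> (\<lambda>t. - \<bar>z t - kconv \<beta> gf t\<bar>) t"
  proof (rule continuous_AE_nonneg[OF J, where f = "\<lambda>t. - \<bar>z t - kconv \<beta> gf t\<bar>"])
    show "continuous_on {a..T} (\<lambda>t. - \<bar>z t - kconv \<beta> gf t\<bar>)" by (intro continuous_intros cz ck)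
    show "AE t in lborel. t \<in> {a..T} \<longrightarrow> 0 \<le> - \<bar>z t - kconv \<beta> gf t\<bar>"
      using ae by eventually_elim (simp add: c0)
  qed (rule t)
  then show ?thesis by (simp add: z_def)
qed

text \<open>Applying I^(1-\<beta>) to q - q a yields the primitive of g by the semigroup law.
  Boundedness of g makes this primitive Lipschitz on compact intervals, hence absolutely continuous,
  and its derivative is g almost everywhere.\<close>

lemma Caputo_solutionI:
  assumes J: "J \<in> base_intervals a" and \<beta>: "0 < \<beta>" "\<beta> \<le> 1"
    and rep: "\<And>T. T \<in> J \<Longrightarrow> a < T \<Longrightarrow> \<exists>gf M. borel_version a T g gf \<and> (\<forall>\<tau>. \<bar>gf \<tau>\<bar> \<le> M) \<and>
        (\<forall>t\<in>{a..T}. q t = q a + kconv \<beta> gf t)"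
  shows "q \<in> Caputo_AC a J \<beta>" "has_Caputo_deriv a J \<beta> q g"
proof -
  define z where "z = (\<lambda>t. q t - q a)"
  define G where "G = (\<lambda>t. integral {a..t} g)"
  define raw where "raw = frac_int_raw a (1 - \<beta>) z"
  define F where "F = frac_int a J (1 - \<beta>) z"
  have main: "\<exists>gf M. borel_version a T g gf \<and> integrable lborel gf \<and> (\<forall>\<tau>. \<bar>gf \<tau>\<bar> \<le> M) \<and>
      continuous_on {a..T} q \<and> (\<forall>t\<in>{a..T}. raw t = G t \<and> G t = kconv 1 gf t)"
    if T: "T \<in> J" "a < T" for T
  proof -
    obtain gf M where gf: "borel_version a T g gf" and M: "\<And>\<tau>. \<bar>gf \<tau>\<bar> \<le> M"
      and q: "\<And>t. t \<in> {a..T} \<Longrightarrow> q t = q a + kconv \<beta> gf t" using rep[OF T] by blast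
    have gi: "integrable lborel gf" by (rule borel_version_bounded_integrable[OF gf, of M]) (use M in simp)
    note gm[measurable] = borel_versionD(1)[OF gf]
    note g0 = borel_versionD(2)[OF gf]
    have "continuous_on {a..T} (\<lambda>t. q a + kconv \<beta> gf t)"
      by (intro continuous_intros kconv_continuous_bounded[where s = a and M = M, OF gm \<beta> g0 M])
    then have cq: "continuous_on {a..T} q" by (subst continuous_on_cong[OF refl q]) auto
    have GK: "G t = kconv 1 gf t" if "t \<in> {a..T}" for t
      unfolding G_def by (rule borel_version_absolutely_integrable(2)[OF gf gi]) (use that in auto)
    moreover have "raw t = kconv 1 gf t" if t: "t \<in> {a..T}" for t
    proof (cases "\<beta> = 1")
      case True
      then show ?thesis using q[OF t] by (simp add: raw_def frac_int_raw_def z_def)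
    next
      case False
      with \<beta> have \<beta>1: "0 < 1 - \<beta>" by simp
      \<comment> \<open>The convolution goes on beyond T and must be cut there to be a
        \<open>borel_version\<close>; this is invisible to convolutions evaluated at t <= T.\<close>
      define zf where "zf = (\<lambda>t. indicator {a<..T} t * kconv \<beta> gf t)"
      have zm[measurable]: "zf \<in> borel_measurable borel" unfolding zf_def by measurable
      have "z \<tau> = zf \<tau>" if "\<tau> \<in> {a..T}" for \<tau>
        using q[OF that] that kconv_eq_0[where s = a and t = a and f = gf and b = \<beta>, OF g0] by (cases "\<tau> = a") (auto simp: z_def zf_def)
      then have zf: "borel_version a T z zf" by (auto simp: borel_version_def zf_def[symmetric] zm) (auto simp: zf_def)
      have "raw t = kconv (1 - \<beta>) zf t"
        unfolding raw_def by (rule frac_int_raw_eq_kconv[OF \<beta>1 zf]) (use t in auto)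
      also have "\<dots> = kconv (1 - \<beta>) (kconv \<beta> gf) t"
      proof (rule kconv_cong_AE[OF zm])
        show "AE \<tau> in lborel. \<tau> < t \<longrightarrow> zf \<tau> = kconv \<beta> gf \<tau>"
        proof (rule AE_I2, rule impI)
          fix \<tau> assume "\<tau> < t"
          then show "zf \<tau> = kconv \<beta> gf \<tau>" using t kconv_eq_0[where s = a and t = \<tau> and f = gf and b = \<beta>, OF g0]
            by (cases "\<tau> \<le> a") (auto simp: zf_def)
        qed
      qed measurable
      also have "\<dots> = kconv 1 gf t"
        using kconv_kconv(2)[OF gm \<beta>1 \<beta>(1), of t] nn_kconv_integrable[where s = a and b = 1 and t = t, OF gi g0] by simp
      finally show ?thesis .
    qed
    ultimately show ?thesis using gf gi M cq by auto
  qed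
  have cq: "continuous_on J q" by (rule continuous_on_base_interval[OF J]) (use main in blast)
  have cz: "continuous_on J z" unfolding z_def by (intro continuous_intros cq)
  have cG: "continuous_on J G"
  proof (rule continuous_on_base_interval[OF J])
    fix T assume "T \<in> J" "a < T"
    from main[OF this] obtain gf M where gf: "borel_version a T g gf" and M: "\<And>\<tau>. \<bar>gf \<tau>\<bar> \<le> M"
      and GK: "\<And>t. t \<in> {a..T} \<Longrightarrow> G t = kconv 1 gf t" by blast
    show "continuous_on {a..T} G"
      by (subst continuous_on_cong[OF refl GK]) (auto intro!: kconv_continuous_bounded[where s = a and M = M, OF borel_versionD(1)[OF gf] _ _ borel_versionD(2)[OF gf] M])
  qed
  obtain T0 where T0: "T0 \<in> J" "a < T0" using base_intervalsD(3)[OF J] by blast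
  have rawG: "raw t = G t" if t: "t \<in> J" for t
  proof (cases "t = a")
    case True
    then show ?thesis using main[OF T0] T0 by auto
  next
    case False
    then have "a < t" using base_intervalsD(4)[OF J t] by simp
    then show ?thesis using main[OF t] by auto
  qed
  have FG: "F t = G t" if t: "t \<in> J" for t
  proof -
    \<comment> \<open>\<open>frac_int\<close> picks some continuous representative by choice; it is
      pinned down on J by agreeing almost everywhere with the continuous primitive G.\<close>
    have ex: "\<exists>g. cont_rep J raw g" using cG rawG by (auto simp: cont_rep_def)
    then have "cont_rep J raw F" unfolding F_def frac_int_def raw_def using someI_ex[OF ex] by (simp add: raw_def)
    then have cF: "continuous_on J F" and ae: "AE t in lborel. t \<in> J \<longrightarrow> raw t = F t"
      by (auto simp: cont_rep_def AE_completion_iff)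
    have "0 \<le> (\<lambda>t. - \<bar>F t - G t\<bar>) t"
    proof (rule continuous_AE_nonneg[OF J, where f = "\<lambda>t. - \<bar>F t - G t\<bar>"])
      show "continuous_on J (\<lambda>t. - \<bar>F t - G t\<bar>)" by (intro continuous_intros cF cG)
      show "AE t in lborel. t \<in> J \<longrightarrow> 0 \<le> - \<bar>F t - G t\<bar>"
        using ae by eventually_elim (simp add: rawG)
    qed (rule t)
    then show ?thesis by simp
  qed
  have "F \<in> AC_loc J"
    unfolding AC_loc_def AC_on_def
  proof (intro CollectI allI impI)
    fix c d and \<epsilon> :: real assume cd: "{c..d} \<subseteq> J" and \<epsilon>: "0 < \<epsilon>"
    show "\<exists>\<delta>>0. \<forall>P. finite P \<and> (\<forall>(u,v)\<in>P. c \<le> u \<and> u < v \<and> v \<le> d) \<and>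
     pairwise (\<lambda>p r. {fst p<..<snd p} \<inter> {fst r<..<snd r} = {}) P \<and>
     (\<Sum>(u,v)\<in>P. v - u) < \<delta> \<longrightarrow> (\<Sum>(u,v)\<in>P. \<bar>F v - F u\<bar>) < \<epsilon>"
    proof (cases "c < d")
      \<comment> \<open>No pair u < v fits into a degenerate or empty interval, so only the empty
        family is admissible.\<close>
      case False
      show ?thesis
      proof (intro exI[of _ 1] conjI allI impI zero_less_one, elim conjE)
        fix P assume P: "\<forall>(u,v)\<in>P. c \<le> u \<and> u < v \<and> v \<le> d"
        have "z \<notin> P" for z using P False by (cases z) fastforce
        then have "P = {}" by blast
        then show "(\<Sum>(u,v)\<in>P. \<bar>F v - F u\<bar>) < \<epsilon>" using \<epsilon> by simp
      qed
    next
      case True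
      then have d: "d \<in> J" and c: "c \<in> J" using cd by auto
      have ac: "a \<le> c" using base_intervalsD(4)[OF J c] .
      obtain gf M where gf: "borel_version a d g gf" and M: "\<And>\<tau>. \<bar>gf \<tau>\<bar> \<le> M"
        and GK: "\<And>t. t \<in> {a..d} \<Longrightarrow> G t = kconv 1 gf t" using main[OF d] True ac by force
      have M0: "0 \<le> M" using M[of 0] by simp
      \<comment> \<open>The Hoelder estimate at order one is a Lipschitz estimate, since the kernel
        of order two is u itself for u > 0.\<close>
      have Lip: "\<bar>F v - F u\<bar> \<le> 2 * M * (v - u)" if uv: "c \<le> u" "u < v" "v \<le> d" for u v
      proof -
        have "u \<in> J" "v \<in> J" using cd uv by auto
        then have "\<bar>F v - F u\<bar> = \<bar>kconv 1 gf v - kconv 1 gf u\<bar>" using uv ac by (simp add: FG GK)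
        also have "\<dots> \<le> 2 * M * rl_kernel (1 + 1) (v - u)"
          using uv by (intro kconv_Hoelder[where s = a and M = M, OF borel_versionD(1)[OF gf] _ _ borel_versionD(2)[OF gf] M]) auto
        also have "rl_kernel (1 + 1) (v - u) = v - u"
          using uv Gamma_fact[of 1, where 'a = real] by (simp add: rl_kernel_def)
        finally show ?thesis .
      qed
      \<comment> \<open>The summand 1 covers M = 0 and makes the final inequality strict.\<close>
      define \<delta> where "\<delta> = \<epsilon> / (2 * M + 1)"
      have \<delta>: "\<delta> > 0" using \<epsilon> M0 by (simp add: \<delta>_def)
      show ?thesis
      proof (intro exI[of _ \<delta>] conjI allI impI \<delta>, elim conjE)
        fix P assume P: "\<forall>(u,v)\<in>P. c \<le> u \<and> u < v \<and> v \<le> d" and sm: "(\<Sum>(u,v)\<in>P. v - u) < \<delta>"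
        have "(\<Sum>(u,v)\<in>P. \<bar>F v - F u\<bar>) \<le> (\<Sum>(u,v)\<in>P. 2 * M * (v - u))"
          by (rule sum_mono) (use P Lip in auto)
        also have "\<dots> = 2 * M * (\<Sum>(u,v)\<in>P. v - u)" by (simp add: sum_distrib_left split_def)
        also have "\<dots> \<le> 2 * M * \<delta>" using sm M0 by (intro mult_left_mono) auto
        also have "\<dots> < \<epsilon>" using \<epsilon> M0 by (simp add: \<delta>_def field_simps)
        finally show "(\<Sum>(u,v)\<in>P. \<bar>F v - F u\<bar>) < \<epsilon>" .
      qed
    qed
  qed
  moreover have "z \<in> L1_loc J"
    unfolding L1_loc_def using cz by (auto intro!: absolutely_integrable_continuous_real intro: continuous_on_subset)
  ultimately show "q \<in> Caputo_AC a J \<beta>"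
    using cq by (simp add: Caputo_AC_def RL_AC_def z_def F_def)
  have "AE t in lborel. t \<in> J \<longrightarrow> (F has_real_derivative g t) (at t)"
  proof (rule base_intervals_AE[OF J])
    fix T assume T: "T \<in> J" "a < T"
    from main[OF this] obtain gf M where gf: "borel_version a T g gf" and gi: "integrable lborel gf"
      and GK: "\<And>t. t \<in> {a..T} \<Longrightarrow> G t = kconv 1 gf t" by blast
    have gg: "borel_version a T gf gf" using gf by (auto simp: borel_version_def)
    have hk: "gf integrable_on {x..y}" for x y
      using integrable_on_subinterval[OF integrable_on_lborel[OF gi], of x y] by simp
    have "AE t in lborel. a < t \<longrightarrow> ((\<lambda>u. integral {a..u} gf) has_real_derivative gf t) (at t)"
      using lebesgue_differentiation[OF hk, of a] by (simp add: AE_completion_iff)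
    then show "AE t in lborel. a < t \<and> t < T \<longrightarrow> (F has_real_derivative g t) (at t)"
      using borel_versionD(4)[OF gf]
    proof eventually_elim
      case (elim t)
      show ?case
      proof
        assume t: "a < t \<and> t < T"
        then have d: "((\<lambda>u. integral {a..u} gf) has_real_derivative g t) (at t)" using elim by auto
        show "(F has_real_derivative g t) (at t)"
        proof (rule has_field_derivative_transform_within_open[OF d])
          show "t \<in> {a<..<T}" using t by auto
          fix u assume u: "u \<in> {a<..<T}"
          then have "u \<in> J" using base_intervalsD(2)[OF J T(1)] by auto
          then show "integral {a..u} gf = F u"
            using u borel_version_absolutely_integrable(2)[OF gg gi, of u] by (simp add: FG GK)
        qed auto
      qed
    qed
  qed
  then show "has_Caputo_deriv a J \<beta> q g"
    by (simp add: has_Caputo_deriv_def has_RL_deriv_def AE_completion_iff F_def z_def)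
qed

section \<open>Vector-valued Volterra equations\<close>

lemma borel_measurable_vec_component:
  fixes f :: "'a \<Rightarrow> 'b::euclidean_space^'n"
  assumes "f \<in> borel_measurable M"
  shows "(\<lambda>x. f x $ i) \<in> borel_measurable M"
  by (rule measurable_compose[OF assms]) (intro borel_measurable_continuous_onI continuous_on_component continuous_on_id)

lemma borel_measurable_vecI:
  fixes f :: "'a \<Rightarrow> real^'n"
  assumes "\<And>i. (\<lambda>x. f x $ i) \<in> borel_measurable M"
  shows "f \<in> borel_measurable M"
  using assms by (subst borel_measurable_euclidean_space) (auto simp: Basis_vec_def inner_axis)

lemma borel_measurable_matrix_vector_mult:
  fixes A :: "'a \<Rightarrow> real^'n^'m" and x :: "'a \<Rightarrow> real^'n"
  assumes "A \<in> borel_measurable M" "x \<in> borel_measurable M"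
  shows "(\<lambda>t. A t *v x t) \<in> borel_measurable M"
proof (rule borel_measurable_vecI)
  fix i
  have "(\<lambda>t. A t $ i $ j * x t $ j) \<in> borel_measurable M" for j
    by (intro borel_measurable_times borel_measurable_vec_component assms)
  then show "(\<lambda>t. (A t *v x t) $ i) \<in> borel_measurable M"
    by (simp add: matrix_vector_mult_def)
qed

definition vconv :: "real^'m \<Rightarrow> (real \<Rightarrow> real^'m) \<Rightarrow> real \<Rightarrow> real^'m" where
  "vconv \<alpha> f t = (\<chi> i. kconv (\<alpha> $ i) (\<lambda>r. f r $ i) t)"

text \<open>One scalar kernel that dominates the kernels of all rows: the different orders
  \<alpha>_i are handled by a single inequality for norms.\<close>

definition kernel_sum :: "real^'m \<Rightarrow> real \<Rightarrow> real" where
  "kernel_sum \<alpha> u = (\<Sum>i\<in>UNIV. rl_kernel (\<alpha> $ i) u)"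

abbreviation norm_vconv :: "real^'m \<Rightarrow> (real \<Rightarrow> real^'m) \<Rightarrow> real \<Rightarrow> ennreal" where
  "norm_vconv \<alpha> f t \<equiv> (\<integral>\<^sup>+r. ennreal (kernel_sum \<alpha> (t - r)) * ennreal (norm (f r)) \<partial>lborel)"

abbreviation weighted_norm :: "real \<Rightarrow> (real \<Rightarrow> real^'m) \<Rightarrow> ennreal" where
  "weighted_norm l x \<equiv> (\<integral>\<^sup>+t. ennreal (exp (- l * t)) * ennreal (norm (x t)) \<partial>lborel)"

lemma kernel_sum_measurable [measurable]: "kernel_sum \<alpha> \<in> borel_measurable borel"
  unfolding kernel_sum_def[abs_def] by measurable

text \<open>A stands for a Borel version of the coefficient matrix, defined and bounded on the whole
  line; K bounds its action on vectors.\<close>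

locale volterra =
  fixes \<alpha> :: "real^'m" and A :: "real \<Rightarrow> real^'m^'m" and K :: real
  assumes \<alpha>_pos: "\<And>i. 0 < \<alpha> $ i" and \<alpha>_le_1: "\<And>i. \<alpha> $ i \<le> 1"
    and A_measurable [measurable]: "A \<in> borel_measurable borel"
    and K_nonneg: "0 \<le> K" and norm_A_le: "\<And>r x. norm (A r *v x) \<le> K * norm x"
begin

lemma kernel_sum_nonneg [simp]: "0 \<le> kernel_sum \<alpha> u"
  unfolding kernel_sum_def using \<alpha>_pos by (intro sum_nonneg) simp

lemma rl_kernel_le_kernel_sum: "rl_kernel (\<alpha> $ i) u \<le> kernel_sum \<alpha> u"
  unfolding kernel_sum_def using \<alpha>_pos by (intro member_le_sum) auto

lemma nn_integral_kernel_sum: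
  assumes [measurable]: "h \<in> borel_measurable borel"
  shows "(\<integral>\<^sup>+r. ennreal (kernel_sum \<alpha> (t - r)) * h r \<partial>lborel) =
    (\<Sum>i\<in>UNIV. \<integral>\<^sup>+r. ennreal (rl_kernel (\<alpha> $ i) (t - r)) * h r \<partial>lborel)"
  using \<alpha>_pos by (subst nn_integral_sum[symmetric])
    (auto simp: kernel_sum_def sum_ennreal[symmetric] sum_distrib_right simp del: sum_ennreal)

lemma norm_vconv_le:
  assumes [measurable]: "f \<in> borel_measurable borel"
  shows "ennreal (norm (vconv \<alpha> f t)) \<le> norm_vconv \<alpha> f t"
proof -
  have "ennreal (norm (vconv \<alpha> f t)) \<le> ennreal (\<Sum>i\<in>UNIV. \<bar>vconv \<alpha> f t $ i\<bar>)"
    by (intro ennreal_leI norm_le_l1_cart)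
  also have "\<dots> = (\<Sum>i\<in>UNIV. ennreal \<bar>kconv (\<alpha> $ i) (\<lambda>r. f r $ i) t\<bar>)"
    by (simp add: vconv_def)
  also have "\<dots> \<le> (\<Sum>i\<in>UNIV. \<integral>\<^sup>+r. ennreal (rl_kernel (\<alpha> $ i) (t - r)) * ennreal (norm (f r)) \<partial>lborel)"
  proof (rule sum_mono)
    fix i
    have "ennreal \<bar>kconv (\<alpha> $ i) (\<lambda>r. f r $ i) t\<bar> \<le> (\<integral>\<^sup>+r. ennreal (rl_kernel (\<alpha> $ i) (t - r)) * ennreal \<bar>f r $ i\<bar> \<partial>lborel)"
      by (rule norm_kconv_le[OF \<alpha>_pos])
    also have "\<dots> \<le> (\<integral>\<^sup>+r. ennreal (rl_kernel (\<alpha> $ i) (t - r)) * ennreal (norm (f r)) \<partial>lborel)"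
      by (intro nn_integral_mono mult_left_mono ennreal_leI component_le_norm_cart) simp
    finally show "ennreal \<bar>kconv (\<alpha> $ i) (\<lambda>r. f r $ i) t\<bar> \<le> (\<integral>\<^sup>+r. ennreal (rl_kernel (\<alpha> $ i) (t - r)) * ennreal (norm (f r)) \<partial>lborel)" .
  qed
  also have "\<dots> = norm_vconv \<alpha> f t"
    by (rule nn_integral_kernel_sum[symmetric]) measurable
  finally show ?thesis .
qed

lemma vconv_integrable:
  assumes [measurable]: "f \<in> borel_measurable borel"
    and fin: "norm_vconv \<alpha> f t < \<infinity>"
  shows "integrable lborel (\<lambda>r. rl_kernel (\<alpha> $ i) (t - r) * f r $ i)"
proof (rule kconv_integrableI[OF _ \<alpha>_pos])
  show "(\<lambda>r. f r $ i) \<in> borel_measurable borel" by (rule borel_measurable_vec_component) measurable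
  have "(\<integral>\<^sup>+r. ennreal (rl_kernel (\<alpha> $ i) (t - r)) * ennreal \<bar>f r $ i\<bar> \<partial>lborel)
    \<le> norm_vconv \<alpha> f t"
    by (intro nn_integral_mono mult_mono ennreal_leI component_le_norm_cart rl_kernel_le_kernel_sum) auto
  then show "(\<integral>\<^sup>+r. ennreal (rl_kernel (\<alpha> $ i) (t - r)) * ennreal \<bar>f r $ i\<bar> \<partial>lborel) < \<infinity>"
    using fin by (rule le_less_trans)
qed

lemma vconv_diff:
  assumes "f \<in> borel_measurable borel" "g \<in> borel_measurable borel"
    and "norm_vconv \<alpha> f t < \<infinity>"
    and "norm_vconv \<alpha> g t < \<infinity>"
  shows "vconv \<alpha> (\<lambda>r. f r - g r) t = vconv \<alpha> f t - vconv \<alpha> g t"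
  using vconv_integrable[OF assms(1,3)] vconv_integrable[OF assms(2,4)]
  by (simp add: vec_eq_iff vconv_def kconv_def right_diff_distrib)

lemma vconv_add:
  assumes "f \<in> borel_measurable borel" "g \<in> borel_measurable borel"
    and "norm_vconv \<alpha> f t < \<infinity>"
    and "norm_vconv \<alpha> g t < \<infinity>"
  shows "vconv \<alpha> (\<lambda>r. f r + g r) t = vconv \<alpha> f t + vconv \<alpha> g t"
  using vconv_integrable[OF assms(1,3)] vconv_integrable[OF assms(2,4)]
  by (simp add: vec_eq_iff vconv_def kconv_def distrib_left)

lemma vconv_cong_AE:
  assumes "f \<in> borel_measurable borel" "g \<in> borel_measurable borel"
    and "AE r in lborel. r < t \<longrightarrow> f r = g r"
  shows "vconv \<alpha> f t = vconv \<alpha> g t"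
  unfolding vconv_def vec_eq_iff vec_lambda_beta
  using assms(3) by (auto intro!: kconv_cong_AE borel_measurable_vec_component assms(1,2) elim: eventually_mono)

lemma vconv_eq_0:
  assumes "\<And>r. r \<le> s \<Longrightarrow> f r = 0" "t \<le> s"
  shows "vconv \<alpha> f t = 0"
  using assms by (simp add: vconv_def vec_eq_iff kconv_eq_0[where s = s])

lemma nn_vconv_bounded:
  assumes [measurable]: "f \<in> borel_measurable borel"
    and s: "\<And>r. r \<le> s \<Longrightarrow> f r = 0" and M: "\<And>r. norm (f r) \<le> M"
  shows "norm_vconv \<alpha> f t
    \<le> ennreal (M * (\<Sum>i\<in>UNIV. rl_kernel (\<alpha> $ i + 1) (t - s)))"
proof -
  have M0: "0 \<le> M" using M[of 0] norm_ge_zero order_trans by blast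
  have "norm_vconv \<alpha> f t =
      (\<Sum>i\<in>UNIV. \<integral>\<^sup>+r. ennreal (rl_kernel (\<alpha> $ i) (t - r)) * ennreal (norm (f r)) \<partial>lborel)"
    by (rule nn_integral_kernel_sum) measurable
  also have "\<dots> \<le> (\<Sum>i\<in>UNIV. ennreal (M * rl_kernel (\<alpha> $ i + 1) (t - s)))"
  proof (rule sum_mono)
    fix i
    show "(\<integral>\<^sup>+r. ennreal (rl_kernel (\<alpha> $ i) (t - r)) * ennreal (norm (f r)) \<partial>lborel) \<le> ennreal (M * rl_kernel (\<alpha> $ i + 1) (t - s))"
      using nn_kconv_bounded[where b = "\<alpha> $ i" and s = s and f = "\<lambda>r. norm (f r)" and M = M and t = t] \<alpha>_pos s M by simp
  qed
  also have "\<dots> = ennreal (M * (\<Sum>i\<in>UNIV. rl_kernel (\<alpha> $ i + 1) (t - s)))"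
    using M0 \<alpha>_pos by (subst sum_ennreal) (auto simp: sum_distrib_left intro!: mult_nonneg_nonneg rl_kernel_nonneg add_pos_pos)
  finally show ?thesis .
qed

lemma vconv_continuous_bounded:
  assumes "f \<in> borel_measurable borel"
    and "\<And>r. r \<le> s \<Longrightarrow> f r = 0" and M: "\<And>r. norm (f r) \<le> M"
  shows "continuous_on S (vconv \<alpha> f)"
proof -
  have "\<bar>f r $ i\<bar> \<le> M" for r i using M[of r] component_le_norm_cart[of "f r" i] by simp
  then show ?thesis
    unfolding vconv_def using assms \<alpha>_pos \<alpha>_le_1
    by (intro continuous_on_vec_lambda kconv_continuous_bounded[where s = s and M = M] borel_measurable_vec_component) auto
qed

text \<open>In the norm with weight \<open>exp (- l * t)\<close> convolution is bounded by \<open>rate l\<close>, which tends to 0.\<close>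

definition rate :: "real \<Rightarrow> real" where "rate l = (\<Sum>i\<in>UNIV. l powr - (\<alpha> $ i))"

lemma rate_nonneg [simp]: "0 \<le> rate l" by (auto simp: rate_def intro: sum_nonneg)

lemma laplace_kernel_sum:
  assumes [measurable]: "h \<in> borel_measurable borel" and l: "0 < l"
  shows "(\<integral>\<^sup>+t. ennreal (exp (- l * t)) * (\<integral>\<^sup>+r. ennreal (kernel_sum \<alpha> (t - r)) * h r \<partial>lborel) \<partial>lborel)
    = ennreal (rate l) * (\<integral>\<^sup>+r. ennreal (exp (- l * r)) * h r \<partial>lborel)"
proof -
  have "(\<integral>\<^sup>+t. ennreal (exp (- l * t)) * (\<integral>\<^sup>+r. ennreal (kernel_sum \<alpha> (t - r)) * h r \<partial>lborel) \<partial>lborel)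
    = (\<integral>\<^sup>+t. (\<Sum>i\<in>UNIV. ennreal (exp (- l * t)) * (\<integral>\<^sup>+r. ennreal (rl_kernel (\<alpha> $ i) (t - r)) * h r \<partial>lborel)) \<partial>lborel)"
    by (simp add: nn_integral_kernel_sum sum_distrib_left)
  also have "\<dots> = (\<Sum>i\<in>UNIV. \<integral>\<^sup>+t. ennreal (exp (- l * t)) * (\<integral>\<^sup>+r. ennreal (rl_kernel (\<alpha> $ i) (t - r)) * h r \<partial>lborel) \<partial>lborel)"
    by (rule nn_integral_sum) measurable
  also have "\<dots> = (\<Sum>i\<in>UNIV. ennreal (l powr - (\<alpha> $ i)) * (\<integral>\<^sup>+r. ennreal (exp (- l * r)) * h r \<partial>lborel))"
    using \<alpha>_pos l by (intro sum.cong refl laplace_rl_convolution) auto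
  also have "\<dots> = ennreal (rate l) * (\<integral>\<^sup>+r. ennreal (exp (- l * r)) * h r \<partial>lborel)"
    by (simp add: rate_def sum_distrib_right[symmetric])
  finally show ?thesis .
qed

text \<open>exp (l * t) is an eigenfunction of the convolution with eigenvalue
  \<open>rate l\<close>. This keeps bounds of the form C * exp (l * t) stable under
  iteration.\<close>

lemma nn_integral_kernel_sum_exp:
  assumes l: "0 < l"
  shows "(\<integral>\<^sup>+r. ennreal (kernel_sum \<alpha> (t - r)) * ennreal (exp (l * r)) \<partial>lborel) = ennreal (rate l * exp (l * t))"
proof -
  have "(\<integral>\<^sup>+r. ennreal (rl_kernel (\<alpha> $ i) (t - r)) * ennreal (exp (l * r)) \<partial>lborel) = ennreal (exp (l * t)) * ennreal (l powr - (\<alpha> $ i))" for i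
  proof -
    have "(\<integral>\<^sup>+r. ennreal (rl_kernel (\<alpha> $ i) (t - r)) * ennreal (exp (l * r)) \<partial>lborel)
      = (\<integral>\<^sup>+r. (\<lambda>u. ennreal (exp (l * t)) * (ennreal (exp (- l * u)) * ennreal (rl_kernel (\<alpha> $ i) u))) (t - r) \<partial>lborel)"
    proof (rule nn_integral_cong)
      fix r
      have "exp (l * r) = exp (l * t) * exp (- l * (t - r))" by (simp add: exp_add[symmetric] algebra_simps)
      then have "ennreal (exp (l * r)) = ennreal (exp (l * t)) * ennreal (exp (- l * (t - r)))"
        by (simp only: ennreal_mult[symmetric] exp_ge_zero)
      then show "ennreal (rl_kernel (\<alpha> $ i) (t - r)) * ennreal (exp (l * r)) =
        ennreal (exp (l * t)) * (ennreal (exp (- l * (t - r))) * ennreal (rl_kernel (\<alpha> $ i) (t - r)))"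
        by (simp only: mult.assoc mult.commute[of "ennreal (rl_kernel (\<alpha> $ i) (t - r))"])
    qed
    also have "\<dots> = (\<integral>\<^sup>+u. ennreal (exp (l * t)) * (ennreal (exp (- l * u)) * ennreal (rl_kernel (\<alpha> $ i) u)) \<partial>lborel)"
      by (rule nn_integral_reflect) measurable
    also have "\<dots> = ennreal (exp (l * t)) * (\<integral>\<^sup>+u. ennreal (exp (- l * u)) * ennreal (rl_kernel (\<alpha> $ i) u) \<partial>lborel)"
      by (rule nn_integral_cmult) measurable
    finally show ?thesis by (simp only: rl_kernel_laplace[OF \<alpha>_pos l])
  qed
  then have "(\<integral>\<^sup>+r. ennreal (kernel_sum \<alpha> (t - r)) * ennreal (exp (l * r)) \<partial>lborel) = (\<Sum>i\<in>UNIV. ennreal (exp (l * t)) * ennreal (l powr - (\<alpha> $ i)))"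
    by (subst nn_integral_kernel_sum) auto
  also have "\<dots> = ennreal (rate l * exp (l * t))"
    by (simp add: rate_def sum_distrib_left[symmetric] ennreal_mult sum_nonneg mult.commute)
  finally show ?thesis .
qed

text \<open>Every exponent - \<alpha>_i is negative. The value 1/2 makes the Picard errors summable
  and leaves the other half of a bound to the source term.\<close>

lemma contraction_rate: obtains l where "0 < l" "K * rate l \<le> 1/2"
proof -
  have "((\<lambda>l. K * (\<Sum>i\<in>UNIV. l powr - (\<alpha> $ i))) \<longlongrightarrow> K * (\<Sum>i\<in>(UNIV::'m set). 0)) at_top"
    by (intro tendsto_intros tendsto_neg_powr filterlim_ident) (simp add: \<alpha>_pos)
  then have "((\<lambda>l. K * rate l) \<longlongrightarrow> 0) at_top" by (simp add: rate_def)
  then have "\<forall>\<^sub>F l in at_top. K * rate l < 1/2" by (rule order_tendstoD) simp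
  then have "\<forall>\<^sub>F l in at_top. 0 < l \<and> K * rate l < 1/2"
    using eventually_gt_at_top[of 0] by eventually_elim simp
  then obtain l where "0 < l \<and> K * rate l < 1/2" using eventually_happens by force
  then show ?thesis by (intro that[of l]) auto
qed

text \<open>Plays the part of a Gronwall inequality for singular kernels: the weighted integral W
  satisfies W <= W / 2. Finiteness of W is essential, as the inequality also holds for an infinite
  W.\<close>

lemma volterra_inequality_zero:
  fixes D :: "real \<Rightarrow> ennreal"
  assumes [measurable]: "D \<in> borel_measurable borel"
    and fin: "\<And>l. 0 < l \<Longrightarrow> (\<integral>\<^sup>+t. ennreal (exp (- l * t)) * D t \<partial>lborel) < \<infinity>"
    and le: "\<And>t. D t \<le> ennreal K * (\<integral>\<^sup>+r. ennreal (kernel_sum \<alpha> (t - r)) * D r \<partial>lborel)"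
  shows "AE t in lborel. D t = 0"
proof -
  obtain l where l: "0 < l" "K * rate l \<le> 1/2" by (rule contraction_rate)
  define W where "W = (\<integral>\<^sup>+t. ennreal (exp (- l * t)) * D t \<partial>lborel)"
  have "W \<le> (\<integral>\<^sup>+t. ennreal K * (ennreal (exp (- l * t)) * (\<integral>\<^sup>+r. ennreal (kernel_sum \<alpha> (t - r)) * D r \<partial>lborel)) \<partial>lborel)"
    unfolding W_def
  proof (rule nn_integral_mono)
    fix t
    show "ennreal (exp (- l * t)) * D t \<le> ennreal K * (ennreal (exp (- l * t)) * (\<integral>\<^sup>+r. ennreal (kernel_sum \<alpha> (t - r)) * D r \<partial>lborel))"
      using mult_left_mono[OF le[of t], of "ennreal (exp (- l * t))"] by (simp add: mult.left_commute)
  qed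
  also have "\<dots> = ennreal K * (ennreal (rate l) * W)"
    unfolding W_def by (subst nn_integral_cmult, measurable) (simp only: laplace_kernel_sum[OF assms(1) l(1)])
  also have "\<dots> = ennreal (K * rate l) * W" using K_nonneg by (simp add: ennreal_mult mult.assoc)
  also have "\<dots> \<le> ennreal (1/2) * W" by (intro mult_right_mono ennreal_leI l) simp
  finally have half: "W \<le> ennreal (1/2) * W" .
  obtain w where w: "W = ennreal w" "0 \<le> w" using fin[OF l(1)] by (cases W) (auto simp: W_def)
  have "ennreal w \<le> ennreal (1/2 * w)"
    using half w(2) unfolding w(1) by (subst ennreal_mult) auto
  then have "w \<le> 1/2 * w" using w by (subst (asm) ennreal_le_iff) auto
  then have "W = 0" using w by simp
  then have "AE t in lborel. ennreal (exp (- l * t)) * D t = 0"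
    unfolding W_def by (subst (asm) nn_integral_0_iff_AE) auto
  then show ?thesis by eventually_elim simp
qed

lemma apply_A_measurable:
  assumes "x \<in> borel_measurable borel" shows "(\<lambda>r. A r *v x r) \<in> borel_measurable borel"
  using assms by (intro borel_measurable_matrix_vector_mult) auto

lemma nn_integral_A_le:
  "norm_vconv \<alpha> (\<lambda>r. A r *v x r) t
    \<le> ennreal K * norm_vconv \<alpha> x t"
  if [measurable]: "x \<in> borel_measurable borel"
proof -
  have "norm_vconv \<alpha> (\<lambda>r. A r *v x r) t
    \<le> (\<integral>\<^sup>+r. ennreal K * (ennreal (kernel_sum \<alpha> (t - r)) * ennreal (norm (x r))) \<partial>lborel)"
  proof (rule nn_integral_mono)
    fix r
    have "ennreal (norm (A r *v x r)) \<le> ennreal K * ennreal (norm (x r))"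
      using norm_A_le[of r "x r"] K_nonneg by (simp add: ennreal_mult[symmetric] ennreal_leI)
    from mult_left_mono[OF this, of "ennreal (kernel_sum \<alpha> (t - r))"]
    show "ennreal (kernel_sum \<alpha> (t - r)) * ennreal (norm (A r *v x r)) \<le> ennreal K * (ennreal (kernel_sum \<alpha> (t - r)) * ennreal (norm (x r)))"
      by (simp add: mult.left_commute)
  qed
  also have "\<dots> = ennreal K * norm_vconv \<alpha> x t"
    by (rule nn_integral_cmult) measurable
  finally show ?thesis .
qed

lemma AE_kernel_sum_finite:
  assumes x[measurable]: "x \<in> borel_measurable borel" and l: "0 < l"
    and fin: "weighted_norm l x < \<infinity>"
  shows "AE t in lborel. norm_vconv \<alpha> (\<lambda>r. A r *v x r) t < \<infinity>"
proof -
  have "(\<integral>\<^sup>+t. ennreal (exp (- l * t)) * norm_vconv \<alpha> x t \<partial>lborel) < \<infinity>"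
    using fin by (subst laplace_kernel_sum[OF _ l]) (auto simp: ennreal_mult_less_top)
  then have "AE t in lborel. ennreal (exp (- l * t)) * norm_vconv \<alpha> x t \<noteq> \<infinity>"
    by (intro nn_integral_noteq_infinite) auto
  then show ?thesis
  proof eventually_elim
    case (elim t)
    then have "ennreal K * norm_vconv \<alpha> x t < \<infinity>"
      by (auto simp: ennreal_mult_eq_top_iff ennreal_mult_less_top less_top)
    then show ?case using nn_integral_A_le[OF x, of t] by (rule le_less_trans[rotated])
  qed
qed

text \<open>The factor \<open>c\<close> is there for a cut-off: convolution spreads to the right,
  and a solution that is meant on a compact interval solves an equation on the whole line only after
  multiplication by an indicator.\<close>

lemma volterra_unique:
  assumes x[measurable]: "x \<in> borel_measurable borel" and s: "\<And>r. r \<le> s \<Longrightarrow> x r = 0"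
    and M: "\<And>r. norm (x r) \<le> M"
    and eq: "\<And>t. x t = c t *\<^sub>R vconv \<alpha> (\<lambda>r. A r *v x r) t" "\<And>t. \<bar>c t\<bar> \<le> 1"
  shows "x t = 0"
proof -
  have "AE t in lborel. ennreal (norm (x t)) = 0"
  proof (rule volterra_inequality_zero)
    fix l :: real assume l: "0 < l"
    have M0: "0 \<le> M" using M[of 0] norm_ge_zero order_trans by blast
    \<comment> \<open>Bounded by M and zero up to s, \<open>x\<close> lies below M times a shifted
      Heaviside function, whose weighted integral is finite for every l > 0.\<close>
    have "weighted_norm l x
        \<le> (\<integral>\<^sup>+t. ennreal M * (ennreal (exp (- l * s)) * (\<lambda>u. ennreal (exp (- l * u)) * ennreal (rl_kernel 1 u)) (t - s)) \<partial>lborel)"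
    proof (rule nn_integral_mono)
      fix t
      have e: "exp (- l * s) * exp (- l * (t - s)) = exp (- l * t)" by (simp add: exp_add[symmetric] algebra_simps)
      show "ennreal (exp (- l * t)) * ennreal (norm (x t))
          \<le> ennreal M * (ennreal (exp (- l * s)) * (\<lambda>u. ennreal (exp (- l * u)) * ennreal (rl_kernel 1 u)) (t - s))"
      proof (cases "t \<le> s")
        case False
        have "ennreal M * (ennreal (exp (- l * s)) * (ennreal (exp (- l * (t - s))) * ennreal (rl_kernel 1 (t - s)))) = ennreal M * ennreal (exp (- l * t))"
          using False unfolding e[symmetric] ennreal_mult[OF exp_ge_zero exp_ge_zero] by (simp add: rl_kernel_1)
        moreover have "ennreal (exp (- l * t)) * ennreal (norm (x t)) \<le> ennreal (exp (- l * t)) * ennreal M"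
          by (intro mult_left_mono ennreal_leI M) simp
        ultimately show ?thesis by (simp add: mult.commute)
      qed (simp add: s)
    qed
    also have "\<dots> = ennreal M * (ennreal (exp (- l * s)) * (\<integral>\<^sup>+t. (\<lambda>u. ennreal (exp (- l * u)) * ennreal (rl_kernel 1 u)) (t - s) \<partial>lborel))"
      by (simp add: nn_integral_cmult)
    also have "(\<integral>\<^sup>+t. (\<lambda>u. ennreal (exp (- l * u)) * ennreal (rl_kernel 1 u)) (t - s) \<partial>lborel) = (\<integral>\<^sup>+u. ennreal (exp (- l * u)) * ennreal (rl_kernel 1 u) \<partial>lborel)"
      by (rule nn_integral_translate) measurable
    also have "\<dots> = ennreal (l powr - 1)" by (rule rl_kernel_laplace) (use l in auto)
    finally show "weighted_norm l x < \<infinity>"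
      by (rule le_less_trans) (simp add: ennreal_mult_less_top)
  next
    fix t
    have "ennreal (norm (x t)) \<le> ennreal (norm (vconv \<alpha> (\<lambda>r. A r *v x r) t))"
    proof (rule ennreal_leI)
      have "norm (x t) = \<bar>c t\<bar> * norm (vconv \<alpha> (\<lambda>r. A r *v x r) t)" by (subst eq(1)) simp
      also have "\<dots> \<le> 1 * norm (vconv \<alpha> (\<lambda>r. A r *v x r) t)" by (intro mult_right_mono eq(2)) simp
      finally show "norm (x t) \<le> norm (vconv \<alpha> (\<lambda>r. A r *v x r) t)" by simp
    qed
    also have "\<dots> \<le> norm_vconv \<alpha> (\<lambda>r. A r *v x r) t"
      by (intro norm_vconv_le apply_A_measurable x)
    also have "\<dots> \<le> ennreal K * norm_vconv \<alpha> x t"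
      by (rule nn_integral_A_le[OF x])
    finally show "ennreal (norm (x t)) \<le> ennreal K * norm_vconv \<alpha> x t" .
  qed measurable
  then have "AE t in lborel. x t = 0" by eventually_elim simp
  \<comment> \<open>So far \<open>x\<close> vanishes almost everywhere; the convolution does not see
    the exceptional set, so the equation itself gives the value at every t.\<close>
  then have "vconv \<alpha> (\<lambda>r. A r *v x r) t = vconv \<alpha> (\<lambda>r. 0) t"
    by (intro vconv_cong_AE apply_A_measurable x) (auto elim: eventually_mono)
  also have "\<dots> = 0" by (simp add: vconv_def kconv_def vec_eq_iff)
  finally show ?thesis by (subst eq(1)) simp
qed

end

section \<open>Measurability and bounds for the resolvent\<close>

text \<open>The free term of the Riemann-Liouville equation: the Hadamard product of the row
  constant kernel matrix with the identity, acting on a vector.\<close>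

definition kernel_apply :: "real^'m \<Rightarrow> real \<Rightarrow> real^'m \<Rightarrow> real^'m" where
  "kernel_apply \<alpha> u v = (\<chi> i. rl_kernel (\<alpha> $ i) u * v $ i)"

text \<open>Y t s stands for Z(t,s) B(s), cut to s < t <= T. Its measurability and integrability are
  assumed in t alone, separately for each s; everything about s is to be derived.\<close>

locale resolvent = volterra \<alpha> A K for \<alpha> :: "real^'m" and A K +
  fixes a T :: real and B :: "real \<Rightarrow> real^'m" and L :: real and Y :: "real \<Rightarrow> real \<Rightarrow> real^'m"
  assumes B_measurable [measurable]: "B \<in> borel_measurable borel"
    and norm_B_le: "\<And>s. norm (B s) \<le> L" and B_eq_0: "\<And>s. s \<le> a \<Longrightarrow> B s = 0"
    and Y_eq: "\<And>t s. Y t s = indicator {s<..T} t *\<^sub>R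
        (kernel_apply \<alpha> (t - s) (B s) + vconv \<alpha> (\<lambda>r. A r *v Y r s) t)"
    and Y_measurable: "\<And>s. (\<lambda>t. Y t s) \<in> borel_measurable borel"
    and Y_integrable: "\<And>s. (\<integral>\<^sup>+t. ennreal (norm (Y t s)) \<partial>lborel) < \<infinity>"
begin

abbreviation step :: "(real \<Rightarrow> real \<Rightarrow> real^'m) \<Rightarrow> real \<Rightarrow> real \<Rightarrow> real^'m" where
  "step X t s \<equiv> indicator {s<..T} t *\<^sub>R
      (kernel_apply \<alpha> (t - s) (B s) + vconv \<alpha> (\<lambda>r. A r *v X r s) t)"

lemma L_nonneg: "0 \<le> L" using norm_B_le[of 0] norm_ge_zero order_trans by blast

text \<open>Started at 0, the iterates are built from A and B alone, so their measurability in both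
  variables does not depend on Y.\<close>

primrec picard :: "nat \<Rightarrow> real \<Rightarrow> real \<Rightarrow> real^'m" where
  "picard 0 = (\<lambda>t s. 0)"
| "picard (Suc n) = (\<lambda>t s. step (picard n) t s)"

lemma norm_kernel_apply_le: "norm (kernel_apply \<alpha> u v) \<le> kernel_sum \<alpha> u * norm v"
proof -
  have "norm (kernel_apply \<alpha> u v) \<le> (\<Sum>i\<in>UNIV. \<bar>kernel_apply \<alpha> u v $ i\<bar>)" by (rule norm_le_l1_cart)
  also have "\<dots> \<le> (\<Sum>i\<in>UNIV. rl_kernel (\<alpha> $ i) u * norm v)"
    using \<alpha>_pos by (intro sum_mono) (auto simp: kernel_apply_def abs_mult intro!: mult_left_mono component_le_norm_cart)
  finally show ?thesis by (simp add: kernel_sum_def sum_distrib_right)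
qed

section \<open>Joint measurability of the Picard iterates\<close>

lemma matrix_apply_jointly_measurable:
  assumes X: "(\<lambda>z. X (fst z) (snd z)) \<in> borel_measurable (lborel \<Otimes>\<^sub>M lborel)"
    and f: "f \<in> borel_measurable M" and g: "g \<in> borel_measurable M"
  shows "(\<lambda>z. A (f z) *v X (f z) (g z)) \<in> borel_measurable M"
proof (rule borel_measurable_matrix_vector_mult)
  show "(\<lambda>z. A (f z)) \<in> borel_measurable M" by (rule measurable_compose[OF f]) measurable
  have "(\<lambda>z. (f z, g z)) \<in> measurable M (lborel \<Otimes>\<^sub>M lborel)" using f g by measurable
  from measurable_compose[OF this X] show "(\<lambda>z. X (f z) (g z)) \<in> borel_measurable M" by simp
qed

lemma vconv_jointly_measurable:
  assumes X: "(\<lambda>z. X (fst z) (snd z)) \<in> borel_measurable (lborel \<Otimes>\<^sub>M lborel)"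
  shows "(\<lambda>z. vconv \<alpha> (\<lambda>r. A r *v X r (snd z)) (fst z)) \<in> borel_measurable (lborel \<Otimes>\<^sub>M lborel)"
proof (rule borel_measurable_vecI)
  fix i
  have "(\<lambda>z. (A (snd z) *v X (snd z) (snd (fst z))) $ i) \<in> borel_measurable ((lborel \<Otimes>\<^sub>M lborel) \<Otimes>\<^sub>M (lborel :: real measure))"
    by (intro borel_measurable_vec_component matrix_apply_jointly_measurable[OF X]) measurable
  note [measurable] = this
  have "case_prod (\<lambda>z r. rl_kernel (\<alpha> $ i) (fst z - r) * (A r *v X r (snd z)) $ i)
      \<in> borel_measurable ((lborel \<Otimes>\<^sub>M lborel) \<Otimes>\<^sub>M lborel)"
    unfolding case_prod_beta' by measurable
  from lborel.borel_measurable_lebesgue_integral[OF this]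
  show "(\<lambda>z. vconv \<alpha> (\<lambda>r. A r *v X r (snd z)) (fst z) $ i) \<in> borel_measurable (lborel \<Otimes>\<^sub>M lborel)"
    by (simp add: vconv_def kconv_def)
qed

lemma step_jointly_measurable:
  assumes X: "(\<lambda>z. X (fst z) (snd z)) \<in> borel_measurable (lborel \<Otimes>\<^sub>M lborel)"
  shows "(\<lambda>z. indicator {snd z<..T} (fst z) *\<^sub>R
      (kernel_apply \<alpha> (fst z - snd z) (B (snd z)) + vconv \<alpha> (\<lambda>r. A r *v X r (snd z)) (fst z)))
      \<in> borel_measurable (lborel \<Otimes>\<^sub>M lborel)"
proof -
  have 1: "(\<lambda>z. kernel_apply \<alpha> (fst z - snd z) (B (snd z))) \<in> borel_measurable (lborel \<Otimes>\<^sub>M lborel)"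
  proof (rule borel_measurable_vecI)
    fix i
    have "(\<lambda>z. B (snd z) $ i) \<in> borel_measurable (lborel \<Otimes>\<^sub>M (lborel :: real measure))"
      by (intro borel_measurable_vec_component) measurable
    note [measurable] = this
    show "(\<lambda>z. kernel_apply \<alpha> (fst z - snd z) (B (snd z)) $ i) \<in> borel_measurable (lborel \<Otimes>\<^sub>M lborel)"
      unfolding kernel_apply_def vec_lambda_beta by measurable
  qed
  have 2: "(\<lambda>z. indicator {snd z<..T} (fst z) :: real) \<in> borel_measurable (lborel \<Otimes>\<^sub>M lborel)"
    unfolding indicator_def by simp
  show ?thesis by (intro borel_measurable_scaleR borel_measurable_add 1 2 vconv_jointly_measurable X)
qed

lemma picard_jointly_measurable:
  "(\<lambda>z. picard n (fst z) (snd z)) \<in> borel_measurable (lborel \<Otimes>\<^sub>M lborel)"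
proof (induction n)
  case (Suc n)
  from step_jointly_measurable[OF this] show ?case by simp
qed simp

lemma jointly_measurable_section:
  assumes X: "(\<lambda>z. X (fst z) (snd z)) \<in> borel_measurable (lborel \<Otimes>\<^sub>M lborel)"
  shows "(\<lambda>t. X t s) \<in> borel_measurable borel" "(\<lambda>s. X t s) \<in> borel_measurable borel"
proof -
  have "(\<lambda>t. (t, s)) \<in> measurable lborel (lborel \<Otimes>\<^sub>M lborel)" "(\<lambda>s. (t, s)) \<in> measurable lborel (lborel \<Otimes>\<^sub>M lborel)" by measurable
  from this[THEN measurable_compose, OF X]
  show "(\<lambda>t. X t s) \<in> borel_measurable borel" "(\<lambda>s. X t s) \<in> borel_measurable borel" by simp_all
qed

lemma picard_measurable: "(\<lambda>t. picard n t s) \<in> borel_measurable borel"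
  by (rule jointly_measurable_section[OF picard_jointly_measurable])

section \<open>Convergence of the Picard iterates\<close>

text \<open>The source terms cancel in the difference, leaving one convolution of the error.
  Subtracting the two convolutions needs both to converge, which holds for almost every t because
  both weighted norms are finite.\<close>

lemma picard_error_step:
  assumes l: "0 < l" "K * rate l \<le> 1/2"
    and W: "weighted_norm l (\<lambda>t. Y t s) < \<infinity>"
    and Wn: "weighted_norm l (\<lambda>t. Y t s - picard n t s) < \<infinity>"
  shows "weighted_norm l (\<lambda>t. Y t s - picard (Suc n) t s)
    \<le> ennreal (1/2) * weighted_norm l (\<lambda>t. Y t s - picard n t s)"
proof -
  note [measurable] = Y_measurable[of s] picard_measurable[of n s] picard_measurable[of "Suc n" s]
  define D where "D = (\<lambda>t. Y t s - picard n t s)"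
  have [measurable]: "D \<in> borel_measurable borel" unfolding D_def by measurable
  \<comment> \<open>Finiteness for the iterate follows from that for Y and for the error.\<close>
  have "weighted_norm l (\<lambda>t. picard n t s)
      \<le> (\<integral>\<^sup>+t. ennreal (exp (- l * t)) * ennreal (norm (Y t s)) + ennreal (exp (- l * t)) * ennreal (norm (D t)) \<partial>lborel)"
  proof (rule nn_integral_mono)
    fix t
    have "norm (picard n t s) \<le> norm (Y t s) + norm (D t)"
      using norm_triangle_ineq4[of "Y t s" "D t"] by (simp add: D_def)
    then have "ennreal (norm (picard n t s)) \<le> ennreal (norm (Y t s)) + ennreal (norm (D t))"
      by (simp add: ennreal_plus[symmetric] ennreal_leI del: ennreal_plus)
    from mult_left_mono[OF this, of "ennreal (exp (- l * t))"]
    show "ennreal (exp (- l * t)) * ennreal (norm (picard n t s))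
      \<le> ennreal (exp (- l * t)) * ennreal (norm (Y t s)) + ennreal (exp (- l * t)) * ennreal (norm (D t))"
      by (simp add: distrib_left)
  qed
  also have "\<dots> = weighted_norm l (\<lambda>t. Y t s) + weighted_norm l D"
    by (rule nn_integral_add) measurable
  also have "\<dots> < \<infinity>" using W Wn by (simp add: D_def)
  finally have Wp: "weighted_norm l (\<lambda>t. picard n t s) < \<infinity>" .
  have "AE t in lborel. ennreal (norm (Y t s - picard (Suc n) t s))
      \<le> ennreal K * norm_vconv \<alpha> D t"
    using AE_kernel_sum_finite[OF Y_measurable l(1) W] AE_kernel_sum_finite[OF picard_measurable l(1) Wp]
  proof eventually_elim
    case (elim t)
    have "Y t s - picard (Suc n) t s = indicator {s<..T} t *\<^sub>R
        (vconv \<alpha> (\<lambda>r. A r *v Y r s) t - vconv \<alpha> (\<lambda>r. A r *v picard n r s) t)"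
      by (subst Y_eq) (simp add: scaleR_diff_right[symmetric])
    also have "\<dots> = indicator {s<..T} t *\<^sub>R vconv \<alpha> (\<lambda>r. A r *v D r) t"
      using vconv_diff[OF apply_A_measurable[OF Y_measurable] apply_A_measurable[OF picard_measurable] elim]
      by (simp add: D_def matrix_vector_mult_diff_distrib)
    finally have "norm (Y t s - picard (Suc n) t s) \<le> norm (vconv \<alpha> (\<lambda>r. A r *v D r) t)"
      by (auto simp: indicator_def)
    then have "ennreal (norm (Y t s - picard (Suc n) t s)) \<le> ennreal (norm (vconv \<alpha> (\<lambda>r. A r *v D r) t))"
      by (rule ennreal_leI)
    also have "\<dots> \<le> norm_vconv \<alpha> (\<lambda>r. A r *v D r) t"
      by (intro norm_vconv_le apply_A_measurable) measurable
    also have "\<dots> \<le> ennreal K * norm_vconv \<alpha> D t"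
      by (rule nn_integral_A_le) measurable
    finally show ?case .
  qed
  then have "AE t in lborel. ennreal (exp (- l * t)) * ennreal (norm (Y t s - picard (Suc n) t s))
      \<le> ennreal K * (ennreal (exp (- l * t)) * norm_vconv \<alpha> D t)"
  proof eventually_elim
    case (elim t)
    from mult_left_mono[OF this, of "ennreal (exp (- l * t))"] show ?case by (simp add: mult.left_commute)
  qed
  then have "weighted_norm l (\<lambda>t. Y t s - picard (Suc n) t s)
     \<le> (\<integral>\<^sup>+t. ennreal K * (ennreal (exp (- l * t)) * norm_vconv \<alpha> D t) \<partial>lborel)"
    by (rule nn_integral_mono_AE)
  also have "\<dots> = ennreal K * (\<integral>\<^sup>+t. ennreal (exp (- l * t)) * norm_vconv \<alpha> D t \<partial>lborel)"
    by (rule nn_integral_cmult) measurable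
  also have "\<dots> = ennreal K * (ennreal (rate l) * weighted_norm l D)"
    by (subst laplace_kernel_sum[OF _ l(1)]) auto
  also have "\<dots> = ennreal (K * rate l) * weighted_norm l D"
    using K_nonneg by (simp add: ennreal_mult mult.assoc)
  also have "\<dots> \<le> ennreal (1/2) * weighted_norm l D"
    by (intro mult_right_mono ennreal_leI l) simp
  finally show ?thesis by (simp add: D_def)
qed

lemma Y_eq_0: "t \<le> s \<Longrightarrow> Y t s = 0" by (subst Y_eq) auto

text \<open>The weighted errors decay like 2^(-n), so their sum over n has a finite integral and is
  finite almost everywhere. Hence the full sequence converges pointwise, not merely a
  subsequence.\<close>

lemma picard_tendsto: "AE t in lborel. (\<lambda>n. picard n t s) \<longlonglongrightarrow> Y t s"
proof -
  obtain l where l: "0 < l" "K * rate l \<le> 1/2" by (rule contraction_rate)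
  note [measurable] = Y_measurable[of s] picard_measurable[of _ s]
  define W where "W = weighted_norm l (\<lambda>t. Y t s)"
  define E where "E = (\<lambda>n. \<integral>\<^sup>+t. ennreal (exp (- l * t)) * ennreal (norm (Y t s - picard n t s)) \<partial>lborel)"
  \<comment> \<open>As Y vanishes for t <= s, the weight is at most exp (- l * s) where it
    matters.\<close>
  have "W \<le> (\<integral>\<^sup>+t. ennreal (exp (- l * s)) * ennreal (norm (Y t s)) \<partial>lborel)"
    unfolding W_def
  proof (rule nn_integral_mono)
    fix t
    show "ennreal (exp (- l * t)) * ennreal (norm (Y t s)) \<le> ennreal (exp (- l * s)) * ennreal (norm (Y t s))"
      using l by (cases "t \<le> s") (auto simp: Y_eq_0 intro!: mult_right_mono ennreal_leI)
  qed
  also have "\<dots> = ennreal (exp (- l * s)) * (\<integral>\<^sup>+t. ennreal (norm (Y t s)) \<partial>lborel)"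
    by (rule nn_integral_cmult) measurable
  also have "\<dots> < \<infinity>" using Y_integrable[of s] by (simp add: ennreal_mult_less_top)
  finally have W: "W < \<infinity>" .
  have E: "E n \<le> ennreal ((1/2)^n) * W" for n
  proof (induction n)
    case 0
    then show ?case by (simp add: E_def W_def)
  next
    case (Suc n)
    have fin: "E n < \<infinity>" using Suc W by (auto intro: le_less_trans simp: ennreal_mult_less_top)
    have "E (Suc n) \<le> ennreal (1/2) * E n"
      unfolding E_def by (rule picard_error_step[OF l]) (use W fin in \<open>simp_all only: W_def E_def\<close>)
    also have "\<dots> \<le> ennreal (1/2) * (ennreal ((1/2)^n) * W)" by (intro mult_left_mono Suc) simp
    also have "\<dots> = ennreal ((1/2)^Suc n) * W"
      by (simp only: power_Suc mult.assoc[symmetric]) (subst ennreal_mult, auto)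
    finally show ?case .
  qed
  have "(\<integral>\<^sup>+t. (\<Sum>n. ennreal (exp (- l * t)) * ennreal (norm (Y t s - picard n t s))) \<partial>lborel) = (\<Sum>n. E n)"
    unfolding E_def by (rule nn_integral_suminf) measurable
  also have "\<dots> \<le> (\<Sum>n. ennreal ((1/2)^n) * W)" by (intro suminf_le E) auto
  also have "\<dots> = (\<Sum>n. ennreal ((1/2)^n)) * W" by (rule ennreal_suminf_multc)
  also have "(\<Sum>n. ennreal ((1/2)^n)) = ennreal 2"
    using suminf_geometric[of "1/2 :: real"] by (subst suminf_ennreal2) (auto intro!: summable_geometric)
  also have "ennreal 2 * W < \<infinity>" using W by (simp add: ennreal_mult_less_top)
  finally have "AE t in lborel. (\<Sum>n. ennreal (exp (- l * t)) * ennreal (norm (Y t s - picard n t s))) \<noteq> \<infinity>"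
    by (intro nn_integral_noteq_infinite) auto
  then show ?thesis
  proof eventually_elim
    case (elim t)
    then have "(\<Sum>n. ennreal (exp (- l * t) * norm (Y t s - picard n t s))) \<noteq> top"
      by (simp add: ennreal_mult)
    then have "summable (\<lambda>n. exp (- l * t) * norm (Y t s - picard n t s))"
      by (intro summable_suminf_not_top) auto
    then have "(\<lambda>n. exp (- l * t) * norm (Y t s - picard n t s)) \<longlonglongrightarrow> 0" by (rule summable_LIMSEQ_zero)
    from tendsto_mult_left[OF this, of "exp (l * t)"]
    have "(\<lambda>n. norm (Y t s - picard n t s)) \<longlonglongrightarrow> 0" by (simp add: mult.assoc[symmetric] exp_add[symmetric])
    then have "(\<lambda>n. norm (picard n t s - Y t s)) \<longlonglongrightarrow> 0" by (simp add: norm_minus_commute)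
    then show "(\<lambda>n. picard n t s) \<longlonglongrightarrow> Y t s" by (simp add: tendsto_norm_zero_iff LIM_zero_iff)
  qed
qed

text \<open>The limit X of the iterates is jointly measurable but equals Y only for almost every t,
  with a null set that may depend on s. One application of \<open>step\<close> to X does not see
  these null sets and returns Y exactly, at every pair.\<close>

lemma Y_jointly_measurable: "(\<lambda>z. Y (fst z) (snd z)) \<in> borel_measurable (lborel \<Otimes>\<^sub>M lborel)"
proof -
  define X where "X = (\<lambda>t s. lim (\<lambda>n. picard n t s))"
  have X: "(\<lambda>z. X (fst z) (snd z)) \<in> borel_measurable (lborel \<Otimes>\<^sub>M lborel)"
    unfolding X_def by (intro borel_measurable_lim_metric picard_jointly_measurable)
  have "vconv \<alpha> (\<lambda>r. A r *v Y r s) t = vconv \<alpha> (\<lambda>r. A r *v X r s) t" for t s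
  proof (rule vconv_cong_AE)
    show "AE r in lborel. r < t \<longrightarrow> A r *v Y r s = A r *v X r s"
      using picard_tendsto[of s] by eventually_elim (simp add: X_def limI)
  qed (intro apply_A_measurable Y_measurable jointly_measurable_section[OF X])+
  then have "Y t s = step X t s" for t s
    by (subst Y_eq) simp
  then show ?thesis using step_jointly_measurable[OF X] by simp
qed

section \<open>Integral bounds in the source variable s\<close>

text \<open>The indicator of {..T} is kept in the source term because the bound later used for that
  term holds only up to T.\<close>

lemma norm_step_le:
  assumes x: "x \<in> borel_measurable borel"
  shows "ennreal (norm (indicator {s<..T} t *\<^sub>R (kernel_apply \<alpha> (t - s) (B s) + vconv \<alpha> (\<lambda>r. A r *v x r) t)))
    \<le> indicator {..T} t * (ennreal (kernel_sum \<alpha> (t - s)) * ennreal (norm (B s))) +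
      ennreal K * norm_vconv \<alpha> x t"
proof (cases "t \<in> {s<..T}")
  case True
  have "ennreal (norm (kernel_apply \<alpha> (t - s) (B s) + vconv \<alpha> (\<lambda>r. A r *v x r) t))
      \<le> ennreal (norm (kernel_apply \<alpha> (t - s) (B s))) + ennreal (norm (vconv \<alpha> (\<lambda>r. A r *v x r) t))"
    by (simp add: ennreal_plus[symmetric] ennreal_leI norm_triangle_ineq del: ennreal_plus)
  also have "\<dots> \<le> ennreal (kernel_sum \<alpha> (t - s)) * ennreal (norm (B s)) +
      norm_vconv \<alpha> (\<lambda>r. A r *v x r) t"
    using norm_kernel_apply_le[of "t - s" "B s"]
    by (intro add_mono norm_vconv_le apply_A_measurable x) (simp add: ennreal_mult[symmetric] ennreal_leI)
  also have "\<dots> \<le> ennreal (kernel_sum \<alpha> (t - s)) * ennreal (norm (B s)) +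
      ennreal K * norm_vconv \<alpha> x t"
    by (intro add_left_mono nn_integral_A_le x)
  finally show ?thesis using True by simp
qed simp

text \<open>Tonelli lets the integral over s be taken first, under the convolution; the exponential
  is then reproduced with factor K * \<open>rate l\<close>, at most one half, and the source term
  takes the other half. An assumption for almost every t becomes a bound at every t.\<close>

lemma nn_integral_step_le:
  assumes X: "(\<lambda>z. X (fst z) (snd z)) \<in> borel_measurable (lborel \<Otimes>\<^sub>M lborel)"
    and l: "0 < l" "K * rate l \<le> 1/2"
    and C: "\<And>t. t \<le> T \<Longrightarrow> ennreal (L * (\<Sum>i\<in>UNIV. rl_kernel (\<alpha> $ i + 1) (t - a))) \<le> ennreal (C * exp (l * t) / 2)" "0 \<le> C"
    and bd: "AE t in lborel. (\<integral>\<^sup>+s. ennreal (norm (X t s)) \<partial>lborel) \<le> ennreal (C * exp (l * t))"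
  shows "(\<integral>\<^sup>+s. ennreal (norm (step X t s)) \<partial>lborel)
    \<le> ennreal (C * exp (l * t))"
proof -
  note [measurable] = X
  have Xn: "(\<lambda>z. ennreal (kernel_sum \<alpha> (t - fst z)) * ennreal (norm (X (fst z) (snd z)))) \<in> borel_measurable (lborel \<Otimes>\<^sub>M lborel)"
    by measurable
  have Xn': "(\<lambda>z. ennreal (kernel_sum \<alpha> (t - snd z)) * ennreal (norm (X (snd z) (fst z)))) \<in> borel_measurable (lborel \<Otimes>\<^sub>M lborel)"
    using measurable_compose[OF measurable_pair_swap' Xn] by (simp add: case_prod_beta')
  have [measurable]: "(\<lambda>s. \<integral>\<^sup>+r. ennreal (kernel_sum \<alpha> (t - r)) * ennreal (norm (X r s)) \<partial>lborel) \<in> borel_measurable lborel"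
    using lborel.borel_measurable_nn_integral_fst[OF Xn'] by simp
  have m1: "(\<lambda>s. X t s) \<in> borel_measurable borel" for t by (rule jointly_measurable_section[OF X])
  have "(\<integral>\<^sup>+s. \<integral>\<^sup>+r. ennreal (kernel_sum \<alpha> (t - r)) * ennreal (norm (X r s)) \<partial>lborel \<partial>lborel) =
      (\<integral>\<^sup>+r. \<integral>\<^sup>+s. ennreal (kernel_sum \<alpha> (t - r)) * ennreal (norm (X r s)) \<partial>lborel \<partial>lborel)"
    using lborel_pair.Fubini[OF Xn] by simp
  also have "\<dots> = (\<integral>\<^sup>+r. ennreal (kernel_sum \<alpha> (t - r)) * (\<integral>\<^sup>+s. ennreal (norm (X r s)) \<partial>lborel) \<partial>lborel)"
    using m1 by (intro nn_integral_cong nn_integral_cmult) simp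
  also have "\<dots> \<le> (\<integral>\<^sup>+r. ennreal C * (ennreal (kernel_sum \<alpha> (t - r)) * ennreal (exp (l * r))) \<partial>lborel)"
  proof (rule nn_integral_mono_AE)
    show "AE r in lborel. ennreal (kernel_sum \<alpha> (t - r)) * (\<integral>\<^sup>+s. ennreal (norm (X r s)) \<partial>lborel)
        \<le> ennreal C * (ennreal (kernel_sum \<alpha> (t - r)) * ennreal (exp (l * r)))"
      using bd
    proof eventually_elim
      case (elim r)
      from mult_left_mono[OF elim, of "ennreal (kernel_sum \<alpha> (t - r))"] show ?case
        using C(2) by (simp add: ennreal_mult mult.left_commute)
    qed
  qed
  also have "\<dots> = ennreal C * (\<integral>\<^sup>+r. ennreal (kernel_sum \<alpha> (t - r)) * ennreal (exp (l * r)) \<partial>lborel)"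
    by (rule nn_integral_cmult) measurable
  also have "\<dots> = ennreal C * ennreal (rate l * exp (l * t))"
    by (simp only: nn_integral_kernel_sum_exp[OF l(1)])
  finally have I2: "(\<integral>\<^sup>+s. \<integral>\<^sup>+r. ennreal (kernel_sum \<alpha> (t - r)) * ennreal (norm (X r s)) \<partial>lborel \<partial>lborel)
      \<le> ennreal C * ennreal (rate l * exp (l * t))" .
  have I1: "indicator {..T} t * (\<integral>\<^sup>+s. ennreal (kernel_sum \<alpha> (t - s)) * ennreal (norm (B s)) \<partial>lborel)
      \<le> ennreal (C * exp (l * t) / 2)"
  proof (cases "t \<le> T")
    case True
    have "(\<integral>\<^sup>+s. ennreal (kernel_sum \<alpha> (t - s)) * ennreal (norm (B s)) \<partial>lborel) \<le> ennreal (L * (\<Sum>i\<in>UNIV. rl_kernel (\<alpha> $ i + 1) (t - a)))"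
      by (rule nn_vconv_bounded[OF B_measurable B_eq_0 norm_B_le])
    also have "\<dots> \<le> ennreal (C * exp (l * t) / 2)" by (rule C(1)[OF True])
    finally show ?thesis using True by simp
  qed simp
  have "(\<integral>\<^sup>+s. ennreal (norm (step X t s)) \<partial>lborel)
    \<le> (\<integral>\<^sup>+s. indicator {..T} t * (ennreal (kernel_sum \<alpha> (t - s)) * ennreal (norm (B s))) +
      ennreal K * norm_vconv \<alpha> (\<lambda>r. X r s) t \<partial>lborel)"
    by (intro nn_integral_mono norm_step_le jointly_measurable_section[OF X])
  also have "\<dots> = (\<integral>\<^sup>+s. indicator {..T} t * (ennreal (kernel_sum \<alpha> (t - s)) * ennreal (norm (B s))) \<partial>lborel) +
      (\<integral>\<^sup>+s. ennreal K * norm_vconv \<alpha> (\<lambda>r. X r s) t \<partial>lborel)"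
    by (rule nn_integral_add) measurable
  also have "\<dots> = indicator {..T} t * (\<integral>\<^sup>+s. ennreal (kernel_sum \<alpha> (t - s)) * ennreal (norm (B s)) \<partial>lborel) +
      ennreal K * (\<integral>\<^sup>+s. \<integral>\<^sup>+r. ennreal (kernel_sum \<alpha> (t - r)) * ennreal (norm (X r s)) \<partial>lborel \<partial>lborel)"
    by (simp add: nn_integral_cmult)
  also have "\<dots> \<le> ennreal (C * exp (l * t) / 2) + ennreal K * (ennreal C * ennreal (rate l * exp (l * t)))"
    by (intro add_mono I1 mult_left_mono I2) simp
  also have "\<dots> = ennreal (C * exp (l * t) / 2 + (K * rate l) * (C * exp (l * t)))"
  proof -
    have "ennreal K * (ennreal C * ennreal (rate l * exp (l * t))) = ennreal (K * (C * (rate l * exp (l * t))))"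
      using C(2) K_nonneg by (subst ennreal_mult, simp, simp, subst ennreal_mult) auto
    also have "K * (C * (rate l * exp (l * t))) = (K * rate l) * (C * exp (l * t))" by (simp only: mult_ac)
    finally show ?thesis using C(2) K_nonneg by (simp only: ennreal_plus[symmetric]) (subst ennreal_plus, auto)
  qed
  also have "\<dots> \<le> ennreal (C * exp (l * t))"
  proof (rule ennreal_leI)
    have "(K * rate l) * (C * exp (l * t)) \<le> 1/2 * (C * exp (l * t))"
      using C(2) by (intro mult_right_mono l(2)) simp
    then show "C * exp (l * t) / 2 + (K * rate l) * (C * exp (l * t)) \<le> C * exp (l * t)" by simp
  qed
  finally show ?thesis .
qed

text \<open>The iterates satisfy one bound for all n by induction, and Fatou passes it to Y for
  almost every t. Since Y is its own \<open>step\<close>, a last application removes the exceptional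
  t.\<close>

lemma nn_integral_Y_le: "\<exists>C l. 0 < l \<and> (\<forall>t. (\<integral>\<^sup>+s. ennreal (norm (Y t s)) \<partial>lborel) \<le> ennreal (C * exp (l * t)))"
proof -
  obtain l where l: "0 < l" "K * rate l \<le> 1/2" by (rule contraction_rate)
  define c where "c = L * (\<Sum>i\<in>UNIV. rl_kernel (\<alpha> $ i + 1) (T - a))"
  have \<alpha>1: "0 < \<alpha> $ i + 1" "1 \<le> \<alpha> $ i + 1" for i using \<alpha>_pos[of i] by auto
  have c0: "0 \<le> c" unfolding c_def using L_nonneg \<alpha>1 by (intro mult_nonneg_nonneg sum_nonneg) auto
  \<comment> \<open>Chosen so that C * exp (l * t) / 2 = c * exp (l * (t - a)), which is at least c
    for t > a; for t <= a the kernels vanish.\<close>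
  define C where "C = 2 * c * exp (- l * a)"
  have C0: "0 \<le> C" using c0 by (simp add: C_def)
  have C: "ennreal (L * (\<Sum>i\<in>UNIV. rl_kernel (\<alpha> $ i + 1) (t - a))) \<le> ennreal (C * exp (l * t) / 2)" if t: "t \<le> T" for t
  proof (cases "t \<le> a")
    case True
    then show ?thesis by simp
  next
    case False
    have "L * (\<Sum>i\<in>UNIV. rl_kernel (\<alpha> $ i + 1) (t - a)) \<le> c * 1"
      unfolding c_def using L_nonneg t \<alpha>1 by (auto intro!: mult_left_mono sum_mono rl_kernel_mono)
    also have "\<dots> \<le> c * exp (l * (t - a))" using c0 False l by (intro mult_left_mono) auto
    also have "exp (l * (t - a)) = exp (- l * a) * exp (l * t)" by (simp add: exp_add[symmetric] algebra_simps)
    also have "c * (exp (- l * a) * exp (l * t)) = C * exp (l * t) / 2" by (simp add: C_def)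
    finally show ?thesis by (rule ennreal_leI)
  qed
  have P: "(\<integral>\<^sup>+s. ennreal (norm (picard n t s)) \<partial>lborel) \<le> ennreal (C * exp (l * t))" for n t
  proof (induction n arbitrary: t)
    case (Suc n)
    show ?case using nn_integral_step_le[OF picard_jointly_measurable l C C0, of n t] Suc by simp
  qed simp
  \<comment> \<open>Convergence is known for each s at almost every t, while Fatou in s needs it for
    almost every t at almost every s. Joint measurability permits the exchange.\<close>
  have "AE s in lborel. AE t in lborel. ennreal (norm (Y t s)) \<le> liminf (\<lambda>n. ennreal (norm (picard n t s)))"
  proof (rule AE_I2)
    fix s
    show "AE t in lborel. ennreal (norm (Y t s)) \<le> liminf (\<lambda>n. ennreal (norm (picard n t s)))"
      using picard_tendsto[of s]
    proof eventually_elim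
      case (elim t)
      have "(\<lambda>n. ennreal (norm (picard n t s))) \<longlonglongrightarrow> ennreal (norm (Y t s))"
        by (intro tendsto_intros elim) 
      then show ?case by (simp only: lim_imp_Liminf[OF sequentially_bot] order_refl)
    qed
  qed
  moreover have "{z \<in> space (lborel \<Otimes>\<^sub>M lborel). ennreal (norm (Y (snd z) (fst z))) \<le> liminf (\<lambda>n. ennreal (norm (picard n (snd z) (fst z))))} \<in> sets (lborel \<Otimes>\<^sub>M lborel)"
  proof -
    have [measurable]: "(\<lambda>z. Y (snd z) (fst z)) \<in> borel_measurable (lborel \<Otimes>\<^sub>M lborel)"
      using measurable_compose[OF measurable_pair_swap' Y_jointly_measurable] by (simp add: case_prod_beta')
    have [measurable]: "(\<lambda>z. picard n (snd z) (fst z)) \<in> borel_measurable (lborel \<Otimes>\<^sub>M lborel)" for n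
      using measurable_compose[OF measurable_pair_swap' picard_jointly_measurable[of n]] by (simp add: case_prod_beta')
    show ?thesis by measurable
  qed
  ultimately have "AE t in lborel. AE s in lborel. ennreal (norm (Y t s)) \<le> liminf (\<lambda>n. ennreal (norm (picard n t s)))"
    using lborel_pair.AE_commute[of "\<lambda>s t. ennreal (norm (Y t s)) \<le> liminf (\<lambda>n. ennreal (norm (picard n t s)))"] by simp
  then have bd: "AE t in lborel. (\<integral>\<^sup>+s. ennreal (norm (Y t s)) \<partial>lborel) \<le> ennreal (C * exp (l * t))"
  proof eventually_elim
    case (elim t)
    have [measurable]: "(\<lambda>s. picard n t s) \<in> borel_measurable borel" for n
      by (rule jointly_measurable_section[OF picard_jointly_measurable])
    have "(\<integral>\<^sup>+s. ennreal (norm (Y t s)) \<partial>lborel) \<le> (\<integral>\<^sup>+s. liminf (\<lambda>n. ennreal (norm (picard n t s))) \<partial>lborel)"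
      using elim by (rule nn_integral_mono_AE)
    also have "\<dots> \<le> liminf (\<lambda>n. \<integral>\<^sup>+s. ennreal (norm (picard n t s)) \<partial>lborel)"
      by (rule nn_integral_liminf) measurable
    also have "\<dots> \<le> limsup (\<lambda>n. \<integral>\<^sup>+s. ennreal (norm (picard n t s)) \<partial>lborel)"
      by (rule Liminf_le_Limsup) simp
    also have "\<dots> \<le> ennreal (C * exp (l * t))"
      by (rule Limsup_bounded) (use P in simp)
    finally show ?case .
  qed
  have "(\<integral>\<^sup>+s. ennreal (norm (Y t s)) \<partial>lborel) \<le> ennreal (C * exp (l * t))" for t
    using nn_integral_step_le[OF Y_jointly_measurable l C C0 bd, of t] by (simp only: Y_eq[symmetric])
  with l(1) show ?thesis by blast
qed

section \<open>The equation solved by the integral of Y over s\<close>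

definition W :: "real \<Rightarrow> real^'m" where "W t = (\<integral>s. Y t s \<partial>lborel)"

lemma Y_integrable_source: "integrable lborel (\<lambda>s. Y t s)"
proof (rule integrableI_bounded)
  show "(\<lambda>s. Y t s) \<in> borel_measurable lborel" using jointly_measurable_section[OF Y_jointly_measurable] by simp
  obtain C l where "(\<integral>\<^sup>+s. ennreal (norm (Y t s)) \<partial>lborel) \<le> ennreal (C * exp (l * t))"
    using nn_integral_Y_le by blast
  then show "(\<integral>\<^sup>+s. ennreal (norm (Y t s)) \<partial>lborel) < \<infinity>"
    by (rule le_less_trans) simp
qed

lemma W_measurable: "W \<in> borel_measurable borel"
  using lborel.borel_measurable_lebesgue_integral[of "\<lambda>t s. Y t s" lborel] Y_jointly_measurable
  by (simp add: W_def[abs_def] case_prod_beta')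

lemma norm_W_le: "\<exists>C l. 0 \<le> C \<and> 0 < l \<and> (\<forall>t. norm (W t) \<le> C * exp (l * t))"
proof -
  obtain C l where l: "0 < l" and C: "\<And>t. (\<integral>\<^sup>+s. ennreal (norm (Y t s)) \<partial>lborel) \<le> ennreal (C * exp (l * t))"
    using nn_integral_Y_le by blast
  have "norm (W t) \<le> max 0 C * exp (l * t)" for t
  proof -
    have "ennreal (norm (W t)) \<le> ennreal (C * exp (l * t))"
      unfolding W_def using integral_norm_bound_ennreal[OF Y_integrable_source[of t]] C[of t] by simp
    also have "\<dots> \<le> ennreal (max 0 C * exp (l * t))" by (intro ennreal_leI mult_right_mono) auto
    finally show ?thesis by (subst (asm) ennreal_le_iff) auto
  qed
  with l show ?thesis by (intro exI[of _ "max 0 C"] exI[of _ l]) simp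
qed

text \<open>Integrate the equation of Y(.,s) over s. The exponential bound on the integral of |Y|
  over s makes the double integrand absolutely integrable, so Fubini moves the integral over s
  inside the convolution, where it meets a linear map.\<close>

lemma W_eq:
  assumes t: "t \<le> T"
  shows "W t = vconv \<alpha> B t + vconv \<alpha> (\<lambda>r. A r *v W r) t"
proof -
  obtain C l where l: "0 < l" and C: "\<And>t. (\<integral>\<^sup>+s. ennreal (norm (Y t s)) \<partial>lborel) \<le> ennreal (C * exp (l * t))"
    using nn_integral_Y_le by blast
  have Y': "Y t s = kernel_apply \<alpha> (t - s) (B s) + vconv \<alpha> (\<lambda>r. A r *v Y r s) t" for s
  proof (cases "s < t")
    case True
    then show ?thesis using t by (subst Y_eq) simp
  next
    case False
    then have "vconv \<alpha> (\<lambda>r. A r *v Y r s) t = 0"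
      by (intro vconv_eq_0[where s = s]) (auto simp: Y_eq_0)
    then show ?thesis using False by (simp add: Y_eq_0 kernel_apply_def vec_eq_iff)
  qed
  have "W t $ i = vconv \<alpha> B t $ i + vconv \<alpha> (\<lambda>r. A r *v W r) t $ i" for i
  proof -
    define H where "H = (\<lambda>r s. rl_kernel (\<alpha> $ i) (t - r) * (A r *v Y r s) $ i)"
    have mA: "(\<lambda>z. A (fst z) *v Y (fst z) (snd z)) \<in> borel_measurable (lborel \<Otimes>\<^sub>M lborel)"
      by (rule matrix_apply_jointly_measurable[OF Y_jointly_measurable]) measurable
    have [measurable]: "(\<lambda>z. (A (fst z) *v Y (fst z) (snd z)) $ i) \<in> borel_measurable (lborel \<Otimes>\<^sub>M lborel)"
      by (rule borel_measurable_vec_component[OF mA])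
    have Hm: "(\<lambda>z. H (fst z) (snd z)) \<in> borel_measurable (lborel \<Otimes>\<^sub>M lborel)" unfolding H_def by measurable
    have mY: "(\<lambda>s. Y r s) \<in> borel_measurable borel" for r by (rule jointly_measurable_section[OF Y_jointly_measurable])
    have "(\<integral>\<^sup>+z. ennreal (norm (H (fst z) (snd z))) \<partial>(lborel \<Otimes>\<^sub>M lborel)) = (\<integral>\<^sup>+r. \<integral>\<^sup>+s. ennreal (norm (H r s)) \<partial>lborel \<partial>lborel)"
      using lborel.nn_integral_fst[of "\<lambda>z. ennreal (norm (H (fst z) (snd z)))" lborel] Hm by simp
    also have "\<dots> \<le> (\<integral>\<^sup>+r. ennreal (K * max 0 C) * (ennreal (kernel_sum \<alpha> (t - r)) * ennreal (exp (l * r))) \<partial>lborel)"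
    proof (rule nn_integral_mono)
      fix r
      have "(\<integral>\<^sup>+s. ennreal (norm (H r s)) \<partial>lborel) \<le> (\<integral>\<^sup>+s. (ennreal (kernel_sum \<alpha> (t - r)) * ennreal K) * ennreal (norm (Y r s)) \<partial>lborel)"
      proof (rule nn_integral_mono)
        fix s
        have "norm (H r s) \<le> kernel_sum \<alpha> (t - r) * (K * norm (Y r s))"
          unfolding H_def norm_mult using \<alpha>_pos
          by (intro mult_mono) (auto simp: rl_kernel_le_kernel_sum intro: order_trans[OF component_le_norm_cart norm_A_le])
        then show "ennreal (norm (H r s)) \<le> (ennreal (kernel_sum \<alpha> (t - r)) * ennreal K) * ennreal (norm (Y r s))"
          using K_nonneg by (simp add: ennreal_mult[symmetric] ennreal_leI mult.assoc)
      qed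
      also have "\<dots> = (ennreal (kernel_sum \<alpha> (t - r)) * ennreal K) * (\<integral>\<^sup>+s. ennreal (norm (Y r s)) \<partial>lborel)"
        using mY[of r] by (intro nn_integral_cmult) simp
      also have "\<dots> \<le> (ennreal (kernel_sum \<alpha> (t - r)) * ennreal K) * ennreal (max 0 C * exp (l * r))"
        by (intro mult_left_mono order_trans[OF C] ennreal_leI mult_right_mono) auto
      also have "\<dots> = ennreal (K * max 0 C) * (ennreal (kernel_sum \<alpha> (t - r)) * ennreal (exp (l * r)))"
        using K_nonneg by (simp add: ennreal_mult[symmetric] mult_ac)
      finally show "(\<integral>\<^sup>+s. ennreal (norm (H r s)) \<partial>lborel) \<le> ennreal (K * max 0 C) * (ennreal (kernel_sum \<alpha> (t - r)) * ennreal (exp (l * r)))" .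
    qed
    also have "\<dots> < \<infinity>"
      by (subst nn_integral_cmult) (auto simp: nn_integral_kernel_sum_exp[OF l] ennreal_mult_less_top)
    finally have H: "integrable (lborel \<Otimes>\<^sub>M lborel) (case_prod H)"
      using Hm by (intro integrableI_bounded) (auto simp: case_prod_beta')
    have H1: "(\<integral>r. H r s \<partial>lborel) = vconv \<alpha> (\<lambda>r. A r *v Y r s) t $ i" for s
      by (simp add: H_def vconv_def kconv_def)
    have H2: "(\<integral>s. H r s \<partial>lborel) = rl_kernel (\<alpha> $ i) (t - r) * (A r *v W r) $ i" for r
    proof -
      have "bounded_linear (\<lambda>v. (A r *v v) $ i)"
        by (intro bounded_linear_compose[OF bounded_linear_vec_nth] matrix_vector_mul_bounded_linear)
      from integral_bounded_linear[OF this Y_integrable_source[of r]]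
      show ?thesis by (simp add: H_def W_def)
    qed
    have iB: "integrable lborel (\<lambda>s. rl_kernel (\<alpha> $ i) (t - s) * B s $ i)"
      by (rule vconv_integrable[OF B_measurable le_less_trans[OF nn_vconv_bounded[OF B_measurable B_eq_0 norm_B_le]]])
        (simp_all only: ennreal_less_top infinity_ennreal_def)
    have iH: "integrable lborel (\<lambda>s. \<integral>r. H r s \<partial>lborel)"
      using lborel_pair.integrable_snd[OF H] .
    have "W t $ i = (\<integral>s. Y t s $ i \<partial>lborel)"
      unfolding W_def using integral_bounded_linear[OF bounded_linear_vec_nth[of i] Y_integrable_source[of t]] by simp
    also have "\<dots> = (\<integral>s. rl_kernel (\<alpha> $ i) (t - s) * B s $ i + (\<integral>r. H r s \<partial>lborel) \<partial>lborel)"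
      unfolding H1 Y' by (simp add: kernel_apply_def)
    also have "\<dots> = (\<integral>s. rl_kernel (\<alpha> $ i) (t - s) * B s $ i \<partial>lborel) + (\<integral>s. (\<integral>r. H r s \<partial>lborel) \<partial>lborel)"
      by (rule Bochner_Integration.integral_add[OF iB iH])
    also have "(\<integral>s. (\<integral>r. H r s \<partial>lborel) \<partial>lborel) = (\<integral>r. (\<integral>s. H r s \<partial>lborel) \<partial>lborel)"
      by (rule lborel_pair.Fubini_integral[OF H])
    finally show ?thesis unfolding H2 by (simp add: vconv_def kconv_def)
  qed
  then show ?thesis by (simp add: vec_eq_iff)
qed

end

section \<open>The linear Caputo problem\<close>

text \<open>A crude constant is enough, since K enters only through the choice of l.\<close>

lemma norm_matrix_vector_le:
  fixes A :: "real^'n^'m"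
  shows "norm (A *v x) \<le> (real CARD('m) * real CARD('n) * norm A) * norm x"
proof -
  have "\<bar>A $ i $ j\<bar> \<le> norm A" for i j
    using component_le_norm_cart[of "A $ i" j] Finite_Cartesian_Product.norm_nth_le[where x = A and i = i] by linarith
  then have "onorm ((*v) A) \<le> real CARD('m) * real CARD('n) * norm A" by (rule onorm_le_matrix_component)
  then show ?thesis
    using onorm[OF matrix_vector_mul_bounded_linear[of A], of x] by (meson mult_right_mono norm_ge_zero order_trans)
qed

lemma Linf_loc_borel_version:
  fixes f :: "real \<Rightarrow> 'b::euclidean_space"
  assumes f: "f \<in> Linf_loc I" and T: "{a..T} \<subseteq> I"
  obtains f' M where "borel_version a T f f'" "\<And>r. norm (f' r) \<le> M" "0 \<le> M"
proof -
  have "f \<in> borel_measurable (lebesgue_on {a..T}) \<and> (\<exists>K. AE t in lebesgue. t \<in> {a..T} \<longrightarrow> norm (f t) \<le> K)"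
    using f T unfolding Linf_loc_def by blast
  then obtain K where meas: "f \<in> borel_measurable (lebesgue_on {a..T})"
    and K: "AE t in lborel. t \<in> {a..T} \<longrightarrow> norm (f t) \<le> K"
    unfolding AE_completion_iff by blast
  have h: "(\<lambda>x. indicator {a..T} x *\<^sub>R f x) \<in> borel_measurable lebesgue"
    using meas by (subst (asm) borel_measurable_restrict_space_iff) auto
  have "\<exists>g\<in>borel_measurable borel. AE x in lborel. (indicator {a..T} x *\<^sub>R f x) \<bullet> b = g x" if "b \<in> Basis" for b
  proof -
    have "(\<lambda>x. (indicator {a..T} x *\<^sub>R f x) \<bullet> b) \<in> borel_measurable lebesgue" by (intro borel_measurable_inner h) simp
    from completion_ex_borel_measurable_real[OF this] show ?thesis by simp
  qed
  then obtain g where g: "\<And>b. b \<in> Basis \<Longrightarrow> g b \<in> borel_measurable borel"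
      "\<And>b. b \<in> Basis \<Longrightarrow> AE x in lborel. (indicator {a..T} x *\<^sub>R f x) \<bullet> b = g b x"
    by metis
  define G where "G = (\<lambda>x. \<Sum>b\<in>Basis. g b x *\<^sub>R b)"
  have [measurable]: "G \<in> borel_measurable borel"
    unfolding G_def using g(1) by (intro borel_measurable_sum borel_measurable_scaleR) auto
  have "AE x in lborel. \<forall>b\<in>Basis. (indicator {a..T} x *\<^sub>R f x) \<bullet> b = g b x"
    using g(2) by (intro AE_finite_allI) auto
  then have G: "AE x in lborel. indicator {a..T} x *\<^sub>R f x = G x"
  proof eventually_elim
    case (elim x)
    have "indicator {a..T} x *\<^sub>R f x = (\<Sum>b\<in>Basis. ((indicator {a..T} x *\<^sub>R f x) \<bullet> b) *\<^sub>R b)"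
      by (rule euclidean_representation[symmetric])
    also have "\<dots> = G x" unfolding G_def by (intro sum.cong refl) (simp only: elim)
    finally show ?case .
  qed
  \<comment> \<open>Truncation at the essential bound changes a null set only and makes the
    representative bounded at every point.\<close>
  define f' where "f' = (\<lambda>x. if x \<in> {a<..T} \<and> norm (G x) \<le> K then G x else 0)"
  have "f' \<in> borel_measurable borel" unfolding f'_def by measurable
  moreover have "AE x in lborel. x \<in> {a..T} \<longrightarrow> f x = f' x"
    using G K AE_lborel_singleton[of a] by eventually_elim (auto simp: f'_def)
  ultimately have "borel_version a T f f'" by (auto simp: borel_version_def f'_def)
  moreover have "norm (f' r) \<le> max K 0" for r by (auto simp: f'_def)
  ultimately show ?thesis by (rule that) simp
qed

lemma (in volterra) vconv_matrix_vector:
  fixes X :: "real \<Rightarrow> real^'m^'m"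
  assumes "\<And>i j. integrable lborel (\<lambda>r. rl_kernel (\<alpha> $ i) (t - r) * (A r ** X r) $ i $ j)"
  shows "vconv \<alpha> (\<lambda>r. A r *v (X r *v b)) t $ i = (\<Sum>j\<in>UNIV. kconv (\<alpha> $ i) (\<lambda>r. (A r ** X r) $ i $ j) t * b $ j)"
proof -
  have "vconv \<alpha> (\<lambda>r. A r *v (X r *v b)) t $ i
    = (\<integral>r. (\<Sum>j\<in>UNIV. rl_kernel (\<alpha> $ i) (t - r) * (A r ** X r) $ i $ j * b $ j) \<partial>lborel)"
    by (simp add: vconv_def kconv_def matrix_vector_mul_assoc matrix_vector_mult_def[of "A _ ** X _"] sum_distrib_left mult.assoc)
  also have "\<dots> = (\<Sum>j\<in>UNIV. \<integral>r. rl_kernel (\<alpha> $ i) (t - r) * (A r ** X r) $ i $ j * b $ j \<partial>lborel)"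
    using assms by (intro Bochner_Integration.integral_sum) auto
  finally show ?thesis by (simp add: kconv_def)
qed

text \<open>The problem on one compact interval, with Borel versions A' and B' of the data. The
  interval I need not be compact, so A', B' and the constants depend on T; statements about I come
  from varying T.\<close>

locale linear_cauchy = volterra \<alpha> A' K for \<alpha> :: "real^'m" and A' K +
  fixes a T :: real and A :: "real \<Rightarrow> real^'m^'m" and B B' :: "real \<Rightarrow> real^'m" and L :: real
  assumes a_less_T: "a < T" and A_version: "borel_version a T A A'"
    and B_version: "borel_version a T B B'" and norm_B'_le: "\<And>s. norm (B' s) \<le> L"
begin

text \<open>Erases the irrelevant values outside the interval, so that a function continuous on
  {a..T} becomes a bounded Borel function on the line.\<close>

abbreviation cut :: "(real \<Rightarrow> 'b::real_vector) \<Rightarrow> real \<Rightarrow> 'b" where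
  "cut q r \<equiv> indicator {a<..T} r *\<^sub>R q r"

abbreviation rhs :: "(real \<Rightarrow> real^'m) \<Rightarrow> real \<Rightarrow> real^'m" where
  "rhs q r \<equiv> A' r *v cut q r + B' r"

lemma cut_bounded:
  fixes q :: "real \<Rightarrow> 'b::euclidean_space"
  assumes q: "continuous_on {a..T} q"
  shows "cut q \<in> borel_measurable borel" "\<exists>M\<ge>0. \<forall>r. norm (cut q r) \<le> M"
proof -
  show "cut q \<in> borel_measurable borel"
    by (rule borel_measurable_continuous_on_indicator) (auto intro: continuous_on_subset[OF q])
  have "bounded (q ` {a..T})" using q by (intro compact_imp_bounded compact_continuous_image) auto
  then obtain M where "\<forall>x\<in>q ` {a..T}. norm x \<le> M" unfolding bounded_iff by blast
  then have M: "norm (q t) \<le> M" if "t \<in> {a..T}" for t using that by blast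
  have "norm (cut q r) \<le> max M 0" for r
    using M[of r] by (auto simp: indicator_def le_max_iff_disj)
  then show "\<exists>M\<ge>0. \<forall>r. norm (cut q r) \<le> M" by (intro exI[of _ "max M 0"]) auto
qed

lemma rhs_version:
  assumes q: "continuous_on {a..T} q"
  defines "g \<equiv> rhs q"
  shows "g \<in> borel_measurable borel" "\<exists>M. \<forall>r. norm (g r) \<le> M" "r \<le> a \<Longrightarrow> g r = 0"
    "borel_version a T (\<lambda>t. (A t *v q t + B t) $ i) (\<lambda>r. g r $ i)"
proof -
  note [measurable] = borel_versionD(1)[OF A_version] borel_versionD(1)[OF B_version] cut_bounded(1)[OF q]
  show m: "g \<in> borel_measurable borel"
    unfolding g_def by (intro borel_measurable_add borel_measurable_matrix_vector_mult) measurable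
  obtain M where M: "M \<ge> 0" "\<And>r. norm (cut q r) \<le> M" using cut_bounded(2)[OF q] by blast
  have "norm (g r) \<le> K * M + L" for r
  proof -
    have "norm (g r) \<le> norm (A' r *v cut q r) + norm (B' r)" unfolding g_def by (rule norm_triangle_ineq)
    also have "\<dots> \<le> K * M + L"
      using norm_A_le[of r "cut q r"] mult_left_mono[OF M(2)[of r] K_nonneg] norm_B'_le[of r] by linarith
    finally show ?thesis .
  qed
  then show "\<exists>M. \<forall>r. norm (g r) \<le> M" by blast
  have z: "g r = 0" if "r \<notin> {a<..T}" for r
    using that B_version unfolding g_def borel_version_def by simp
  show "r \<le> a \<Longrightarrow> g r = 0" by (rule z) simp
  have "AE r in lborel. r \<in> {a..T} \<longrightarrow> (A r *v q r + B r) $ i = g r $ i"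
    using borel_versionD(4)[OF A_version] borel_versionD(4)[OF B_version] AE_lborel_singleton[of a]
    by eventually_elim (auto simp: g_def)
  then show "borel_version a T (\<lambda>t. (A t *v q t + B t) $ i) (\<lambda>r. g r $ i)"
    using z by (auto simp: borel_version_def intro!: borel_measurable_vec_component m)
qed

lemma nn_integral_bounded_finite:
  assumes "f \<in> borel_measurable borel" "\<And>r. r \<le> a \<Longrightarrow> f r = 0" "\<And>r. norm (f r) \<le> M"
  shows "norm_vconv \<alpha> f t < \<infinity>"
  by (rule le_less_trans[OF nn_vconv_bounded[where s = a and M = M, OF assms]])
    (simp_all only: ennreal_less_top infinity_ennreal_def)

lemma local_solution_integral_eq:
  assumes sol: "local_solution a I \<alpha> A B q\<^sub>a q J" and T: "T \<in> J" and t: "t \<in> {a..T}"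
  shows "q t = q\<^sub>a + vconv \<alpha> (rhs q) t"
proof -
  have J: "J \<in> base_intervals a" and qa: "q a = q\<^sub>a"
    and qC: "\<And>i. (\<lambda>t. q t $ i) \<in> Caputo_AC a J (\<alpha> $ i)"
    and dq: "\<And>i. has_Caputo_deriv a J (\<alpha> $ i) (\<lambda>t. q t $ i) (\<lambda>t. (A t *v q t + B t) $ i)"
    using sol by (auto simp: local_solution_def)
  have TJ: "{a..T} \<subseteq> J" by (rule base_intervalsD(2)[OF J T])
  have "continuous_on J (\<lambda>t. \<chi> i. q t $ i)"
    using qC by (intro continuous_on_vec_lambda) (auto simp: Caputo_AC_def)
  then have q: "continuous_on {a..T} q" using TJ by (auto intro: continuous_on_subset)
  obtain M where M: "\<And>r. norm (rhs q r) \<le> M" using rhs_version(2)[OF q] by blast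
  have "q t $ i = q\<^sub>a $ i + vconv \<alpha> (rhs q) t $ i" for i
  proof -
    have "\<bar>(A' r *v cut q r + B' r) $ i\<bar> \<le> M" for r
      using component_le_norm_cart M by (rule order_trans)
    from Caputo_solution_eq[OF \<alpha>_pos \<alpha>_le_1 qC dq TJ a_less_T rhs_version(4)[OF q] this t]
    show ?thesis by (simp add: vconv_def qa)
  qed
  then show ?thesis by (simp add: vec_eq_iff)
qed

lemma integral_eq_unique:
  assumes q: "continuous_on {a..T} q" "\<And>t. t \<in> {a..T} \<Longrightarrow> q t = q\<^sub>a + vconv \<alpha> (rhs q) t"
    and y: "continuous_on {a..T} y" "\<And>t. t \<in> {a..T} \<Longrightarrow> y t = q\<^sub>a + vconv \<alpha> (rhs y) t"
    and t: "t \<in> {a..T}"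
  shows "q t = y t"
proof -
  define d where "d = (\<lambda>t. q t - y t)"
  have cd: "continuous_on {a..T} d" unfolding d_def by (intro continuous_intros q y)
  obtain M where M: "\<And>r. norm (cut d r) \<le> M" using cut_bounded(2)[OF cd] by blast
  have fin: "norm_vconv \<alpha> (rhs x) t < \<infinity>"
    if x: "continuous_on {a..T} x" for x t
  proof -
    obtain M where M: "\<And>r. norm (rhs x r) \<le> M" using rhs_version(2)[OF x] by blast
    show ?thesis by (rule nn_integral_bounded_finite[OF rhs_version(1)[OF x] rhs_version(3)[OF x] M])
  qed
  have deq: "d t = vconv \<alpha> (\<lambda>r. A' r *v cut d r) t" if "t \<in> {a..T}" for t
  proof -
    have "d t = vconv \<alpha> (rhs q) t - vconv \<alpha> (rhs y) t"
      unfolding d_def q(2)[OF that] y(2)[OF that] by simp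
    also have "\<dots> = vconv \<alpha> (\<lambda>r. (A' r *v cut q r + B' r) - (A' r *v cut y r + B' r)) t"
      by (intro vconv_diff[symmetric] rhs_version(1) q(1) y(1) fin)
    finally show ?thesis by (simp add: d_def scaleR_diff_right matrix_vector_mult_diff_distrib)
  qed
  \<comment> \<open>Right of T the cut difference is 0 although the convolution may not be; the
    indicator as factor \<open>c\<close> makes the equation hold there too.\<close>
  have z: "cut d t = 0" for t
    by (rule volterra_unique[where s = a and M = M and c = "indicator {a<..T}"])
      (use deq M cut_bounded(1)[OF cd] in \<open>auto simp: indicator_def\<close>)
  have "d t = vconv \<alpha> (\<lambda>r. 0) t" using deq[OF t] by (simp only: z matrix_vector_mult_0_right)
  also have "\<dots> = 0" by (rule vconv_eq_0[of t]) auto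
  finally show ?thesis by (simp add: d_def)
qed

end

section \<open>Integral equations of the state-transition matrices\<close>

text \<open>The equation is first known for almost every t. Both sides are continuous on {s<..T}:
  the left by assumption, the right because Z is bounded away from s. So it holds at every t > s; at
  s itself the kernel may be singular.\<close>

lemma RL_state_transition_entry_eq:
  fixes A A' :: "real \<Rightarrow> real^'m^'m" and Z :: "real \<Rightarrow> real^'m^'m"
  assumes \<alpha>: "\<And>i. 0 < \<alpha> $ i" "\<And>i. \<alpha> $ i \<le> 1" and T: "{s..T} \<subseteq> J" "s < T"
    and A': "A' \<in> borel_measurable borel" "AE r in lborel. r \<in> {s..T} \<longrightarrow> A r = A' r" "\<And>r. norm (A' r) \<le> M"
    and ZRL: "\<And>i j. (\<lambda>t. Z t $ i $ j) \<in> RL_AC s J (\<alpha> $ i)"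
    and dZ: "\<And>i j. has_RL_deriv s J (\<alpha> $ i) (\<lambda>t. Z t $ i $ j) (\<lambda>t. (A t ** Z t) $ i $ j)"
    and ini: "\<And>i j. frac_int s J (1 - \<alpha> $ i) (\<lambda>t. Z t $ i $ j) s = mat 1 $ i $ j"
    and cont: "continuous_on {s<..T} Z"
  defines "X \<equiv> (\<lambda>r. indicator {s<..T} r *\<^sub>R Z r)"
  shows "X \<in> borel_measurable borel" "integrable lborel (\<lambda>t. X t $ i $ j)"
    and "t \<in> {s<..T} \<Longrightarrow> integrable lborel (\<lambda>r. rl_kernel (\<alpha> $ i) (t - r) * (A' r ** X r) $ i $ j)"
    and "t \<in> {s<..T} \<Longrightarrow> Z t $ i $ j = mat 1 $ i $ j * rl_kernel (\<alpha> $ i) (t - s) + kconv (\<alpha> $ i) (\<lambda>r. (A' r ** X r) $ i $ j) t"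
proof -
  show X: "X \<in> borel_measurable borel"
    unfolding X_def by (rule borel_measurable_continuous_on_indicator[OF _ cont]) simp
  have Xm: "(\<lambda>t. X t $ i $ j) \<in> borel_measurable borel" for i j by (intro borel_measurable_vec_component X)
  have Am: "(\<lambda>t. A' t $ i $ j) \<in> borel_measurable borel" for i j by (intro borel_measurable_vec_component A')
  have zv: "borel_version s T (\<lambda>t. Z t $ i $ j) (\<lambda>t. X t $ i $ j)" for i j
  proof -
    have "AE t in lborel. t \<in> {s..T} \<longrightarrow> Z t $ i $ j = X t $ i $ j"
      using AE_lborel_singleton[of s] by eventually_elim (auto simp: X_def)
    then show ?thesis using Xm by (auto simp: borel_version_def X_def)
  qed
  have zi: "integrable lborel (\<lambda>t. X t $ i $ j)" for i j
  proof -
    have 1: "(\<lambda>t. Z t $ i $ j) absolutely_integrable_on {s..T}"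
      using ZRL[of i j] T(1) by (auto simp: RL_AC_def L1_loc_def)
    have 2: "AE t in lborel. X t $ i $ j = indicator {s..T} t *\<^sub>R (Z t $ i $ j)"
      using AE_lborel_singleton[of s] by eventually_elim (auto simp: X_def indicator_def)
    show ?thesis using lebesgue_integral_borel_version(2)[OF Xm 2] 1 by (simp add: set_integrable_def)
  qed
  show "integrable lborel (\<lambda>t. X t $ i $ j)" by (rule zi)
  define g where "g = (\<lambda>i j r. (A' r ** X r) $ i $ j)"
  have g_sum: "g i j r = (\<Sum>k\<in>UNIV. A' r $ i $ k * X r $ k $ j)" for i j r by (simp add: g_def matrix_matrix_mult_def)
  have Ab: "\<bar>A' r $ i $ k\<bar> \<le> M" for r i k
    using component_le_norm_cart[of "A' r $ i" k] Finite_Cartesian_Product.norm_nth_le[where x = "A' r" and i = i] A'(3)[of r] by linarith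
  have M0: "0 \<le> M" using A'(3)[of 0] norm_ge_zero order_trans by blast
  have gm: "g i j \<in> borel_measurable borel" for i j
    unfolding g_sum[abs_def] by (intro borel_measurable_sum borel_measurable_times Am Xm)
  have gi: "integrable lborel (g i j)" for i j
    unfolding g_sum[abs_def]
  proof (rule Bochner_Integration.integrable_sum)
    fix k
    show "integrable lborel (\<lambda>r. A' r $ i $ k * X r $ k $ j)"
    proof (rule Bochner_Integration.integrable_bound)
      show "integrable lborel (\<lambda>r. M * \<bar>X r $ k $ j\<bar>)" using zi by auto
      show "(\<lambda>r. A' r $ i $ k * X r $ k $ j) \<in> borel_measurable lborel"
        using Am[of i k] Xm[of k j] by simp
    qed (use Ab M0 in \<open>auto simp: abs_mult intro!: AE_I2 mult_right_mono\<close>)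
  qed
  have gv: "borel_version s T (\<lambda>t. (A t ** Z t) $ i $ j) (g i j)" for i j
  proof -
    have "AE t in lborel. t \<in> {s..T} \<longrightarrow> (A t ** Z t) $ i $ j = g i j t"
      using A'(2) AE_lborel_singleton[of s] by eventually_elim (auto simp: X_def g_def)
    moreover have "g i j r = 0" if "r \<notin> {s<..T}" for r using that by (simp add: g_sum X_def)
    ultimately show ?thesis using gm by (auto simp: borel_version_def)
  qed
  have ae: "AE t in lborel. t \<in> {s..T} \<longrightarrow>
      Z t $ i $ j = mat 1 $ i $ j * rl_kernel (\<alpha> $ i) (t - s) + kconv (\<alpha> $ i) (g i j) t" for i j
    using RL_solution_AE[OF \<alpha> ZRL dZ T zv zi gv gi] by (simp add: ini)
  \<comment> \<open>Continuity on the compact interval {c..T} bounds Z there; beyond T the cut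
    function is zero.\<close>
  have bd: "\<exists>C. \<forall>r>c. \<bar>g i j r\<bar> \<le> C" if c: "s < c" for c i j
  proof -
    have "continuous_on {c..T} Z" using cont c by (auto intro: continuous_on_subset)
    then have "bounded (Z ` {c..T})" by (intro compact_imp_bounded compact_continuous_image) auto
    then obtain D where "\<forall>x\<in>Z ` {c..T}. norm x \<le> D" unfolding bounded_iff by blast
    then have D0: "norm (Z t) \<le> D" if "t \<in> {c..T}" for t using that by blast
    have D: "norm (X r) \<le> max D 0" if "r > c" for r
      using that c D0[of r] by (auto simp: X_def indicator_def le_max_iff_disj)
    have "\<bar>g i j r\<bar> \<le> (\<Sum>k\<in>(UNIV::'m set). M * max D 0)" if r: "r > c" for r
    proof -
      have "\<bar>g i j r\<bar> \<le> (\<Sum>k\<in>UNIV. \<bar>A' r $ i $ k * X r $ k $ j\<bar>)" unfolding g_sum by (rule sum_abs)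
      also have "\<dots> \<le> (\<Sum>k\<in>(UNIV::'m set). M * max D 0)"
      proof (rule sum_mono)
        fix k
        have "\<bar>X r $ k $ j\<bar> \<le> max D 0"
          using component_le_norm_cart[of "X r $ k" j] Finite_Cartesian_Product.norm_nth_le[where x = "X r" and i = k] D[OF r] by linarith
        then show "\<bar>A' r $ i $ k * X r $ k $ j\<bar> \<le> M * max D 0"
          unfolding abs_mult using Ab M0 by (intro mult_mono) auto
      qed
      finally show ?thesis .
    qed
    then show ?thesis by blast
  qed
  note lb = kconv_locally_bounded[where s = s, OF gi \<alpha> borel_versionD(2)[OF gv] bd]
  show "integrable lborel (\<lambda>r. rl_kernel (\<alpha> $ i) (t - r) * (A' r ** X r) $ i $ j)" if "t \<in> {s<..T}"
    using lb(1)[where t = t] that by (simp add: g_def)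
  show "Z t $ i $ j = mat 1 $ i $ j * rl_kernel (\<alpha> $ i) (t - s) + kconv (\<alpha> $ i) (\<lambda>r. (A' r ** X r) $ i $ j) t"
    if t: "t \<in> {s<..T}"
  proof -
    \<comment> \<open>The midpoint keeps the interval {c..t} away from the singularity at s.\<close>
    define c where "c = (s + t) / 2"
    have c: "s < c" "c < t" "t \<le> T" using t by (auto simp: c_def field_simps)
    define h where "h = (\<lambda>t. - \<bar>Z t $ i $ j - (mat 1 $ i $ j * rl_kernel (\<alpha> $ i) (t - s) + kconv (\<alpha> $ i) (g i j) t)\<bar>)"
    have ck: "continuous_on {c..t} (\<lambda>t. rl_kernel (\<alpha> $ i) (t - s))"
    proof (subst continuous_on_cong[OF refl])
      show "rl_kernel (\<alpha> $ i) (x - s) = (x - s) powr (\<alpha> $ i - 1) / Gamma (\<alpha> $ i)" if "x \<in> {c..t}" for x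
        using that c by (simp add: rl_kernel_def)
      show "continuous_on {c..t} (\<lambda>x. (x - s) powr (\<alpha> $ i - 1) / Gamma (\<alpha> $ i))"
        using c Gamma_real_pos[OF \<alpha>(1)[of i]] by (intro continuous_intros) auto
    qed
    have "0 \<le> h t"
    proof (rule continuous_AE_nonneg[where f = h and t = t, OF base_intervals_Icc[OF c(2)]])
      have cg: "continuous_on {c..t} (kconv (\<alpha> $ i) (g i j))" 
        by (rule continuous_on_subset[OF lb(2)]) (use c in auto)
      have cZ: "continuous_on {c..t} (\<lambda>t. Z t $ i $ j)"
        by (intro continuous_on_component continuous_on_subset[OF cont]) (use c in auto)
      show "continuous_on {c..t} h" unfolding h_def by (intro continuous_intros cZ ck cg)
      show "AE t' in lborel. t' \<in> {c..t} \<longrightarrow> 0 \<le> h t'"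
        using ae[of i j] by eventually_elim (use c in \<open>auto simp: h_def\<close>)
    qed (use c in auto)
    then show ?thesis by (simp add: h_def g_def)
  qed
qed

context linear_cauchy
begin

text \<open>Makes the results of this locale available with zero source, for the columns of the
  Caputo matrix.\<close>

lemma homogeneous: "linear_cauchy \<alpha> A' K a T A (\<lambda>_. 0) (\<lambda>_. 0) 0"
proof unfold_locales
  show "borel_version a T (\<lambda>_. 0 :: real^'m) (\<lambda>_. 0)" by (simp add: borel_version_def)
qed (simp_all add: a_less_T A_version)

text \<open>Because the order matrix is row constant, each column of the Caputo matrix solves the
  homogeneous vector problem with orders \<alpha>, starting from a unit vector. The equation for p
  is the combination of the column equations with the entries of the initial value.\<close>

lemma Caputo_transition_integral_eq:
  fixes q\<^sub>a :: "real^'m"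
  assumes I: "I \<in> base_intervals a" and T: "T \<in> I"
    and cZ: "Caputo_state_transition I A (row_constant \<alpha>) cZ"
  defines "p \<equiv> (\<lambda>t. cZ t a *v q\<^sub>a)"
  shows "continuous_on {a..T} p" "t \<in> {a..T} \<Longrightarrow> p t = q\<^sub>a + vconv \<alpha> (\<lambda>r. A' r *v cut p r) t"
proof -
  have IA: "I \<inter> {a..} = I" using base_intervalsD(4)[OF I] by auto
  have c: "(\<lambda>t. cZ t a $ i $ j) \<in> Caputo_AC a I (\<alpha> $ i)"
      "has_Caputo_deriv a I (\<alpha> $ i) (\<lambda>t. cZ t a $ i $ j) (\<lambda>t. (A t ** cZ t a) $ i $ j)"
      "cZ a a = mat 1" for i j
    using cZ T a_less_T base_intervalsD(1)[OF I] unfolding Caputo_state_transition_def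
    by (auto simp: IA row_constant_def)
  have TI: "{a..T} \<subseteq> I" by (rule base_intervalsD(2)[OF I T])
  have cc: "continuous_on {a..T} (\<lambda>t. cZ t a $ i $ j)" for i j
    using c(1)[of i j] TI by (auto simp: Caputo_AC_def intro: continuous_on_subset)
  define y where "y = (\<lambda>j t. column j (cZ t a))"
  have cr: "continuous_on {a..T} (y j)" for j
    unfolding y_def column_def by (intro continuous_on_vec_lambda cc)
  have "continuous_on {a..T} (\<lambda>t. \<chi> i. \<Sum>j\<in>UNIV. cZ t a $ i $ j * q\<^sub>a $ j)"
    by (intro continuous_on_vec_lambda continuous_intros cc)
  then show cp: "continuous_on {a..T} p" by (simp add: p_def matrix_vector_mult_def)
  interpret C: linear_cauchy \<alpha> A' K a T A "\<lambda>_. 0" "\<lambda>_. 0" 0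
    by (rule homogeneous)
  have mv: "(A t ** cZ t a) $ i $ j = (A t *v y j t) $ i" for t i j
    by (simp add: y_def matrix_matrix_mult_def matrix_vector_mult_def column_def)
  have sol: "local_solution a I \<alpha> A (\<lambda>_. 0) (axis j 1) (y j) I" for j
    unfolding local_solution_def
  proof (intro conjI allI)
    show "y j a = axis j 1" by (simp add: y_def c(3) column_def mat_def axis_def vec_eq_iff)
    show "(\<lambda>t. y j t $ i) \<in> Caputo_AC a I (\<alpha> $ i)" for i using c(1)[of i j] by (simp add: y_def column_def)
    show "has_Caputo_deriv a I (\<alpha> $ i) (\<lambda>t. y j t $ i) (\<lambda>t. (A t *v y j t + 0) $ i)" for i
      using c(2)[of i j] unfolding mv by (simp add: y_def column_def)
  qed (use I in auto)
  have req: "y j t = axis j 1 + vconv \<alpha> (\<lambda>r. A' r *v cut (y j) r) t" if "t \<in> {a..T}" for j t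
    using C.local_solution_integral_eq[OF sol T that] by simp
  define X where "X = (\<lambda>r. cut (\<lambda>t. cZ t a) r)"
  have AX: "(A' r ** X r) $ i $ j = (A' r *v cut (y j) r) $ i" for r i j
    by (simp add: X_def y_def matrix_matrix_mult_def matrix_vector_mult_def column_def)
  have int: "integrable lborel (\<lambda>r. rl_kernel (\<alpha> $ i) (t - r) * (A' r ** X r) $ i $ j)" for i j t
  proof -
    obtain M where M: "\<And>r. norm (A' r *v cut (y j) r + 0) \<le> M" using C.rhs_version(2)[OF cr] by blast
    have "norm_vconv \<alpha> (\<lambda>r. A' r *v cut (y j) r + 0) t < \<infinity>"
      by (rule nn_integral_bounded_finite[OF C.rhs_version(1)[OF cr] C.rhs_version(3)[OF cr] M])
    from vconv_integrable[OF C.rhs_version(1)[OF cr] this, of i] show ?thesis unfolding AX by simp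
  qed
  show "p t = q\<^sub>a + vconv \<alpha> (\<lambda>r. A' r *v cut p r) t" if t: "t \<in> {a..T}"
  proof -
    have cp': "cut p r = X r *v q\<^sub>a" for r by (simp add: p_def X_def scaleR_matrix_vector_assoc)
    have "p t $ i = q\<^sub>a $ i + vconv \<alpha> (\<lambda>r. A' r *v cut p r) t $ i" for i
    proof -
      have "p t $ i = (\<Sum>j\<in>UNIV. y j t $ i * q\<^sub>a $ j)" by (simp add: p_def y_def column_def matrix_vector_mult_def)
      also have "\<dots> = (\<Sum>j\<in>UNIV. (if j = i then q\<^sub>a $ j else 0) + kconv (\<alpha> $ i) (\<lambda>r. (A' r ** X r) $ i $ j) t * q\<^sub>a $ j)"
        unfolding AX by (intro sum.cong refl, subst req[OF t]) (auto simp: vconv_def axis_def algebra_simps)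
      also have "\<dots> = q\<^sub>a $ i + vconv \<alpha> (\<lambda>r. A' r *v cut p r) t $ i"
        unfolding cp' vconv_matrix_vector[OF int] by (simp add: sum.distrib)
      finally show ?thesis .
    qed
    then show ?thesis by (simp add: vec_eq_iff)
  qed
qed

text \<open>Verifies the assumptions of \<open>resolvent\<close> for the columns applied to B'(s),
  and reads its conclusion back in terms of Z and B.\<close>

lemma RL_transition_integral_eq:
  assumes I: "I \<in> base_intervals a" and T: "T \<in> I"
    and Z: "RL_state_transition I A (row_constant \<alpha>) Z" and M: "\<And>r. norm (A' r) \<le> M"
  defines "w \<equiv> (\<lambda>t. LINT s:{a..t}|lebesgue. Z t s *v B s)"
  shows "t \<in> {a..T} \<Longrightarrow> (\<lambda>s. Z t s *v B s) absolutely_integrable_on {a..t}"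
    and "continuous_on {a..T} w" "t \<in> {a..T} \<Longrightarrow> w t = vconv \<alpha> (rhs w) t"
proof -
  have TI: "{a..T} \<subseteq> I" by (rule base_intervalsD(2)[OF I T])
  note B0 = borel_versionD(2)[OF B_version] and Bm[measurable] = borel_versionD(1)[OF B_version]
  \<comment> \<open>The hypothesis on Z covers only s in I with a later point in I. For the
    remaining s the value 0 is consistent with the equation: left of a the source B' vanishes, and
    from T on the indicator is empty.\<close>
  define Y where "Y = (\<lambda>t s. if s \<in> {a..<T} then indicator {s<..T} t *\<^sub>R (Z t s *v B' s) else 0)"
  have Ys: "(\<lambda>t. Y t s) \<in> borel_measurable borel"
      "(\<integral>\<^sup>+t. ennreal (norm (Y t s)) \<partial>lborel) < \<infinity>"
      "\<And>t. Y t s = indicator {s<..T} t *\<^sub>R (kernel_apply \<alpha> (t - s) (B' s) + vconv \<alpha> (\<lambda>r. A' r *v Y r s) t)" for s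
  proof -
    have "(\<lambda>t. Y t s) \<in> borel_measurable borel \<and> (\<integral>\<^sup>+t. ennreal (norm (Y t s)) \<partial>lborel) < \<infinity> \<and>
      (\<forall>t. Y t s = indicator {s<..T} t *\<^sub>R (kernel_apply \<alpha> (t - s) (B' s) + vconv \<alpha> (\<lambda>r. A' r *v Y r s) t))"
    proof (cases "s \<in> {a..<T}")
      case False
      then have Y0: "Y t s = 0" for t unfolding Y_def by (rule if_not_P)
      have v0: "vconv \<alpha> (\<lambda>r. 0) t = 0" for t by (rule vconv_eq_0[of t]) auto
      have "indicator {s<..T} t *\<^sub>R kernel_apply \<alpha> (t - s) (B' s) = 0" for t
        using False B0[of s] by (cases "s < a") (auto simp: kernel_apply_def vec_eq_iff)
      then show ?thesis by (simp add: Y0 v0)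
    next
      case True
      define J where "J = I \<inter> {s..}"
      define X where "X = (\<lambda>r. indicator {s<..T} r *\<^sub>R Z r s)"
      have sI: "s \<in> I" using True TI by auto
      have sT: "s < T" using True by simp
      have sub: "{s..T} \<subseteq> J" unfolding J_def using True TI by auto
      have z: "(\<lambda>t. Z t s $ i $ j) \<in> RL_AC s J (\<alpha> $ i)"
          "has_RL_deriv s J (\<alpha> $ i) (\<lambda>t. Z t s $ i $ j) (\<lambda>t. (A t ** Z t s) $ i $ j)"
          "frac_int s J (1 - \<alpha> $ i) (\<lambda>t. Z t s $ i $ j) s = mat 1 $ i $ j"
          "continuous_on (I \<inter> {s<..}) (\<lambda>t. Z t s)" for i j
        using Z sI T sT unfolding RL_state_transition_def J_def by (auto simp: row_constant_def)
      have cont: "continuous_on {s<..T} (\<lambda>t. Z t s)"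
        by (rule continuous_on_subset[OF z(4)]) (use sub in \<open>auto simp: J_def\<close>)
      have Aae: "AE r in lborel. r \<in> {s..T} \<longrightarrow> A r = A' r"
        using borel_versionD(4)[OF A_version] by eventually_elim (use True in auto)
      have Xp: "indicator {s<..T} r *\<^sub>R Z r s = X r" for r by (simp add: X_def)
      note entry = RL_state_transition_entry_eq[OF \<alpha>_pos \<alpha>_le_1 sub sT A_measurable Aae M z(1) z(2) z(3) cont, unfolded Xp]
      have YX: "Y t s = X t *v B' s" for t using True by (simp add: Y_def X_def scaleR_matrix_vector_assoc)
      have m: "(\<lambda>t. X t *v B' s) \<in> borel_measurable borel"
        by (intro borel_measurable_matrix_vector_mult entry(1)) simp
      have "integrable lborel (\<lambda>t. \<Sum>i\<in>UNIV. \<bar>(X t *v B' s) $ i\<bar>)"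
        unfolding matrix_vector_mult_def using entry(2) by auto
      then have "(\<integral>\<^sup>+t. ennreal (\<Sum>i\<in>UNIV. \<bar>(X t *v B' s) $ i\<bar>) \<partial>lborel) < \<infinity>"
        by (subst (asm) integrable_iff_bounded) (simp add: abs_of_nonneg sum_nonneg)
      then have fin: "(\<integral>\<^sup>+t. ennreal (norm (X t *v B' s)) \<partial>lborel) < \<infinity>"
        by (rule le_less_trans[rotated]) (intro nn_integral_mono ennreal_leI norm_le_l1_cart)
      have Xeq: "X t *v B' s = indicator {s<..T} t *\<^sub>R (kernel_apply \<alpha> (t - s) (B' s) + vconv \<alpha> (\<lambda>r. A' r *v (X r *v B' s)) t)" for t
      proof (cases "t \<in> {s<..T}")
        case t: True
        have "(Z t s *v B' s) $ i = (kernel_apply \<alpha> (t - s) (B' s) + vconv \<alpha> (\<lambda>r. A' r *v (X r *v B' s)) t) $ i" for i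
        proof -
          have "(Z t s *v B' s) $ i = (\<Sum>j\<in>UNIV. Z t s $ i $ j * B' s $ j)" by (simp add: matrix_vector_mult_def)
          also have "\<dots> = (\<Sum>j\<in>UNIV. (if j = i then rl_kernel (\<alpha> $ i) (t - s) * B' s $ j else 0) +
              kconv (\<alpha> $ i) (\<lambda>r. (A' r ** X r) $ i $ j) t * B' s $ j)"
            by (intro sum.cong refl, subst entry(4)[OF t]) (auto simp: mat_def algebra_simps)
          also have "\<dots> = rl_kernel (\<alpha> $ i) (t - s) * B' s $ i + vconv \<alpha> (\<lambda>r. A' r *v (X r *v B' s)) t $ i"
            unfolding vconv_matrix_vector[OF entry(3)[OF t]] by (simp add: sum.distrib)
          finally show ?thesis by (simp add: kernel_apply_def)
        qed
        then show ?thesis using t by (simp add: X_def vec_eq_iff)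
      qed (simp add: X_def)
      show ?thesis unfolding YX by (intro conjI allI m fin Xeq)
    qed
    then show "(\<lambda>t. Y t s) \<in> borel_measurable borel"
      "(\<integral>\<^sup>+t. ennreal (norm (Y t s)) \<partial>lborel) < \<infinity>"
      "\<And>t. Y t s = indicator {s<..T} t *\<^sub>R (kernel_apply \<alpha> (t - s) (B' s) + vconv \<alpha> (\<lambda>r. A' r *v Y r s) t)" by blast+
  qed
  interpret R: resolvent \<alpha> A' K a T B' L Y
  proof unfold_locales
    show "B' s = 0" if "s \<le> a" for s by (rule B0[OF that])
    show "Y t s = indicator {s<..T} t *\<^sub>R (kernel_apply \<alpha> (t - s) (B' s) + vconv \<alpha> (\<lambda>r. A' r *v Y r s) t)" for t s
      by (rule Ys(3))
  qed (rule Bm norm_B'_le Ys(1) Ys(2))+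
  have Wf: "(\<lambda>s. Z t s *v B s) absolutely_integrable_on {a..t}" "w t = R.W t" if t: "t \<in> {a..T}" for t
  proof -
    have m: "(\<lambda>s. Y t s) \<in> borel_measurable borel" by (rule R.jointly_measurable_section(2)[OF R.Y_jointly_measurable])
    \<comment> \<open>B and B' agree almost everywhere only, and the cuts defining Y may differ from
      {a..t} at the points a and t.\<close>
    have ae: "AE s in lborel. Y t s = indicator {a..t} s *\<^sub>R (Z t s *v B s)"
      using borel_versionD(4)[OF B_version] AE_lborel_singleton[of a] AE_lborel_singleton[of t]
    proof eventually_elim
      case (elim s)
      consider "s < a" | "a < s" "s < t" | "t < s" using elim by linarith
      then show ?case using t elim by cases (auto simp: Y_def)
    qed
    show "(\<lambda>s. Z t s *v B s) absolutely_integrable_on {a..t}"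
      using lebesgue_integral_borel_version(2)[OF m ae] R.Y_integrable_source[of t] by (simp add: set_integrable_def)
    show "w t = R.W t"
      using lebesgue_integral_borel_version(1)[OF m ae] by (simp add: w_def R.W_def set_lebesgue_integral_def)
  qed
  show "(\<lambda>s. Z t s *v B s) absolutely_integrable_on {a..t}" if "t \<in> {a..T}" by (rule Wf(1)[OF that])
  have A0: "A' r = 0" if "r \<notin> {a<..T}" for r using A_version that by (auto simp: borel_version_def)
  define f where "f = (\<lambda>r. A' r *v R.W r)"
  have fm: "f \<in> borel_measurable borel" unfolding f_def by (rule apply_A_measurable[OF R.W_measurable])
  have f0: "f r = 0" if "r \<le> a" for r using A0[of r] that by (simp add: f_def)
  obtain C l where C: "0 \<le> C" "0 < l" "\<And>t. norm (R.W t) \<le> C * exp (l * t)" using R.norm_W_le by blast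
  \<comment> \<open>The bound on W grows exponentially, but A' vanishes beyond T, so its value at T
    suffices.\<close>
  have fM: "norm (f r) \<le> K * (C * exp (l * T))" for r
  proof (cases "r \<in> {a<..T}")
    case True
    have "norm (f r) \<le> K * norm (R.W r)" unfolding f_def by (rule norm_A_le)
    also have "\<dots> \<le> K * (C * exp (l * T))"
    proof (intro mult_left_mono K_nonneg order_trans[OF C(3)])
      show "exp (l * r) \<le> exp (l * T)" using True C(2) by simp
    qed (rule C(1))
    finally show ?thesis .
  qed (use A0 K_nonneg C(1) in \<open>simp add: f_def\<close>)
  have Weq: "R.W t = vconv \<alpha> B' t + vconv \<alpha> f t" if "t \<le> T" for t
    using R.W_eq[OF that] by (simp add: f_def)
  have "continuous_on {a..T} (\<lambda>t. vconv \<alpha> B' t + vconv \<alpha> f t)"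
    by (intro continuous_on_add vconv_continuous_bounded[OF Bm B0 norm_B'_le] vconv_continuous_bounded[OF fm f0 fM])
  then show "continuous_on {a..T} w"
    by (subst continuous_on_cong[OF refl, of _ _ "\<lambda>t. vconv \<alpha> B' t + vconv \<alpha> f t"]) (auto simp: Wf(2) Weq)
  show "w t = vconv \<alpha> (rhs w) t" if t: "t \<in> {a..T}"
  proof -
    have fc: "f = (\<lambda>r. A' r *v cut w r)"
    proof
      fix r
      show "f r = A' r *v cut w r"
        by (cases "r \<in> {a<..T}") (auto simp: f_def Wf(2) A0)
    qed
    have "w t = vconv \<alpha> f t + vconv \<alpha> B' t" using t by (simp add: Wf(2) Weq add.commute)
    also have "\<dots> = vconv \<alpha> (\<lambda>r. f r + B' r) t"
      by (intro vconv_add[symmetric] fm Bm nn_integral_bounded_finite[OF fm f0 fM] nn_integral_bounded_finite[OF Bm B0 norm_B'_le])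
    finally show ?thesis by (simp add: fc)
  qed
qed

lemma solution_formula:
  fixes q\<^sub>a :: "real^'m"
  assumes I: "I \<in> base_intervals a" and T: "T \<in> I"
    and Z: "RL_state_transition I A (row_constant \<alpha>) Z" and M: "\<And>r. norm (A' r) \<le> M"
    and cZ: "Caputo_state_transition I A (row_constant \<alpha>) cZ"
  defines "q \<equiv> (\<lambda>t. cZ t a *v q\<^sub>a + (LINT s:{a..t}|lebesgue. Z t s *v B s))"
  shows "continuous_on {a..T} q" "t \<in> {a..T} \<Longrightarrow> q t = q\<^sub>a + vconv \<alpha> (rhs q) t"
proof -
  define p where "p = (\<lambda>t. cZ t a *v q\<^sub>a)"
  define w where "w = (\<lambda>t. LINT s:{a..t}|lebesgue. Z t s *v B s)"
  have P: "continuous_on {a..T} p" "\<And>t. t \<in> {a..T} \<Longrightarrow> p t = q\<^sub>a + vconv \<alpha> (\<lambda>r. A' r *v cut p r) t"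
    unfolding p_def by (fact Caputo_transition_integral_eq[OF I T cZ])+
  have W: "continuous_on {a..T} w" "\<And>t. t \<in> {a..T} \<Longrightarrow> w t = vconv \<alpha> (rhs w) t"
    unfolding w_def by (fact RL_transition_integral_eq(2,3)[OF I T Z M])+
  have q: "q = (\<lambda>t. p t + w t)" by (simp add: q_def p_def w_def)
  show "continuous_on {a..T} q" unfolding q by (intro continuous_on_add P W)
  interpret C: linear_cauchy \<alpha> A' K a T A "\<lambda>_. 0" "\<lambda>_. 0" 0
    by (rule homogeneous)
  have Pm: "(\<lambda>r. A' r *v cut p r) \<in> borel_measurable borel"
    and P0: "\<And>r. r \<le> a \<Longrightarrow> A' r *v cut p r = 0"
    and Pb: "\<exists>M. \<forall>r. norm (A' r *v cut p r) \<le> M"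
    using C.rhs_version[OF P(1)] by simp_all
  obtain M1 where M1: "\<And>r. norm (A' r *v cut p r) \<le> M1" using Pb by blast
  obtain M2 where M2: "\<And>r. norm (rhs w r) \<le> M2" using rhs_version(2)[OF W(1)] by blast
  show "q t = q\<^sub>a + vconv \<alpha> (rhs q) t" if t: "t \<in> {a..T}"
  proof -
    have "q t = q\<^sub>a + (vconv \<alpha> (\<lambda>r. A' r *v cut p r) t + vconv \<alpha> (rhs w) t)"
      using P(2)[OF t] W(2)[OF t] unfolding q by simp
    also have "\<dots> = q\<^sub>a + vconv \<alpha> (\<lambda>r. A' r *v cut p r + (A' r *v cut w r + B' r)) t"
      by (intro arg_cong[where f = "(+) q\<^sub>a"] vconv_add[symmetric] Pm rhs_version(1)[OF W(1)]
          nn_integral_bounded_finite[OF Pm P0 M1] nn_integral_bounded_finite[OF rhs_version(1)[OF W(1)] rhs_version(3)[OF W(1)] M2])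
    also have "(\<lambda>r. A' r *v cut p r + (A' r *v cut w r + B' r)) = rhs q"
      by (simp add: q scaleR_add_right matrix_vector_right_distrib add.assoc)
    finally show ?thesis .
  qed
qed

end

theorem theorem6:
  fixes a :: real and I :: "real set" and q\<^sub>a \<alpha> :: "real^'m"
    and A :: "real \<Rightarrow> real^'m^'m" and B :: "real \<Rightarrow> real^'m"
    and Z cZ :: "real \<Rightarrow> real \<Rightarrow> real^'m^'m"
  assumes "I \<in> base_intervals a"
    and "\<And>i. 0 < \<alpha> $ i \<and> \<alpha> $ i \<le> 1"
    and "A \<in> Linf_loc I"
    and "B \<in> Linf_loc I"
    and "RL_state_transition I A (row_constant \<alpha>) Z"
    and "Caputo_state_transition I A (row_constant \<alpha>) cZ"
  shows "\<exists>q. maximal_solution a I \<alpha> A B q\<^sub>a q I \<and>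
           (\<forall>q' J. maximal_solution a I \<alpha> A B q\<^sub>a q' J \<longrightarrow> J = I \<and> (\<forall>t\<in>I. q' t = q t)) \<and>
           (\<forall>t\<in>I. (\<lambda>s. Z t s *v B s) absolutely_integrable_on {a..t} \<and>
                  q t = cZ t a *v q\<^sub>a + (LINT s:{a..t}|lebesgue. Z t s *v B s))"
proof -
  note I = assms(1)
  define q where "q = (\<lambda>t. cZ t a *v q\<^sub>a + (LINT s:{a..t}|lebesgue. Z t s *v B s))"
  have versions: "\<exists>A' K B' L M. linear_cauchy \<alpha> A' K a T A B B' L \<and> (\<forall>r. norm (A' r) \<le> M)"
    if T: "T \<in> I" "a < T" for T
  proof -
    have TI: "{a..T} \<subseteq> I" by (rule base_intervalsD(2)[OF I T(1)])
    obtain A' M where A': "borel_version a T A A'" "\<And>r. norm (A' r) \<le> M" "0 \<le> M"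
      using Linf_loc_borel_version[OF assms(3) TI] by blast
    obtain B' L where B': "borel_version a T B B'" "\<And>r. norm (B' r) \<le> L" "0 \<le> L"
      using Linf_loc_borel_version[OF assms(4) TI] by blast
    have "linear_cauchy \<alpha> A' (real CARD('m) * real CARD('m) * M) a T A B B' L"
    proof unfold_locales
      show "norm (A' r *v x) \<le> real CARD('m) * real CARD('m) * M * norm x" for r x
        by (rule order_trans[OF norm_matrix_vector_le]) (intro mult_right_mono mult_left_mono A'(2), auto)
    qed (use assms(2) A' B' T borel_versionD(1)[OF A'(1)] in auto)
    then show ?thesis using A'(2) by blast
  qed
  \<comment> \<open>At t = a the convolution in the integral equation is empty, which leaves the
    initial value.\<close>
  have qa: "q a = q\<^sub>a"
  proof -
    obtain T where T: "T \<in> I" "a < T" using base_intervalsD(3)[OF I] by blast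
    then obtain A' K B' L M where lc: "linear_cauchy \<alpha> A' K a T A B B' L" and M: "\<And>r. norm (A' r) \<le> M"
      using versions by blast
    interpret linear_cauchy \<alpha> A' K a T A B B' L by (rule lc)
    have F: "continuous_on {a..T} q" "\<And>t. t \<in> {a..T} \<Longrightarrow> q t = q\<^sub>a + vconv \<alpha> (rhs q) t"
      unfolding q_def by (fact solution_formula[OF I T(1) assms(5) M assms(6)])+
    have "vconv \<alpha> (rhs q) a = 0"
      by (rule vconv_eq_0[OF rhs_version(3)[OF F(1)]]) auto
    then show ?thesis using F(2)[of a] T by simp
  qed
  have sol: "local_solution a I \<alpha> A B q\<^sub>a q I"
  proof -
    have "(\<lambda>t. q t $ i) \<in> Caputo_AC a I (\<alpha> $ i) \<and> has_Caputo_deriv a I (\<alpha> $ i) (\<lambda>t. q t $ i) (\<lambda>t. (A t *v q t + B t) $ i)" for i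
    proof -
      have rep: "\<exists>gf M. borel_version a T (\<lambda>t. (A t *v q t + B t) $ i) gf \<and> (\<forall>r. \<bar>gf r\<bar> \<le> M) \<and>
          (\<forall>t\<in>{a..T}. q t $ i = q a $ i + kconv (\<alpha> $ i) gf t)" if T: "T \<in> I" "a < T" for T
      proof -
        obtain A' K B' L M where lc: "linear_cauchy \<alpha> A' K a T A B B' L" and M: "\<And>r. norm (A' r) \<le> M"
          using versions[OF T] by blast
        interpret linear_cauchy \<alpha> A' K a T A B B' L by (rule lc)
        have F: "continuous_on {a..T} q" "\<And>t. t \<in> {a..T} \<Longrightarrow> q t = q\<^sub>a + vconv \<alpha> (rhs q) t"
          unfolding q_def by (fact solution_formula[OF I T(1) assms(5) M assms(6)])+
        define g where "g = rhs q"
        obtain N where N: "\<And>r. norm (g r) \<le> N" using rhs_version(2)[OF F(1)] unfolding g_def by blast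
        have "\<bar>g r $ i\<bar> \<le> N" for r by (rule order_trans[OF component_le_norm_cart N])
        moreover have "borel_version a T (\<lambda>t. (A t *v q t + B t) $ i) (\<lambda>r. g r $ i)"
          unfolding g_def by (rule rhs_version(4)[OF F(1)])
        moreover have "q t $ i = q a $ i + kconv (\<alpha> $ i) (\<lambda>r. g r $ i) t" if "t \<in> {a..T}" for t
          by (subst F(2)[OF that]) (simp add: vconv_def qa g_def)
        ultimately show ?thesis by blast
      qed
      show ?thesis using Caputo_solutionI[OF I _ _ rep] assms(2)[of i] by blast
    qed
    then show ?thesis using I qa by (simp add: local_solution_def)
  qed
  have unique: "q' t = q t" if sol': "local_solution a I \<alpha> A B q\<^sub>a q' J" and t: "t \<in> J" for q' J t
  proof -
    have J: "J \<in> base_intervals a" "J \<subseteq> I" using sol' by (auto simp: local_solution_def)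
    show ?thesis
    proof (cases "t = a")
      case True
      then show ?thesis using sol' qa by (simp add: local_solution_def)
    next
      case False
      then have at: "a < t" using base_intervalsD(4)[OF J(1) t] by simp
      have tI: "t \<in> I" using t J by blast
      \<comment> \<open>The comparison with the global solution runs on {a..t}, with t itself as
        right end; this interval lies in both domains.\<close>
      then obtain A' K B' L M where lc: "linear_cauchy \<alpha> A' K a t A B B' L"
        using versions at by blast
      interpret linear_cauchy \<alpha> A' K a t A B B' L by (rule lc)
      have cont: "continuous_on {a..t} x" if s: "local_solution a I \<alpha> A B q\<^sub>a x J'" and t: "t \<in> J'" for x J'
      proof -
        have "continuous_on J' (\<lambda>t. \<chi> i. x t $ i)"
          using s by (intro continuous_on_vec_lambda) (auto simp: local_solution_def Caputo_AC_def)
        moreover have "{a..t} \<subseteq> J'" using s base_intervalsD(2)[OF _ t] by (auto simp: local_solution_def)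
        ultimately show ?thesis by (auto intro: continuous_on_subset)
      qed
      show ?thesis
        by (rule integral_eq_unique[OF cont[OF sol' t] local_solution_integral_eq[OF sol' t]
              cont[OF sol tI] local_solution_integral_eq[OF sol tI]]) (use at in auto)
    qed
  qed
  have "maximal_solution a I \<alpha> A B q\<^sub>a q I"
    unfolding maximal_solution_def using sol by (auto simp: local_solution_def)
  moreover have "J = I \<and> (\<forall>t\<in>I. q' t = q t)" if max: "maximal_solution a I \<alpha> A B q\<^sub>a q' J" for q' J
  proof -
    have s: "local_solution a I \<alpha> A B q\<^sub>a q' J" using max by (simp add: maximal_solution_def)
    have eq: "q' t = q t" if "t \<in> J" for t by (rule unique[OF s that])
    have "J \<subseteq> I" using s by (simp add: local_solution_def)
    \<comment> \<open>The global solution agrees with q' on J and hence extends it, so maximality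
      leaves no smaller domain.\<close>
    then have "I = J" using max sol eq unfolding maximal_solution_def by (metis (no_types, lifting))
    then show ?thesis using eq by blast
  qed
  moreover have "(\<lambda>s. Z t s *v B s) absolutely_integrable_on {a..t}" if t: "t \<in> I" for t
  proof -
    \<comment> \<open>T may have to exceed t: for t = a the interval {a..t} is degenerate, and
      \<open>linear_cauchy\<close> requires a < T.\<close>
    obtain T where T: "T \<in> I" "a < T" "t \<le> T"
    proof (cases "t = a")
      case True
      then show ?thesis using base_intervalsD(3)[OF I] that by auto
    next
      case False
      then show ?thesis using base_intervalsD(4)[OF I t] that[OF t] by simp
    qed
    obtain A' K B' L M where lc: "linear_cauchy \<alpha> A' K a T A B B' L" and M: "\<And>r. norm (A' r) \<le> M"
      using versions[OF T(1,2)] by blast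
    interpret linear_cauchy \<alpha> A' K a T A B B' L by (rule lc)
    show ?thesis
      by (rule RL_transition_integral_eq(1)[OF I T(1) assms(5) M]) (use T base_intervalsD(4)[OF I t] in auto)
  qed
  ultimately show ?thesis unfolding q_def by blast
qed

end
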